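(* Let $\sigma>0$ and let $(Y_1,X_1),\dots,(Y_n,X_n)$ be an i.i.d. sample of $(Y,X)$ obeying $Y=\int_0^1\beta(t)X(t)\,dt+\sigma\epsilon$. Suppose that $X$ is second order stationary, that its covariance operator $T$ has associated sequence of eigenvalues $(\lambda_j)_{j\ge1}\in\mathcal S_\upsilon^d$, $d\ge1$, and that $X\in\mathcal X^{4k}_\eta$ and $\epsilon\in\mathcal E^{4k}_\eta$ for some integer $k\ge4$ and $\eta\ge1$. Let $p\ge0$, $\rho>0$, put $\gamma:=w^p$ and $\omega:=\upsilon$, and suppose that for some $\triangle\ge1$ (not depending on $n$) there is $k_n^*\in\mathbb N$ with $$\frac1\triangle\le\frac{\gamma_{k_n^*}}{n\,\omega_{k_n^*}}\sum_{j=1}^{k_n^*}\frac{\omega_j}{\upsilon_j}\le\triangle .$$ Consider the estimator $$\widehat\beta=\sum_{j=1}^m\frac{\widehat g_j}{\widehat\lambda_j}\,\mathbf 1\{\widehat\lambda_j\ge\alpha\}\,\psi_j$$ with dimension parameter $m=m(n)\in\mathbb N$ and threshold $\alpha=\alpha(n)>0$ specified, in each case, only up to order as follows. (i) In the polynomial case, i.e. $\upsilon_1=1$ and $\upsilon_j=j^{-2a}$, $j\ge2$, for some $a>1/2$, with dimension $m\sim n^{1/(2p+2a+1)}$ and threshold $\alpha\sim1/n$, we have $$\sup_{\beta\in\mathcal W_p^\rho}\mathbb E\langle T(\widehat\beta-\beta),\widehat\beta-\beta\rangle\lesssim n^{-(2p+2a)/(2p+2a+1)}.$$ (ii) In the exponential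 case, i.e. $\upsilon_1=1$ and $\upsilon_j=\exp(-j^{2a})$, $j\ge2$, for some $a>0$, with dimension $m\sim(\log n)^{1/(2a)}$ and threshold $\alpha\sim1/n$, we have $$\sup_{\beta\in\mathcal W_p^\rho}\mathbb E\langle T(\widehat\beta-\beta),\widehat\beta-\beta\rangle\lesssim n^{-1}(\log n)^{1/(2a)}.$$
   Context: $L^2[0,1]$ has its usual inner product $\langle\cdot,\cdot\rangle$ and norm $\|\cdot\|$. Model: $Y=\int_0^1\beta(t)X(t)dt+\sigma\epsilon$, where $\beta\in L^2[0,1]$, $X$ is a random function with values in $L^2[0,1]$, centered, with $\mathbb E\|X\|^2<\infty$, and $\epsilon$ is a real error term with mean zero and variance one, uncorrelated with $X$ (i.e. $\mathbb E[\epsilon\langle X,f\rangle]=0$ for all $f\in L^2[0,1]$). The expectation is taken under the distribution of the sample with slope $\beta$. Trigonometric basis of $L^2[0,1]$: $\psi_1\equiv1$, $\psi_{2j}(s)=\sqrt2\cos(2\pi js)$, $\psi_{2j+1}(s)=\sqrt2\sin(2\pi js)$, $j\in\mathbb N=\{1,2,\dots\}$. $X$ is second order stationary: $\mathrm{Cov}(X(t),X(s))=c(t-s)$ for $s,t\in[0,1]$, with $c:[-1,1]\to\mathbb R$ positive definite. Its covariance operator is $(Tf)(s)=\int_0^1\mathrm{Cov}(X(t),X(s))f(t)dt$. Standing property: $T$ is strictly positive and diagonal in the trigonometric basis, $T\psi_j=\lambda_j\psi_j$ with $\lambda_j=\mathbb E\langle X,\psi_j\rangle^2>0$ for all $j\ge1$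 (so $\langle X,\psi_j\rangle/\sqrt{\lambda_j}$, $j\ge1$, are centered, of variance one and pairwise uncorrelated). For $d\ge1$: $\mathcal S_\upsilon^d=\{(\lambda_j)_{j\ge1}:1/d\le\lambda_j/\upsilon_j\le d\ \ \forall j\in\mathbb N\}$. $\mathcal X$ is the set of centered second order stationary random functions $X$ with $\mathbb E\|X\|^2<\infty$ and strictly positive covariance operator. For $r\in\mathbb N$, $\eta\ge1$: $\mathcal X^r_\eta$ is the set of $X\in\mathcal X$ with $\sup_{j\in\mathbb N}\mathbb E|\langle X,\psi_j\rangle/\sqrt{\lambda_j}|^r\le\eta$, and $\mathcal E^r_\eta$ is the set of centered error terms $\epsilon$ with variance one and $\mathbb E|\epsilon|^r\le\eta$. $\widehat g_j=\frac1n\sum_{i=1}^nY_i\langle X_i,\psi_j\rangle$ and $\widehat\lambda_j=\frac1n\sum_{i=1}^n\langle X_i,\psi_j\rangle^2$. Weights: $w_1^p=1$, $w_{2j}^p=w_{2j+1}^p=j^{2p}$ for $j\in\mathbb N$. The Sobolev ellipsoid of periodic functions is $\mathcal W_p^\rho=\{f\in L^2[0,1]:\sum_{j\ge1}w_j^p|\langle f,\psi_j\rangle|^2\le\rho\}$ (for $p=0$ this is an ellipsoid in $L^2[0,1]$ without smoothness restriction). $a_n\lesssim b_n$ means that there is $C>0$ with $a_n\le C\,b_n$ for all sufficiently large $n$ ($C$ may depend on the fixed parameters but not on $n$); $a_n\sim b_n$ means $a_n\lesssim b_n$ and $b_n\lesssim a_n$.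
   Formalization: In (ii) the dimension m is also required to satisfy m ≥ k_n^* for all large n: for arbitrary m ~ (log n)^{1/(2a)} the bound fails, e.g. a=1/2, p=0, m=⌊(log n)/2⌋, β=√ρ ψ_{m+1}, where the risk is at least of order n^{-1/2}. *)

theory Defs
  imports "HOL-Probability.Probability"
begin

section \<open>The space of square integrable functions on the unit interval\<close>

text \<open>Elements of the space are represented by Borel functions; their values outside
  the unit interval play no role, and equality in the space is equality almost
  everywhere with respect to the measure below.\<close>

definition unit_leb :: "real measure" where
  "unit_leb = restrict_space lborel {0..1}"

definition L2 :: "(real \<Rightarrow> real) set" where
  "L2 = {f \<in> borel_measurable unit_leb. integrable unit_leb (\<lambda>t. (f t)\<^sup>2)}"

definition ip :: "(real \<Rightarrow> real) \<Rightarrow> (real \<Rightarrow> real) \<Rightarrow> real" where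
  "ip f g = (\<integral>t. f t * g t \<partial>unit_leb)"

text \<open>The sigma-algebra generated by the continuous linear functionals. By separability
  it is the Borel sigma-algebra of the norm topology.\<close>

definition L2_space :: "(real \<Rightarrow> real) measure" where
  "L2_space = sigma L2 {{g \<in> L2. ip g f \<in> B} | f B. f \<in> L2 \<and> B \<in> sets borel}"

text \<open>The trigonometric basis is indexed from 1; the value at index 0 is never used.\<close>

definition psi :: "nat \<Rightarrow> real \<Rightarrow> real" where
  "psi j s =
    (if j = 1 then 1
     else if even j then sqrt 2 * cos (2 * pi * real (j div 2) * s)
     else sqrt 2 * sin (2 * pi * real (j div 2) * s))"

definition sobolev_weight :: "real \<Rightarrow> nat \<Rightarrow> real" where
  "sobolev_weight p j = (if j = 1 then 1 else real (j div 2) powr (2 * p))"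

definition sobolev_ellipsoid :: "real \<Rightarrow> real \<Rightarrow> (real \<Rightarrow> real) set" where
  "sobolev_ellipsoid p \<rho> =
    {f \<in> L2. (\<Sum>j. ennreal (sobolev_weight p (Suc j) * \<bar>ip f (psi (Suc j))\<bar>\<^sup>2)) \<le> ennreal \<rho>}"

section \<open>Random functions and error terms\<close>

definition covar :: "'a measure \<Rightarrow> ('a \<Rightarrow> real) \<Rightarrow> ('a \<Rightarrow> real) \<Rightarrow> real" where
  "covar M A B = (\<integral>x. (A x - (\<integral>y. A y \<partial>M)) * (B x - (\<integral>y. B y \<partial>M)) \<partial>M)"

text \<open>Because covariances at individual time points are used, a random function is a
  jointly measurable process, all of whose paths are square integrable.\<close>

definition random_function :: "'a measure \<Rightarrow> ('a \<Rightarrow> real \<Rightarrow> real) \<Rightarrow> bool" where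
  "random_function M X \<longleftrightarrow>
    (\<lambda>(x, t). X x t) \<in> borel_measurable (M \<Otimes>\<^sub>M unit_leb) \<and> (\<forall>x \<in> space M. X x \<in> L2)"

definition cov_op :: "'a measure \<Rightarrow> ('a \<Rightarrow> real \<Rightarrow> real) \<Rightarrow> (real \<Rightarrow> real) \<Rightarrow> real \<Rightarrow> real" where
  "cov_op M X f s = (\<integral>t. covar M (\<lambda>x. X x t) (\<lambda>x. X x s) * f t \<partial>unit_leb)"

text \<open>Finitely many points whose differences all lie in the domain [-1, 1] can be
  translated into the unit interval.\<close>

definition positive_definite :: "(real \<Rightarrow> real) \<Rightarrow> bool" where
  "positive_definite c \<longleftrightarrow>
    (\<forall>(n::nat) t a. (\<forall>i<n. t i \<in> {0..1}) \<longrightarrow>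
       0 \<le> (\<Sum>i<n. \<Sum>j<n. a i * a j * c (t i - t j)))"

definition second_order_stationary :: "'a measure \<Rightarrow> ('a \<Rightarrow> real \<Rightarrow> real) \<Rightarrow> bool" where
  "second_order_stationary M X \<longleftrightarrow>
    (\<forall>t \<in> {0..1}. (\<lambda>x. X x t) \<in> borel_measurable M \<and> integrable M (\<lambda>x. (X x t)\<^sup>2)) \<and>
    (\<exists>c. positive_definite c \<and>
       (\<forall>s \<in> {0..1}. \<forall>t \<in> {0..1}. covar M (\<lambda>x. X x t) (\<lambda>x. X x s) = c (t - s)))"

definition strictly_positive_op :: "((real \<Rightarrow> real) \<Rightarrow> real \<Rightarrow> real) \<Rightarrow> bool" where
  "strictly_positive_op T \<longleftrightarrow> (\<forall>f \<in> L2. ip f f > 0 \<longrightarrow> ip (T f) f > 0)"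

definition regressors :: "'a measure \<Rightarrow> ('a \<Rightarrow> real \<Rightarrow> real) set" where
  "regressors M =
    {X. random_function M X \<and>
        (\<forall>t \<in> {0..1}. (\<integral>x. X x t \<partial>M) = 0) \<and>
        second_order_stationary M X \<and>
        (\<integral>\<^sup>+ x. ennreal (ip (X x) (X x)) \<partial>M) < \<infinity> \<and>
        strictly_positive_op (cov_op M X)}"

definition eigval :: "'a measure \<Rightarrow> ('a \<Rightarrow> real \<Rightarrow> real) \<Rightarrow> nat \<Rightarrow> real" where
  "eigval M X j = (\<integral>x. (ip (X x) (psi j))\<^sup>2 \<partial>M)"

text \<open>This does not follow from stationarity on the unit interval alone (it amounts to
  a covariance function of period one), hence it is a separate condition.\<close>

definition trig_diagonal :: "'a measure \<Rightarrow> ('a \<Rightarrow> real \<Rightarrow> real) \<Rightarrow> bool" where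
  "trig_diagonal M X \<longleftrightarrow>
    (\<forall>j\<ge>1. eigval M X j > 0 \<and>
       (AE s in unit_leb. cov_op M X (psi j) s = eigval M X j * psi j s))"

definition regressors_moment :: "'a measure \<Rightarrow> nat \<Rightarrow> real \<Rightarrow> ('a \<Rightarrow> real \<Rightarrow> real) set" where
  "regressors_moment M r \<eta> =
    {X \<in> regressors M.
       (SUP j\<in>{1..}. \<integral>\<^sup>+ x. ennreal (\<bar>ip (X x) (psi j) / sqrt (eigval M X j)\<bar> ^ r) \<partial>M)
         \<le> ennreal \<eta>}"

definition errors_moment :: "'a measure \<Rightarrow> nat \<Rightarrow> real \<Rightarrow> ('a \<Rightarrow> real) set" where
  "errors_moment M r \<eta> =
    {e \<in> borel_measurable M.
       integrable M (\<lambda>x. (e x)\<^sup>2) \<and> (\<integral>x. e x \<partial>M) = 0 \<and> covar M e e = 1 \<and>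
       (\<integral>\<^sup>+ x. ennreal (\<bar>e x\<bar> ^ r) \<partial>M) \<le> ennreal \<eta>}"

definition uncorrelated :: "'a measure \<Rightarrow> ('a \<Rightarrow> real) \<Rightarrow> ('a \<Rightarrow> real \<Rightarrow> real) \<Rightarrow> bool" where
  "uncorrelated M e X \<longleftrightarrow> (\<forall>f \<in> L2. (\<integral>x. e x * ip (X x) f \<partial>M) = 0)"

definition eigval_class :: "(nat \<Rightarrow> real) \<Rightarrow> real \<Rightarrow> (nat \<Rightarrow> real) set" where
  "eigval_class \<upsilon> d = {l. \<forall>j\<ge>1. 1 / d \<le> l j / \<upsilon> j \<and> l j / \<upsilon> j \<le> d}"

section \<open>Sample, estimator and risk\<close>

text \<open>The pairs \<open>(es i, Xs i)\<close>, for \<open>i\<close> at least 1, are independent copies of \<open>(e, X)\<close>.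
  For every slope \<open>\<beta>\<close> this is the same as \<open>(response \<beta> \<sigma> Xs es i, Xs i)\<close> being
  independent copies of \<open>(Y, X)\<close>, because the model equation can be solved for the error.
  A single sequence serves all sample sizes: the risk at sample size \<open>n\<close> only depends
  on the joint law of the first \<open>n\<close> pairs.\<close>

definition iid_copies ::
  "'a measure \<Rightarrow> ('a \<Rightarrow> real) \<Rightarrow> ('a \<Rightarrow> real \<Rightarrow> real) \<Rightarrow>
   'b measure \<Rightarrow> (nat \<Rightarrow> 'b \<Rightarrow> real) \<Rightarrow> (nat \<Rightarrow> 'b \<Rightarrow> real \<Rightarrow> real) \<Rightarrow> bool" where
  "iid_copies M e X N es Xs \<longleftrightarrow>
    prob_space.indep_vars N (\<lambda>_. borel \<Otimes>\<^sub>M L2_space) (\<lambda>i w. (es i w, Xs i w)) {1..} \<and>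
    (\<forall>i\<ge>1. distr N (borel \<Otimes>\<^sub>M L2_space) (\<lambda>w. (es i w, Xs i w)) =
            distr M (borel \<Otimes>\<^sub>M L2_space) (\<lambda>x. (e x, X x)))"

definition response ::
  "(real \<Rightarrow> real) \<Rightarrow> real \<Rightarrow> (nat \<Rightarrow> 'b \<Rightarrow> real \<Rightarrow> real) \<Rightarrow> (nat \<Rightarrow> 'b \<Rightarrow> real) \<Rightarrow> nat \<Rightarrow> 'b \<Rightarrow> real"
  where "response \<beta> \<sigma> Xs es i w = ip \<beta> (Xs i w) + \<sigma> * es i w"

definition g_hat :: "nat \<Rightarrow> (nat \<Rightarrow> real) \<Rightarrow> (nat \<Rightarrow> real \<Rightarrow> real) \<Rightarrow> nat \<Rightarrow> real" where
  "g_hat n y x j = (1 / real n) * (\<Sum>i=1..n. y i * ip (x i) (psi j))"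

definition lambda_hat :: "nat \<Rightarrow> (nat \<Rightarrow> real \<Rightarrow> real) \<Rightarrow> nat \<Rightarrow> real" where
  "lambda_hat n x j = (1 / real n) * (\<Sum>i=1..n. (ip (x i) (psi j))\<^sup>2)"

definition beta_hat ::
  "nat \<Rightarrow> nat \<Rightarrow> real \<Rightarrow> (nat \<Rightarrow> real) \<Rightarrow> (nat \<Rightarrow> real \<Rightarrow> real) \<Rightarrow> real \<Rightarrow> real" where
  "beta_hat n m \<alpha> y x t =
    (\<Sum>j=1..m. g_hat n y x j / lambda_hat n x j * (if lambda_hat n x j \<ge> \<alpha> then 1 else 0) * psi j t)"

text \<open>The expectation under slope \<open>\<beta>\<close> of the squared prediction error; an extended
  nonnegative integral, so that an infinite risk is not mistaken for 0.\<close>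

definition prediction_risk ::
  "'a measure \<Rightarrow> ('a \<Rightarrow> real \<Rightarrow> real) \<Rightarrow> 'b measure \<Rightarrow> (nat \<Rightarrow> 'b \<Rightarrow> real) \<Rightarrow>
   (nat \<Rightarrow> 'b \<Rightarrow> real \<Rightarrow> real) \<Rightarrow> real \<Rightarrow> nat \<Rightarrow> nat \<Rightarrow> real \<Rightarrow> (real \<Rightarrow> real) \<Rightarrow> ennreal" where
  "prediction_risk M X N es Xs \<sigma> n m \<alpha> \<beta> =
    (\<integral>\<^sup>+ w. (let \<Delta> = (\<lambda>t. beta_hat n m \<alpha> (\<lambda>i. response \<beta> \<sigma> Xs es i w) (\<lambda>i. Xs i w) t - \<beta> t)
             in ennreal (ip (cov_op M X \<Delta>) \<Delta>)) \<partial>N)"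

definition lesssim :: "(nat \<Rightarrow> ennreal) \<Rightarrow> (nat \<Rightarrow> ennreal) \<Rightarrow> bool" where
  "lesssim a b \<longleftrightarrow> (\<exists>C::real. C > 0 \<and> (\<forall>\<^sub>F n in sequentially. a n \<le> ennreal C * b n))"

text \<open>Only meant for nonnegative sequences.\<close>

definition same_order :: "(nat \<Rightarrow> real) \<Rightarrow> (nat \<Rightarrow> real) \<Rightarrow> bool" where
  "same_order a b \<longleftrightarrow>
    lesssim (\<lambda>n. ennreal (a n)) (\<lambda>n. ennreal (b n)) \<and>
    lesssim (\<lambda>n. ennreal (b n)) (\<lambda>n. ennreal (a n))"

end

theory Submission
  imports Defs
begin

text \<open>
  Because the covariance operator is diagonal in the trigonometric basis, the prediction risk is
  the sum over \<open>j\<close> of the eigenvalue \<open>\<lambda>\<^sub>j\<close> times the mean squared error of the \<open>j\<close>-th coefficient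
  (\<open>cov_op_quadratic_form\<close>). This identity rests on the completeness of the
  basis (\<open>parseval\<close>), which is proved from the Stone-Weierstrass theorem on the circle.

  With \<open>b\<close> the slope without its \<open>j\<close>-th component, the empirical cross covariance is the \<open>j\<close>-th
  coefficient of the slope times the empirical eigenvalue plus a centered mean of the products of
  \<open>\<langle>X\<^sub>i, \<psi>\<^sub>j\<rangle>\<close> and the noise \<open>\<langle>X\<^sub>i, b\<rangle> + \<sigma> * \<epsilon>\<^sub>i\<close>. That mean has variance of order \<open>\<lambda>\<^sub>j / n\<close>
  (\<open>score_second_moment\<close>), so division by the eigenvalue \<open>\<lambda>\<^sub>j\<close> costs a mean squared error of order \<open>1 / (n * \<lambda>\<^sub>j)\<close>,
  and each of the \<open>m\<close> estimated coefficients contributes \<open>1 / n\<close> to the risk, however small its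
  eigenvalue is.

  Two things can go wrong. The empirical eigenvalue may be less than half the true one; this has
  an exponentially small probability, because lower tails of means of nonnegative variables are
  exponential as soon as second moments exist (\<open>lower_tail_nonneg\<close>). On this event the threshold, of order
  \<open>1 / n\<close>, limits the damage to a power of \<open>n\<close>. Or the coefficient may be discarded because its
  eigenvalue is itself below a multiple of the threshold; then its contribution is at most that
  multiple of \<open>1 / n\<close> times the squared coefficient of the slope. Altogether the risk is at most a
  multiple of \<open>m / n\<close> plus the bias from the coefficients beyond \<open>m\<close>, uniformly over the ellipsoid
  (\<open>risk_bound\<close>). The bias is at most \<open>\<rho>\<close> times the largest ratio \<open>\<lambda>\<^sub>j / w\<^sub>j\<close> with \<open>j > m\<close>, and the prescribed
  orders of \<open>m\<close> bring both parts to the claimed rate (\<open>polynomial_rate\<close>, \<open>exponential_rate\<close>).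
\<close>

section \<open>Square integrable functions and the trigonometric system\<close>

lemma space_unit_leb [simp]: "space unit_leb = {0..1}"
  by (simp add: unit_leb_def space_restrict_space)

lemma sets_unit_leb: "sets unit_leb = sets (restrict_space borel {0..1})"
  by (simp add: unit_leb_def sets_restrict_space)

lemma prob_space_unit_leb: "prob_space unit_leb"
  by (rule prob_spaceI) (simp add: unit_leb_def space_restrict_space emeasure_restrict_space)

interpretation U: prob_space unit_leb by (rule prob_space_unit_leb)

lemma borel_measurable_unit_leb:
  "f \<in> borel_measurable borel \<Longrightarrow> f \<in> borel_measurable unit_leb"
  unfolding measurable_cong_sets[OF sets_unit_leb refl] by (rule measurable_restrict_space1)

lemma integral_unit_leb_FTC:
  fixes F f :: "real \<Rightarrow> real"
  assumes "\<And>t. (F has_real_derivative f t) (at t)" "continuous_on UNIV f"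
  shows "(\<integral>t. f t \<partial>unit_leb) = F 1 - F 0"
proof -
  have "(\<integral>t. f t \<partial>unit_leb) = (\<integral>t. indicator {0..1} t *\<^sub>R f t \<partial>lborel)"
    unfolding unit_leb_def by (subst integral_restrict_space) auto
  also have "\<dots> = F 1 - F 0"
    using assms by (intro integral_FTC_atLeastAtMost)
      (auto simp: has_real_derivative_iff_has_vector_derivative[symmetric]
        intro: DERIV_subset continuous_on_subset)
  finally show ?thesis .
qed

lemma integral_cos_period:
  "(\<integral>t. cos (2 * pi * of_int k * t) \<partial>unit_leb) = (if k = 0 then 1 else 0)"
proof (cases "k = 0")
  case True
  then show ?thesis using U.prob_space by simp
next
  case False
  have "(\<integral>t. cos (2 * pi * of_int k * t) \<partial>unit_leb)
    = sin (2 * pi * of_int k * 1) / (2 * pi * of_int k) - sin (2 * pi * of_int k * 0) / (2 * pi * of_int k)"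
    using False by (intro integral_unit_leb_FTC) (auto intro!: derivative_eq_intros continuous_intros)
  also have "\<dots> = 0" using sin_int_2pin[of k] by simp
  finally show ?thesis using False by simp
qed

lemma integral_sin_period:
  "(\<integral>t. sin (2 * pi * of_int k * t) \<partial>unit_leb) = 0"
proof (cases "k = 0")
  case False
  have "(\<integral>t. sin (2 * pi * of_int k * t) \<partial>unit_leb)
    = - cos (2 * pi * of_int k * 1) / (2 * pi * of_int k) - - cos (2 * pi * of_int k * 0) / (2 * pi * of_int k)"
    using False by (intro integral_unit_leb_FTC) (auto intro!: derivative_eq_intros continuous_intros)
  also have "\<dots> = 0" using cos_int_2pin[of k] by simp
  finally show ?thesis .
qed auto

lemma L2_measurable: "f \<in> L2 \<Longrightarrow> f \<in> borel_measurable unit_leb"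
  by (simp add: L2_def)

lemma L2_integrable_sq: "f \<in> L2 \<Longrightarrow> integrable unit_leb (\<lambda>t. (f t)\<^sup>2)"
  by (simp add: L2_def)

lemma L2_bounded:
  assumes "f \<in> borel_measurable unit_leb" "\<And>t. t \<in> {0..1} \<Longrightarrow> \<bar>f t\<bar> \<le> B"
  shows "f \<in> L2"
proof -
  have "integrable unit_leb (\<lambda>t. (f t)\<^sup>2)"
    using assms by (intro U.integrable_const_bound[of _ "B\<^sup>2"] AE_I2)
      (auto intro!: abs_le_square_iff[THEN iffD1] intro: order_trans[OF _ abs_ge_self])
  then show ?thesis using assms by (simp add: L2_def)
qed

lemma abs_mult_le_half: "\<bar>a * b\<bar> \<le> a\<^sup>2 / 2 + b\<^sup>2 / (2 :: real)"
proof -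
  have "2 * \<bar>a\<bar> * \<bar>b\<bar> \<le> \<bar>a\<bar>\<^sup>2 + \<bar>b\<bar>\<^sup>2" by (rule sum_squares_bound)
  then show ?thesis by (simp add: abs_mult)
qed

lemma integrable_mult_sq:
  fixes A B :: "'a \<Rightarrow> real"
  assumes [measurable]: "A \<in> borel_measurable M" "B \<in> borel_measurable M"
    and "integrable M (\<lambda>x. (A x)\<^sup>2)" "integrable M (\<lambda>x. (B x)\<^sup>2)"
  shows "integrable M (\<lambda>x. A x * B x)"
proof (rule Bochner_Integration.integrable_bound)
  show "integrable M (\<lambda>x. (A x)\<^sup>2 / 2 + (B x)\<^sup>2 / 2)" using assms by simp
  show "AE x in M. norm (A x * B x) \<le> norm ((A x)\<^sup>2 / 2 + (B x)\<^sup>2 / 2)"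
    using abs_mult_le_half by (intro AE_I2) simp
qed simp

lemma L2_integrable_mult: "f \<in> L2 \<Longrightarrow> g \<in> L2 \<Longrightarrow> integrable unit_leb (\<lambda>t. f t * g t)"
  by (intro integrable_mult_sq L2_measurable L2_integrable_sq)

lemma L2_add:
  assumes "f \<in> L2" "g \<in> L2"
  shows "(\<lambda>t. f t + g t) \<in> L2"
proof -
  have "integrable unit_leb (\<lambda>t. (f t)\<^sup>2 + (g t)\<^sup>2 + 2 * (f t * g t))"
    using assms by (intro Bochner_Integration.integrable_add integrable_mult_right
        L2_integrable_sq L2_integrable_mult)
  moreover have "(\<lambda>t. f t + g t) \<in> borel_measurable unit_leb"
    using assms[THEN L2_measurable] by (rule borel_measurable_add)
  ultimately show ?thesis by (simp add: L2_def power2_sum mult.assoc)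
qed

lemma L2_scale: "f \<in> L2 \<Longrightarrow> (\<lambda>t. c * f t) \<in> L2"
  by (auto simp: L2_def power_mult_distrib)

lemma L2_diff: "f \<in> L2 \<Longrightarrow> g \<in> L2 \<Longrightarrow> (\<lambda>t. f t - g t) \<in> L2"
  using L2_add[of f "\<lambda>t. - 1 * g t"] L2_scale[of g "- 1"] by simp

lemma L2_zero: "(\<lambda>t. 0) \<in> L2" by (simp add: L2_def)

lemma L2_sum: "(\<And>i. i \<in> A \<Longrightarrow> f i \<in> L2) \<Longrightarrow> (\<lambda>t. \<Sum>i\<in>A. f i t) \<in> L2"
  by (induction A rule: infinite_finite_induct) (auto intro: L2_zero L2_add)

lemma L2_abs: "f \<in> L2 \<Longrightarrow> (\<lambda>t. \<bar>f t\<bar>) \<in> L2"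
  by (auto simp: L2_def)

lemma ip_commute: "ip f g = ip g f"
  by (simp add: ip_def mult.commute)

lemma ip_self_nonneg: "0 \<le> ip f f"
  by (simp add: ip_def)

lemma ip_add_left: "f \<in> L2 \<Longrightarrow> g \<in> L2 \<Longrightarrow> h \<in> L2 \<Longrightarrow> ip (\<lambda>t. f t + g t) h = ip f h + ip g h"
  by (simp add: ip_def distrib_right L2_integrable_mult)

lemma ip_scale_left: "ip (\<lambda>t. c * f t) h = c * ip f h"
  by (simp add: ip_def mult.assoc)

lemma ip_diff_left: "f \<in> L2 \<Longrightarrow> g \<in> L2 \<Longrightarrow> h \<in> L2 \<Longrightarrow> ip (\<lambda>t. f t - g t) h = ip f h - ip g h"
  by (simp add: ip_def left_diff_distrib L2_integrable_mult)

lemma ip_sum_left: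
  assumes "\<And>i. i \<in> A \<Longrightarrow> f i \<in> L2" "h \<in> L2"
  shows "ip (\<lambda>t. \<Sum>i\<in>A. f i t) h = (\<Sum>i\<in>A. ip (f i) h)"
  using assms by (simp add: ip_def sum_distrib_right L2_integrable_mult)

lemmas ip_add_right = ip_add_left[where h = h, unfolded ip_commute[of _ h]] for h
lemmas ip_scale_right = ip_scale_left[where h = h, unfolded ip_commute[of _ h]] for h
lemmas ip_diff_right = ip_diff_left[where h = h, unfolded ip_commute[of _ h]] for h
lemmas ip_sum_right = ip_sum_left[where h = h, unfolded ip_commute[of _ h]] for h

lemma ip_Cauchy_Schwarz:
  assumes f: "f \<in> L2" and g: "g \<in> L2"
  shows "(ip f g)\<^sup>2 \<le> ip f f * ip g g"
proof -
  have quad: "0 \<le> ip f f - 2 * c * ip f g + c\<^sup>2 * ip g g" for c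
  proof -
    have "0 \<le> ip (\<lambda>t. f t - c * g t) (\<lambda>t. f t - c * g t)" by (rule ip_self_nonneg)
    also have "\<dots> = ip f f - 2 * c * ip f g + c\<^sup>2 * ip g g"
      by (simp add: ip_diff_left ip_diff_right ip_scale_left ip_scale_right f g L2_diff L2_scale
          power2_eq_square algebra_simps ip_commute[of g f])
    finally show ?thesis .
  qed
  show ?thesis
  proof (cases "ip g g = 0")
    case False
    then have "ip g g > 0" using ip_self_nonneg[of g] by simp
    then show ?thesis using quad[of "ip f g / ip g g"]
      by (simp add: power_divide field_simps power2_eq_square)
  next
    case True
    have "ip f g = 0"
    proof (rule ccontr)
      assume "ip f g \<noteq> 0"
      then show False using quad[of "(ip f f + 1) / (2 * ip f g)"] True by simp
    qed
    then show ?thesis using True by simp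
  qed
qed

lemma ip_self_add_le:
  assumes f: "f \<in> L2" and g: "g \<in> L2"
  shows "ip (\<lambda>t. f t + g t) (\<lambda>t. f t + g t) \<le> 2 * ip f f + 2 * ip g g"
proof -
  have "0 \<le> ip (\<lambda>t. f t - g t) (\<lambda>t. f t - g t)" by (rule ip_self_nonneg)
  then show ?thesis
    by (simp add: ip_diff_left ip_diff_right ip_add_left ip_add_right f g L2_diff L2_add)
qed

lemma psi_continuous: "continuous_on UNIV (psi j)"
  unfolding psi_def by (cases "j = 1"; cases "even j") (auto intro!: continuous_intros)

lemma abs_psi_le: "\<bar>psi j t\<bar> \<le> sqrt 2"
  by (simp add: psi_def abs_mult)

lemma psi_L2: "psi j \<in> L2"
  by (rule L2_bounded[of _ "sqrt 2"])
    (auto intro: borel_measurable_unit_leb borel_measurable_continuous_onI psi_continuous abs_psi_le)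

lemma ip_psi:
  assumes "1 \<le> i" "1 \<le> j"
  shows "ip (psi i) (psi j) = (if i = j then 1 else 0)"
proof -
  define cc ss where "cc k t = cos (2 * pi * of_int k * t)" and "ss k t = sin (2 * pi * of_int k * t)"
    for k :: int and t :: real
  have int: "integrable unit_leb (cc k)" "integrable unit_leb (ss k)" for k
    by (auto intro!: U.integrable_const_bound[of _ 1] borel_measurable_unit_leb
        borel_measurable_continuous_onI continuous_intros simp: cc_def ss_def abs_le_iff)
  have I: "(\<integral>t. cc k t \<partial>unit_leb) = (if k = 0 then 1 else 0)" "(\<integral>t. ss k t \<partial>unit_leb) = 0" for k
    unfolding cc_def ss_def using integral_cos_period[of k] integral_sin_period[of k] by auto
  have prods: "cc k t * cc l t = (cc (k - l) t + cc (k + l) t) / 2"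
    "ss k t * ss l t = (cc (k - l) t - cc (k + l) t) / 2"
    "ss k t * cc l t = (ss (k + l) t + ss (k - l) t) / 2"
    "cc k t * ss l t = (ss (k + l) t - ss (k - l) t) / 2" for k l t
    unfolding cc_def ss_def cos_times_cos sin_times_sin sin_times_cos cos_times_sin
    by (simp_all add: algebra_simps)
  have P: "(\<integral>t. cc k t * cc l t \<partial>unit_leb) = ((if k = l then 1 else 0) + (if k = - l then 1 else 0)) / 2"
    "(\<integral>t. ss k t * ss l t \<partial>unit_leb) = ((if k = l then 1 else 0) - (if k = - l then 1 else 0)) / 2"
    "(\<integral>t. ss k t * cc l t \<partial>unit_leb) = 0" "(\<integral>t. cc k t * ss l t \<partial>unit_leb) = 0" for k l
    unfolding prods by (simp_all add: int I eq_neg_iff_add_eq_0)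
  have psi: "psi j = (if j = 1 then cc 0 else if even j then (\<lambda>t. sqrt 2 * cc (int (j div 2)) t)
      else (\<lambda>t. sqrt 2 * ss (int (j div 2)) t))" for j
    by (rule ext) (simp add: psi_def cc_def ss_def)
  have half: "i = j" if "even i \<longleftrightarrow> even j" "i div 2 = j div 2"
  proof -
    have "i mod 2 = j mod 2" using that(1) by (simp add: mod2_eq_if)
    with that(2) show ?thesis by (metis div_mult_mod_eq)
  qed
  have pos: "j \<noteq> 1 \<Longrightarrow> 0 < j div 2" if "1 \<le> j" for j :: nat
    using that by linarith
  have i: "i = 1 \<or> 0 < i div 2" and j: "j = 1 \<or> 0 < j div 2" using pos[OF assms(1)] pos[OF assms(2)] by argo+
  note rules = psi ip_scale_left ip_scale_right P[folded ip_def]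
  have two: "sqrt 2 * (sqrt 2 * x) = 2 * x" for x :: real by (simp flip: mult.assoc)
  show ?thesis
  proof (cases "i = 1"; cases "j = 1")
    assume "i \<noteq> 1" "j \<noteq> 1"
    then have ij: "0 < i div 2" "0 < j div 2" using i j by auto
    then have ne: "int (i div 2) \<noteq> - int (j div 2)" by linarith
    have eq: "int (i div 2) = int (j div 2) \<longleftrightarrow> i = j" if "even i \<longleftrightarrow> even j"
      using half[OF that] by auto
    show ?thesis
      using \<open>i \<noteq> 1\<close> \<open>j \<noteq> 1\<close> ne eq
      by (cases "even i"; cases "even j"; simp only: rules two if_False if_True simp_thms; force)
  next
    assume "i = 1" "j \<noteq> 1"
    then have "int (j div 2) \<noteq> 0" using j by simp
    then show ?thesis using \<open>i = 1\<close> \<open>j \<noteq> 1\<close> by (cases "even j") (simp_all add: rules del: of_nat_eq_0_iff)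
  next
    assume "i \<noteq> 1" "j = 1"
    then have "int (i div 2) \<noteq> 0" using i by simp
    then show ?thesis using \<open>i \<noteq> 1\<close> \<open>j = 1\<close> by (cases "even i") (simp_all add: rules del: of_nat_eq_0_iff)
  qed (simp add: rules)
qed

section \<open>Parseval's identity for the trigonometric system\<close>

text \<open>The component of \<open>f\<close> orthogonal to the first \<open>n\<close> basis functions.\<close>

definition resid :: "(real \<Rightarrow> real) \<Rightarrow> nat \<Rightarrow> real \<Rightarrow> real" where
  "resid f n t = f t - (\<Sum>l<n. ip f (psi (Suc l)) * psi (Suc l) t)"

text \<open>Completeness of the system is proved by enlarging the class of functions that satisfy
  Parseval's identity. The identity says that the remainders tend to zero in norm; hence the
  class is a linear subspace and closed under limits in norm. It contains the trigonometric
  polynomials, therefore continuous functions on the circle, therefore indicators of Borel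
  sets, therefore everything.\<close>

definition has_parseval :: "(real \<Rightarrow> real) \<Rightarrow> bool" where
  "has_parseval f \<longleftrightarrow> f \<in> L2 \<and> (\<lambda>l. (ip f (psi (Suc l)))\<^sup>2) sums ip f f"

lemma psi_comb_L2: "(\<lambda>t. \<Sum>l\<in>A. a l * psi (h l) t) \<in> L2"
  by (intro L2_sum L2_scale psi_L2)

lemma ip_psi_comb:
  assumes "finite A"
  shows "ip (\<lambda>t. \<Sum>l\<in>A. a l * psi (Suc l) t) (psi (Suc i)) = (if i \<in> A then a i else 0)"
proof -
  have "ip (\<lambda>t. \<Sum>l\<in>A. a l * psi (Suc l) t) (psi (Suc i)) = (\<Sum>l\<in>A. if l = i then a i else 0)"
    by (subst ip_sum_left) (auto simp: psi_L2 L2_scale ip_scale_left ip_psi intro!: sum.cong)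
  then show ?thesis using assms by simp
qed

lemma resid_L2: "f \<in> L2 \<Longrightarrow> resid f n \<in> L2"
  unfolding resid_def by (intro L2_diff psi_comb_L2)

lemma ip_resid_psi:
  "f \<in> L2 \<Longrightarrow> ip (resid f n) (psi (Suc i)) = (if i < n then 0 else ip f (psi (Suc i)))"
  unfolding resid_def by (subst ip_diff_left) (auto simp: psi_comb_L2 psi_L2 ip_psi_comb)

lemma ip_resid_self:
  assumes f: "f \<in> L2"
  shows "ip (resid f n) (resid f n) = ip f f - (\<Sum>l<n. (ip f (psi (Suc l)))\<^sup>2)"
proof -
  have *: "ip g (resid f n) = ip g f - (\<Sum>l<n. ip f (psi (Suc l)) * ip g (psi (Suc l)))" if "g \<in> L2" for g
    unfolding resid_def using that f
    by (subst ip_diff_right, auto simp: psi_comb_L2)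
       (subst ip_sum_right, auto simp: psi_L2 L2_scale ip_scale_right)
  show ?thesis
    using f by (simp add: *[OF resid_L2] ip_resid_psi ip_commute[of "resid f n" f] *[OF f] power2_eq_square)
qed

lemma bessel: "f \<in> L2 \<Longrightarrow> (\<Sum>l<n. (ip f (psi (Suc l)))\<^sup>2) \<le> ip f f"
  using ip_resid_self[of f n] ip_self_nonneg[of "resid f n"] by simp

lemma ip_resid_le: "f \<in> L2 \<Longrightarrow> ip (resid f n) (resid f n) \<le> ip f f"
  by (simp add: ip_resid_self sum_nonneg)

lemma resid_add: "f \<in> L2 \<Longrightarrow> g \<in> L2 \<Longrightarrow> resid (\<lambda>t. f t + g t) n = (\<lambda>t. resid f n t + resid g n t)"
  by (rule ext) (simp add: resid_def ip_add_left psi_L2 distrib_right sum.distrib)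

lemma resid_scale: "resid (\<lambda>t. c * f t) n = (\<lambda>t. c * resid f n t)"
  by (rule ext) (simp add: resid_def ip_scale_left sum_distrib_left algebra_simps)

lemma has_parseval_iff:
  "has_parseval f \<longleftrightarrow> f \<in> L2 \<and> (\<lambda>n. ip (resid f n) (resid f n)) \<longlonglongrightarrow> 0"
proof (cases "f \<in> L2")
  case True
  have "(\<lambda>n. ip (resid f n) (resid f n)) \<longlonglongrightarrow> 0 \<longleftrightarrow>
      (\<lambda>n. (\<Sum>l<n. (ip f (psi (Suc l)))\<^sup>2)) \<longlonglongrightarrow> ip f f"
    using LIM_zero_iff[of "\<lambda>n. (\<Sum>l<n. (ip f (psi (Suc l)))\<^sup>2)" "ip f f" sequentially]
      tendsto_minus_cancel_left[of "\<lambda>n. ip (resid f n) (resid f n)" 0]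
    by (simp add: ip_resid_self[OF True])
  then show ?thesis by (simp add: has_parseval_def sums_def)
qed (simp add: has_parseval_def)

lemma has_parseval_scale: "has_parseval f \<Longrightarrow> has_parseval (\<lambda>t. c * f t)"
  by (auto simp: has_parseval_iff resid_scale L2_scale ip_scale_left ip_scale_right
      intro!: tendsto_mult_right_zero)

lemma has_parseval_add:
  assumes "has_parseval f" "has_parseval g"
  shows "has_parseval (\<lambda>t. f t + g t)"
proof -
  have fg: "f \<in> L2" "g \<in> L2" using assms by (auto simp: has_parseval_def)
  define F where "F n = ip (resid (\<lambda>t. f t + g t) n) (resid (\<lambda>t. f t + g t) n)" for n
  define G where "G n = 2 * ip (resid f n) (resid f n) + 2 * ip (resid g n) (resid g n)" for n
  have "G \<longlonglongrightarrow> 2 * 0 + 2 * 0"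
    unfolding G_def by (rule tendsto_add[OF tendsto_mult_left tendsto_mult_left])
       (use assms in \<open>simp_all add: has_parseval_iff\<close>)
  then have G: "G \<longlonglongrightarrow> 0" by simp
  have FG: "norm (F n) \<le> G n" for n
    unfolding F_def G_def resid_add[OF fg]
    using ip_self_add_le[OF resid_L2[OF fg(1), of n] resid_L2[OF fg(2), of n]]
      ip_self_nonneg[of "\<lambda>t. resid f n t + resid g n t"] by simp
  have "F \<longlonglongrightarrow> 0"
    by (rule Lim_null_comparison[OF always_eventually G]) (use FG in blast)
  then show ?thesis using fg by (simp add: has_parseval_iff L2_add F_def[abs_def])
qed

lemma has_parseval_diff: "has_parseval f \<Longrightarrow> has_parseval g \<Longrightarrow> has_parseval (\<lambda>t. f t - g t)"
  using has_parseval_add[of f "\<lambda>t. - 1 * g t"] has_parseval_scale[of g "- 1"] by simp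

lemma has_parseval_psi:
  assumes "1 \<le> j"
  shows "has_parseval (psi j)"
proof -
  obtain i where j: "j = Suc i" using assms by (cases j) auto
  have "(\<lambda>l. (ip (psi j) (psi (Suc l)))\<^sup>2) = (\<lambda>l. if l = i then 1 else 0)"
    by (auto simp: j ip_psi fun_eq_iff)
  then show ?thesis
    using sums_single[of i "\<lambda>_. 1"] by (simp add: has_parseval_def psi_L2 j ip_psi)
qed

lemma has_parseval_zero: "has_parseval (\<lambda>t. 0)"
  using has_parseval_scale[OF has_parseval_psi[of 1], of 0] by simp

lemma has_parseval_sum:
  "(\<And>i. i \<in> A \<Longrightarrow> has_parseval (f i)) \<Longrightarrow> has_parseval (\<lambda>t. \<Sum>i\<in>A. f i t)"
  by (induction A rule: infinite_finite_induct) (auto intro: has_parseval_zero has_parseval_add)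

text \<open>Taking the remainder is linear and does not increase the norm, so a good approximation
  of \<open>f\<close> has a remainder close to that of \<open>f\<close>, uniformly in the number of basis functions.\<close>

lemma has_parseval_limit:
  assumes f: "f \<in> L2" and g: "\<And>i. has_parseval (g i)"
    and lim: "(\<lambda>i. ip (\<lambda>t. f t - g i t) (\<lambda>t. f t - g i t)) \<longlonglongrightarrow> 0"
  shows "has_parseval f"
  unfolding has_parseval_iff
proof (intro conjI f LIMSEQ_I)
  fix r :: real assume r: "0 < r"
  from LIMSEQ_D[OF lim, of "r / 4"] r
  obtain i where "\<forall>n\<ge>i. norm (ip (\<lambda>t. f t - g n t) (\<lambda>t. f t - g n t) - 0) < r / 4" by auto
  then have "norm (ip (\<lambda>t. f t - g i t) (\<lambda>t. f t - g i t) - 0) < r / 4" using order_refl by blast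
  then have i: "ip (\<lambda>t. f t - g i t) (\<lambda>t. f t - g i t) < r / 4" by (simp add: abs_less_iff)
  let ?h = "\<lambda>t. f t - g i t"
  have gi: "g i \<in> L2" "(\<lambda>n. ip (resid (g i) n) (resid (g i) n)) \<longlonglongrightarrow> 0"
    using g[of i] by (auto simp: has_parseval_iff)
  have h: "?h \<in> L2" using f gi by (intro L2_diff)
  from LIMSEQ_D[OF gi(2), of "r / 4"] r obtain n0
    where n0': "\<forall>n\<ge>n0. norm (ip (resid (g i) n) (resid (g i) n) - 0) < r / 4" by auto
  have n0: "ip (resid (g i) n) (resid (g i) n) < r / 4" if "n \<ge> n0" for n
  proof -
    have "norm (ip (resid (g i) n) (resid (g i) n) - 0) < r / 4" using n0' that by blast
    then show ?thesis by (simp add: abs_less_iff)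
  qed
  have "norm (ip (resid f n) (resid f n) - 0) < r" if "n \<ge> n0" for n
  proof -
    have "resid f n = (\<lambda>t. resid (g i) n t + resid ?h n t)"
      using resid_add[OF gi(1) h, of n] by simp
    then have "ip (resid f n) (resid f n) \<le>
        2 * ip (resid (g i) n) (resid (g i) n) + 2 * ip (resid ?h n) (resid ?h n)"
      using ip_self_add_le[OF resid_L2[OF gi(1)] resid_L2[OF h]] by simp
    also have "\<dots> < r" using n0[OF that] ip_resid_le[OF h, of n] i by simp
    finally show ?thesis using ip_self_nonneg[of "resid f n"] by simp
  qed
  then show "\<exists>n0. \<forall>n\<ge>n0. norm (ip (resid f n) (resid f n) - 0) < r" by blast
qed

text \<open>Dominated convergence turns pointwise limits into limits in norm. Every enlargement of
  the class beyond the trigonometric polynomials goes through this lemma.\<close>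

lemma has_parseval_dominated:
  assumes g: "\<And>i. has_parseval (g i)" and f[measurable]: "f \<in> borel_measurable unit_leb"
    and w: "w \<in> L2" and bound: "\<And>i. AE t in unit_leb. \<bar>g i t\<bar> \<le> w t"
    and lim: "AE t in unit_leb. (\<lambda>i. g i t) \<longlonglongrightarrow> f t"
  shows "has_parseval f"
proof -
  have [measurable]: "g i \<in> borel_measurable unit_leb" "w \<in> borel_measurable unit_leb" for i
    using g w by (auto simp: has_parseval_def L2_def)
  have "AE t in unit_leb. \<forall>i. \<bar>g i t\<bar> \<le> w t" using bound by (simp add: AE_all_countable)
  with lim have fw: "AE t in unit_leb. \<bar>f t\<bar> \<le> w t"
  proof eventually_elim
    case (elim t)
    then show ?case by (intro LIMSEQ_le_const2[OF tendsto_rabs]) auto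
  qed
  have w2: "integrable unit_leb (\<lambda>t. 4 * (w t)\<^sup>2)" using w by (simp add: L2_def)
  have "integrable unit_leb (\<lambda>t. (f t)\<^sup>2)"
  proof (rule Bochner_Integration.integrable_bound[OF w2])
    show "AE t in unit_leb. norm ((f t)\<^sup>2) \<le> norm (4 * (w t)\<^sup>2)"
      using fw
    proof eventually_elim
      case (elim t)
      then have "(f t)\<^sup>2 \<le> (w t)\<^sup>2" by (intro abs_le_square_iff[THEN iffD1]) linarith
      then have "(f t)\<^sup>2 \<le> 4 * (w t)\<^sup>2" using zero_le_power2[of "w t"] by linarith
      then show ?case by simp
    qed
  qed simp
  then have fL: "f \<in> L2" by (simp add: L2_def)
  have "(\<lambda>i. \<integral>t. (f t - g i t) * (f t - g i t) \<partial>unit_leb) \<longlonglongrightarrow> (\<integral>t. 0 \<partial>unit_leb)"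
  proof (rule integral_dominated_convergence[where w = "\<lambda>t. 4 * (w t)\<^sup>2"])
    show "AE t in unit_leb. (\<lambda>i. (f t - g i t) * (f t - g i t)) \<longlonglongrightarrow> 0"
      using lim
    proof eventually_elim
      case (elim t)
      then have "(\<lambda>i. (f t - g i t) * (f t - g i t)) \<longlonglongrightarrow> (f t - f t) * (f t - f t)"
        by (intro tendsto_intros)
      then show ?case by simp
    qed
    fix i
    show "AE t in unit_leb. norm ((f t - g i t) * (f t - g i t)) \<le> 4 * (w t)\<^sup>2"
      using fw bound[of i]
    proof eventually_elim
      case (elim t)
      then have "\<bar>f t - g i t\<bar> \<le> \<bar>2 * w t\<bar>" by linarith
      then show ?case by (simp add: abs_le_square_iff power2_eq_square)
    qed
  qed (use w2 in auto)
  then show ?thesis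
    by (intro has_parseval_limit[OF fL g]) (simp add: ip_def)
qed

lemma has_parseval_cong_AE:
  assumes "has_parseval g" "f \<in> borel_measurable unit_leb" "AE t in unit_leb. f t = g t"
  shows "has_parseval f"
proof (rule has_parseval_dominated[where g = "\<lambda>_. g" and w = "\<lambda>t. \<bar>g t\<bar>"])
  show "AE t in unit_leb. (\<lambda>i. g t) \<longlonglongrightarrow> f t"
    using assms(3) by eventually_elim simp
qed (use assms in \<open>auto simp: has_parseval_def L2_abs\<close>)

text \<open>Frequencies are integers of either sign because the product formulas produce both the
  difference and the sum of two frequencies.\<close>

inductive_set trig_poly :: "(real \<Rightarrow> real) set" where
  cos: "(\<lambda>t. cos (2 * pi * of_int k * t)) \<in> trig_poly"
| sin: "(\<lambda>t. sin (2 * pi * of_int k * t)) \<in> trig_poly"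
| scale: "f \<in> trig_poly \<Longrightarrow> (\<lambda>t. c * f t) \<in> trig_poly"
| add: "f \<in> trig_poly \<Longrightarrow> g \<in> trig_poly \<Longrightarrow> (\<lambda>t. f t + g t) \<in> trig_poly"

lemma trig_poly_mult_base:
  "(\<lambda>t. cos (2 * pi * of_int k * t) * cos (2 * pi * of_int l * t)) \<in> trig_poly"
  "(\<lambda>t. sin (2 * pi * of_int k * t) * sin (2 * pi * of_int l * t)) \<in> trig_poly"
  "(\<lambda>t. sin (2 * pi * of_int k * t) * cos (2 * pi * of_int l * t)) \<in> trig_poly"
  "(\<lambda>t. cos (2 * pi * of_int k * t) * sin (2 * pi * of_int l * t)) \<in> trig_poly"
proof -
  note c = trig_poly.cos and s = trig_poly.sin
  have *: "2 * pi * of_int k * t - 2 * pi * of_int l * t = 2 * pi * of_int (k - l) * t"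
    "2 * pi * of_int k * t + 2 * pi * of_int l * t = 2 * pi * of_int (k + l) * t" for t
    by (simp_all add: algebra_simps)
  show "(\<lambda>t. cos (2 * pi * of_int k * t) * cos (2 * pi * of_int l * t)) \<in> trig_poly"
    using trig_poly.add[OF trig_poly.scale[OF c[of "k - l"], of "1/2"] trig_poly.scale[OF c[of "k + l"], of "1/2"]]
    unfolding cos_times_cos * by (simp add: add_divide_distrib)
  show "(\<lambda>t. sin (2 * pi * of_int k * t) * sin (2 * pi * of_int l * t)) \<in> trig_poly"
    using trig_poly.add[OF trig_poly.scale[OF c[of "k - l"], of "1/2"] trig_poly.scale[OF c[of "k + l"], of "-1/2"]]
    unfolding sin_times_sin * by (simp add: diff_divide_distrib)
  show "(\<lambda>t. sin (2 * pi * of_int k * t) * cos (2 * pi * of_int l * t)) \<in> trig_poly"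
    using trig_poly.add[OF trig_poly.scale[OF s[of "k + l"], of "1/2"] trig_poly.scale[OF s[of "k - l"], of "1/2"]]
    unfolding sin_times_cos * by (simp add: add_divide_distrib)
  show "(\<lambda>t. cos (2 * pi * of_int k * t) * sin (2 * pi * of_int l * t)) \<in> trig_poly"
    using trig_poly.add[OF trig_poly.scale[OF s[of "k + l"], of "1/2"] trig_poly.scale[OF s[of "k - l"], of "-1/2"]]
    unfolding cos_times_sin * by (simp add: diff_divide_distrib)
qed

lemma trig_poly_mult:
  assumes f: "f \<in> trig_poly" and g: "g \<in> trig_poly"
  shows "(\<lambda>t. f t * g t) \<in> trig_poly"
  using f
proof induction
  case (cos k)
  show ?case using g
    by induction (auto simp: distrib_left mult.left_commute[of "cos _"]
        intro: trig_poly_mult_base trig_poly.scale trig_poly.add)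
next
  case (sin k)
  show ?case using g
    by induction (auto simp: distrib_left mult.left_commute[of "sin _"]
        intro: trig_poly_mult_base trig_poly.scale trig_poly.add)
qed (auto simp: distrib_right mult.assoc intro: trig_poly.scale trig_poly.add)

lemma has_parseval_trig_poly: "f \<in> trig_poly \<Longrightarrow> has_parseval f"
proof (induction rule: trig_poly.induct)
  case (cos k)
  have "(\<lambda>t. cos (2 * pi * of_int k * t)) = (if k = 0 then psi 1 else (\<lambda>t. 1 / sqrt 2 * psi (2 * nat \<bar>k\<bar>) t))"
    by (auto simp: psi_def fun_eq_iff abs_if)
  then show ?case
    using has_parseval_psi[of 1] has_parseval_scale[OF has_parseval_psi[of "2 * nat \<bar>k\<bar>"], of "1 / sqrt 2"]
    by (cases "k = 0") simp_all
next
  case (sin k)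
  have eq: "(\<lambda>t. sin (2 * pi * of_int k * t)) = (\<lambda>t. of_int (sgn k) / sqrt 2 * psi (2 * nat \<bar>k\<bar> + 1) t)"
  proof (rule ext)
    fix t :: real
    have "psi (2 * nat \<bar>k\<bar> + 1) t = sqrt 2 * sin (2 * pi * real_of_int \<bar>k\<bar> * t)" if "k \<noteq> 0"
      using that by (simp add: psi_def)
    then show "sin (2 * pi * of_int k * t) = of_int (sgn k) / sqrt 2 * psi (2 * nat \<bar>k\<bar> + 1) t"
      by (cases k "0 :: int" rule: linorder_cases) simp_all
  qed
  show ?case unfolding eq by (intro has_parseval_scale has_parseval_psi) simp
qed (auto intro: has_parseval_scale has_parseval_add)

lemma real_polynomial_cis_trig_poly:
  assumes "real_polynomial_function P"
  shows "(\<lambda>t. P (cis (2 * pi * t))) \<in> trig_poly"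
  using assms
proof induction
  case (linear f)
  interpret bounded_linear f by fact
  have eq: "f (cis x) = f 1 * cos x + f \<i> * sin x" for x
  proof -
    have "cis x = cos x *\<^sub>R 1 + sin x *\<^sub>R \<i>" by (auto simp: complex_eq_iff)
    then show ?thesis by (simp add: add scaleR)
  qed
  show ?case unfolding eq
    using trig_poly.add[OF trig_poly.scale[OF trig_poly.cos[of 1]] trig_poly.scale[OF trig_poly.sin[of 1]]]
    by simp
next
  case (const c)
  show ?case using trig_poly.scale[OF trig_poly.cos[of 0], of c] by simp
qed (auto intro: trig_poly.add trig_poly_mult)

text \<open>On the unit circle a polynomial in the two coordinates is a trigonometric polynomial, so
  the Stone-Weierstrass theorem applies. It has to be used on the circle, not on the interval:
  uniform limits of trigonometric polynomials take the same value at both end points.\<close>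

lemma has_parseval_circle:
  assumes F: "continuous_on (sphere 0 1) F"
  shows "has_parseval (\<lambda>t. F (cis (2 * pi * t)))"
proof -
  have sph: "cis x \<in> sphere 0 1" for x by simp
  have cont: "continuous_on UNIV (\<lambda>t. F (cis (2 * pi * t)))"
    by (rule continuous_on_compose2[OF F]) (auto intro!: continuous_intros)
  have meas: "(\<lambda>t. F (cis (2 * pi * t))) \<in> borel_measurable unit_leb"
    by (intro borel_measurable_unit_leb borel_measurable_continuous_onI cont)
  have "\<exists>P. real_polynomial_function P \<and> (\<forall>z\<in>sphere 0 1. \<bar>F z - P z\<bar> < inverse (Suc i))" for i
    by (rule Stone_Weierstrass_real_polynomial_function[OF _ F, of "inverse (Suc i)"]) auto
  then obtain P where P: "\<And>i. real_polynomial_function (P i)"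
    "\<And>i z. z \<in> sphere 0 1 \<Longrightarrow> \<bar>F z - P i z\<bar> < inverse (Suc i)" by metis
  have "compact (F ` sphere 0 1)" by (intro compact_continuous_image F) auto
  then have "bounded (F ` sphere 0 1)" by (rule compact_imp_bounded)
  then obtain B where B: "\<And>z. z \<in> sphere 0 1 \<Longrightarrow> \<bar>F z\<bar> \<le> B"
    unfolding bounded_iff real_norm_def by blast
  show ?thesis
  proof (rule has_parseval_dominated[where g = "\<lambda>i t. P i (cis (2 * pi * t))" and w = "\<lambda>_. B + 1"])
    show "has_parseval (\<lambda>t. P i (cis (2 * pi * t)))" for i
      by (intro has_parseval_trig_poly real_polynomial_cis_trig_poly P)
    show "(\<lambda>_. B + 1) \<in> L2" by (rule L2_bounded[of _ "\<bar>B + 1\<bar>"]) auto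
    show "AE t in unit_leb. \<bar>P i (cis (2 * pi * t))\<bar> \<le> B + 1" for i
    proof (rule AE_I2)
      fix t
      have "inverse (real (Suc i)) \<le> 1" by (simp add: field_simps)
      then show "\<bar>P i (cis (2 * pi * t))\<bar> \<le> B + 1"
        using P(2)[OF sph, of "2 * pi * t" i] B[OF sph, of "2 * pi * t"] by linarith
    qed
    show "AE t in unit_leb. (\<lambda>i. P i (cis (2 * pi * t))) \<longlonglongrightarrow> F (cis (2 * pi * t))"
    proof (rule AE_I2)
      fix t
      show "(\<lambda>i. P i (cis (2 * pi * t))) \<longlonglongrightarrow> F (cis (2 * pi * t))"
      proof (rule LIM_zero_cancel, rule Lim_null_comparison)
        show "\<forall>\<^sub>F i in sequentially. norm (P i (cis (2 * pi * t)) - F (cis (2 * pi * t))) \<le> inverse (real (Suc i))"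
          using P(2)[OF sph, of "2 * pi * t"] by (intro always_eventually) (auto simp: abs_minus_commute less_imp_le)
        show "(\<lambda>i. inverse (real (Suc i))) \<longlonglongrightarrow> 0" by (rule LIMSEQ_inverse_real_of_nat)
      qed
    qed
  qed (rule meas)
qed

text \<open>The indicator of a closed set is the pointwise limit of continuous functions that decay
  with the distance to the set.\<close>

lemma has_parseval_indicator_circle:
  assumes K: "closed K" "K \<noteq> {}"
  shows "has_parseval (\<lambda>t. indicator K (cis (2 * pi * t)))"
proof (rule has_parseval_dominated[where w = "\<lambda>_. 1"
      and g = "\<lambda>i t. max 0 (1 - real i * infdist (cis (2 * pi * t)) K)"])
  show "has_parseval (\<lambda>t. max 0 (1 - real i * infdist (cis (2 * pi * t)) K))" for i
    by (rule has_parseval_circle[of "\<lambda>z. max 0 (1 - real i * infdist z K)"]) (intro continuous_intros)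
  have [measurable]: "K \<in> sets borel" using K by auto
  have "(\<lambda>t. cis (2 * pi * t)) \<in> borel_measurable unit_leb"
    by (intro borel_measurable_unit_leb borel_measurable_continuous_onI continuous_intros)
  then show "(\<lambda>t. indicator K (cis (2 * pi * t))) \<in> borel_measurable unit_leb" by simp
  show "(\<lambda>_. 1) \<in> L2" by (rule L2_bounded[of _ 1]) auto
  show "AE t in unit_leb. \<bar>max 0 (1 - real i * infdist (cis (2 * pi * t)) K)\<bar> \<le> 1" for i
  proof (rule AE_I2)
    fix t
    have "0 \<le> real i * infdist (cis (2 * pi * t)) K" by (simp add: infdist_nonneg)
    then show "\<bar>max 0 (1 - real i * infdist (cis (2 * pi * t)) K)\<bar> \<le> 1" by simp
  qed
  show "AE t in unit_leb. (\<lambda>i. max 0 (1 - real i * infdist (cis (2 * pi * t)) K))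
      \<longlonglongrightarrow> indicator K (cis (2 * pi * t))"
  proof (rule AE_I2)
    fix t
    let ?z = "cis (2 * pi * t)"
    show "(\<lambda>i. max 0 (1 - real i * infdist ?z K)) \<longlonglongrightarrow> indicator K ?z"
    proof (cases "?z \<in> K")
      case False
      then have "infdist ?z K > 0"
        using in_closed_iff_infdist_zero[OF K, of ?z] infdist_nonneg[of ?z K] by linarith
      then obtain n where n: "1 < real n * infdist ?z K" 
        using reals_Archimedean3[of "infdist ?z K"] by blast
      have "\<forall>\<^sub>F i in sequentially. max 0 (1 - real i * infdist ?z K) = 0"
        using eventually_ge_at_top[of n]
      proof eventually_elim
        case (elim i)
        then have "real n * infdist ?z K \<le> real i * infdist ?z K"
          by (intro mult_right_mono infdist_nonneg) simp
        then show ?case using n by simp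
      qed
      then show ?thesis using False by (simp add: tendsto_eventually)
    qed (simp add: infdist_zero)
  qed
qed

text \<open>A half-line meets the unit interval in nothing, in everything, or in a segment that wraps
  to a closed arc of the circle. In the last case the two indicators differ at most at the point 1,
  which has the same image on the circle as 0.\<close>

lemma has_parseval_indicator_atMost: "has_parseval (indicator {..x})"
proof -
  have meas: "indicator {..x} \<in> borel_measurable unit_leb"
    by (intro borel_measurable_unit_leb) simp
  consider "x < 0" | "0 \<le> x" "x < 1" | "1 \<le> x" by linarith
  then show ?thesis
  proof cases
    case 1
    then show ?thesis
      by (intro has_parseval_cong_AE[OF has_parseval_zero meas] AE_I2) auto
  next
    case 3
    then show ?thesis
      by (intro has_parseval_cong_AE[OF has_parseval_psi[of 1] meas] AE_I2) (auto simp: psi_def)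
  next
    case 2
    define K where "K = (\<lambda>s. cis (2 * pi * s)) ` {0..x}"
    have "compact K" unfolding K_def
      by (intro compact_continuous_image continuous_intros) auto
    then have K: "closed K" "K \<noteq> {}" using 2 by (auto simp: K_def compact_imp_closed)
    have inj: "s = t" if "cis (2 * pi * s) = cis (2 * pi * t)" "0 \<le> s" "s < 1" "0 \<le> t" "t < 1" for s t
    proof -
      have "sin (2 * pi * s) = sin (2 * pi * t)" "cos (2 * pi * s) = cos (2 * pi * t)"
        using that(1) by (simp_all add: complex_eq_iff)
      then obtain n :: int where n: "2 * pi * s = 2 * pi * t + 2 * pi * of_int n"
        using sin_cos_eq_iff[of "2 * pi * s" "2 * pi * t"] by blast
      have "2 * pi * s = 2 * pi * (t + of_int n)" using n by (simp add: algebra_simps)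
      then have st: "s = t + of_int n" by simp
      then have "- 1 < (of_int n :: real)" "(of_int n :: real) < 1" using that by linarith+
      then have "n = 0" by linarith
      then show ?thesis using st by simp
    qed
    have "AE t in lborel. t \<noteq> (1 :: real)" by (rule AE_lborel_singleton)
    then have ne: "AE t in unit_leb. t \<noteq> (1 :: real)"
      unfolding unit_leb_def by (subst AE_restrict_space_iff) auto
    have "AE t in unit_leb. indicator {..x} t = (indicator K (cis (2 * pi * t)) :: real)"
      using ne AE_space
    proof eventually_elim
      case (elim t)
      then have t: "0 \<le> t" "t < 1" by auto
      have "cis (2 * pi * t) \<in> K \<longleftrightarrow> t \<le> x"
        using t 2 inj[of t] by (auto simp: K_def)
      then show ?case by (auto simp: indicator_def)
    qed
    then show ?thesis
      by (rule has_parseval_cong_AE[OF has_parseval_indicator_circle[OF K] meas])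
  qed
qed

text \<open>The half-lines generate the Borel sets and are stable under intersection, and the class
  is closed under complements and countable disjoint unions of indicators.\<close>

lemma has_parseval_indicator:
  assumes A: "A \<in> sets (borel :: real measure)"
  shows "has_parseval (indicator A)"
proof -
  have "Int_stable (range (\<lambda>a::real. {..a}))"
    by (auto simp: Int_stable_def)
  moreover have "range (\<lambda>a::real. {..a}) \<subseteq> Pow UNIV" by simp
  moreover have "A \<in> sigma_sets UNIV (range (\<lambda>a::real. {..a}))"
    using A by (subst (asm) borel_eq_atMost) simp
  ultimately show ?thesis
  proof (induction rule: sigma_sets_induct_disjoint)
    case (basic A)
    then show ?case using has_parseval_indicator_atMost by auto
  next
    case empty
    then show ?case using has_parseval_zero by (simp add: indicator_def)
  next
    case (compl A)
    have "indicator (UNIV - A) = (\<lambda>t. psi 1 t - indicator A t :: real)"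
      by (auto simp: fun_eq_iff psi_def indicator_def)
    then show ?case using has_parseval_diff[OF has_parseval_psi[of 1] compl(2)] by simp
  next
    case (union A)
    have ind: "(\<Sum>i<n. indicator (A i) t :: real) = indicator (\<Union>i<n. A i) t" for n t
      using union(1) by (intro indicator_UN_disjoint[symmetric]) (auto simp: disjoint_family_on_def)
    have Am: "A i \<in> sets borel" for i
      using union(2) by (subst borel_eq_atMost) auto
    show ?case
    proof (rule has_parseval_dominated[where w = "\<lambda>_. 1" and g = "\<lambda>n t. \<Sum>i<n. indicator (A i) t"])
      show "has_parseval (\<lambda>t. \<Sum>i<n. indicator (A i) t)" for n
        by (intro has_parseval_sum union)
      show "(\<lambda>_. 1) \<in> L2" by (rule L2_bounded[of _ 1]) auto
      show "indicator (\<Union>i. A i) \<in> borel_measurable unit_leb"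
        using Am by (intro borel_measurable_unit_leb borel_measurable_indicator) auto
      show "AE t in unit_leb. \<bar>\<Sum>i<n. indicator (A i) t :: real\<bar> \<le> 1" for n
      proof (rule AE_I2)
        fix t
        show "\<bar>\<Sum>i<n. indicator (A i) t :: real\<bar> \<le> 1" unfolding ind by (simp add: indicator_def)
      qed
      show "AE t in unit_leb. (\<lambda>n. \<Sum>i<n. indicator (A i) t) \<longlonglongrightarrow> (indicator (\<Union>i. A i) t :: real)"
      proof (rule AE_I2)
        fix t
        have "(\<lambda>n. \<Sum>i<n. indicator (A i) t) = (\<lambda>n. indicator (\<Union>i<n. A i) t :: real)"
          by (rule ext) (rule ind)
        then show "(\<lambda>n. \<Sum>i<n. indicator (A i) t) \<longlonglongrightarrow> (indicator (\<Union>i. A i) t :: real)"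
          using LIMSEQ_indicator_UN[of A t] by simp
      qed
    qed
  qed
qed

text \<open>Simple functions approximate \<open>f\<close> pointwise and can be kept below \<open>2 * \<bar>f\<bar>\<close>.\<close>

theorem parseval:
  assumes f: "f \<in> L2"
  shows "(\<lambda>l. (ip f (psi (Suc l)))\<^sup>2) sums ip f f"
proof -
  obtain s where s: "\<And>i. simple_function unit_leb (s i)"
    "\<And>x. x \<in> space unit_leb \<Longrightarrow> (\<lambda>i. s i x) \<longlonglongrightarrow> f x"
    "\<And>i x. x \<in> space unit_leb \<Longrightarrow> dist (s i x) 0 \<le> 2 * dist (f x) 0"
    using borel_measurable_implies_sequence_metric[OF L2_measurable[OF f], of 0] by blast
  have "has_parseval f"
  proof (rule has_parseval_dominated[where g = s and w = "\<lambda>t. 2 * \<bar>f t\<bar>"])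
    show "has_parseval (s i)" for i
    proof (rule has_parseval_cong_AE)
      let ?A = "\<lambda>y. s i -` {y} \<inter> {0..1}"
      show "has_parseval (\<lambda>t. \<Sum>y\<in>s i ` {0..1}. y * indicator (?A y) t)"
      proof (intro has_parseval_sum has_parseval_scale has_parseval_indicator)
        fix y
        have "?A y \<in> sets unit_leb" using simple_functionD(2)[OF s(1), of i "{y}"] by simp
        then show "?A y \<in> sets borel" unfolding sets_unit_leb by (subst (asm) sets_restrict_space_iff) auto
      qed
      show "AE t in unit_leb. s i t = (\<Sum>y\<in>s i ` {0..1}. y * indicator (?A y) t)"
      proof (rule AE_I2)
        fix t assume "t \<in> space unit_leb"
        from simple_function_indicator_representation_banach[OF s(1) this, of i]
        show "s i t = (\<Sum>y\<in>s i ` {0..1}. y * indicator (?A y) t)"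
          by (simp only: space_unit_leb real_scaleR_def mult.commute)
      qed
      show "s i \<in> borel_measurable unit_leb" using s(1) by (rule borel_measurable_simple_function)
    qed
    show "f \<in> borel_measurable unit_leb" using f by (rule L2_measurable)
    show "(\<lambda>t. 2 * \<bar>f t\<bar>) \<in> L2" using f by (intro L2_scale L2_abs)
    show "AE t in unit_leb. \<bar>s i t\<bar> \<le> 2 * \<bar>f t\<bar>" for i
      using s(3)[of _ i] by (intro AE_I2) simp
    show "AE t in unit_leb. (\<lambda>i. s i t) \<longlonglongrightarrow> f t"
      using s(2) by (intro AE_I2) simp
  qed
  then show ?thesis unfolding has_parseval_def by (rule conjunct2)
qed

lemma resid_tendsto_zero:
  assumes "f \<in> L2"
  shows "(\<lambda>n. ip (resid f n) (resid f n)) \<longlonglongrightarrow> 0"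
proof -
  have "has_parseval f" unfolding has_parseval_def using assms parseval by blast
  then show ?thesis unfolding has_parseval_iff by (rule conjunct2)
qed

section \<open>Second moments of the regressor\<close>

locale stationary_regressor = prob_space M
  for M :: "'a measure" and X :: "'a \<Rightarrow> real \<Rightarrow> real" +
  assumes X_regressors: "X \<in> regressors M" and X_diagonal: "trig_diagonal M X"
begin

abbreviation lam :: "nat \<Rightarrow> real" where "lam \<equiv> eigval M X"

text \<open>The trace of the covariance operator.\<close>

definition total_variance :: real where
  "total_variance = (\<integral>x. ip (X x) (X x) \<partial>M)"

lemma X_joint_measurable [measurable]: "case_prod X \<in> borel_measurable (M \<Otimes>\<^sub>M unit_leb)"
  using X_regressors by (simp add: regressors_def random_function_def)

lemma X_L2: "x \<in> space M \<Longrightarrow> X x \<in> L2"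
  using X_regressors by (simp add: regressors_def random_function_def)

lemma lam_pos: "1 \<le> j \<Longrightarrow> 0 < lam j"
  using X_diagonal by (simp add: trig_diagonal_def)

lemma measurable_ip_X:
  assumes "f \<in> L2"
  shows "(\<lambda>x. ip (X x) f) \<in> borel_measurable M"
proof -
  have [measurable]: "f \<in> borel_measurable unit_leb" using assms by (rule L2_measurable)
  show ?thesis unfolding ip_def by measurable
qed

lemma integrable_norm_X: "integrable M (\<lambda>x. ip (X x) (X x))"
proof (rule integrableI_nonneg)
  show "(\<lambda>x. ip (X x) (X x)) \<in> borel_measurable M" unfolding ip_def by measurable
  show "(\<integral>\<^sup>+ x. ennreal (ip (X x) (X x)) \<partial>M) < \<infinity>"
    using X_regressors by (simp add: regressors_def)
qed (simp add: ip_self_nonneg)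

lemma total_variance_nonneg: "0 \<le> total_variance"
  unfolding total_variance_def by (simp add: ip_self_nonneg)

lemma integrable_ip_X_sq:
  assumes f: "f \<in> L2"
  shows "integrable M (\<lambda>x. (ip (X x) f)\<^sup>2)"
proof (rule Bochner_Integration.integrable_bound)
  show "integrable M (\<lambda>x. ip (X x) (X x) * ip f f)" using integrable_norm_X by simp
  show "AE x in M. norm ((ip (X x) f)\<^sup>2) \<le> norm (ip (X x) (X x) * ip f f)"
    using ip_Cauchy_Schwarz[OF X_L2 f] by (intro AE_I2) (simp add: abs_mult ip_self_nonneg)
qed (use measurable_ip_X[OF f] in simp)

lemma integrable_ip_X_mult:
  "f \<in> L2 \<Longrightarrow> g \<in> L2 \<Longrightarrow> integrable M (\<lambda>x. ip (X x) f * ip (X x) g)"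
  by (intro integrable_mult_sq measurable_ip_X integrable_ip_X_sq)

lemma measurable_cross_moment:
  assumes [measurable]: "Z \<in> borel_measurable M"
  shows "(\<lambda>t. \<integral>x. X x t * Z x \<partial>M) \<in> borel_measurable unit_leb"
proof -
  have [measurable]: "(\<lambda>(t, x). X x t) \<in> borel_measurable (unit_leb \<Otimes>\<^sub>M M)"
    using measurable_compose[OF measurable_pair_swap' X_joint_measurable]
    by (simp add: case_prod_unfold)
  show ?thesis by measurable
qed

text \<open>Used twice to exchange the integral over the sample space with integrals over time: with
  \<open>Z\<close> the value of the process at a fixed time it evaluates the covariance operator, with \<open>Z\<close>
  a linear functional of the path it evaluates the quadratic form of that operator.\<close>

lemma Fubini_cross_moment:
  assumes Z[measurable]: "Z \<in> borel_measurable M" and Z2: "integrable M (\<lambda>x. (Z x)\<^sup>2)"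
    and f: "f \<in> L2"
  shows "(\<integral>t. (\<integral>x. X x t * Z x \<partial>M) * f t \<partial>unit_leb) = (\<integral>x. ip (X x) f * Z x \<partial>M)"
proof -
  interpret P: pair_sigma_finite M unit_leb by unfold_locales
  have [measurable]: "f \<in> borel_measurable unit_leb" using f by (rule L2_measurable)
  have Xf: "integrable unit_leb (\<lambda>t. X x t * f t)" if "x \<in> space M" for x
    using L2_integrable_mult[OF X_L2[OF that] f] .
  have norm_eq: "(\<integral>t. norm (X x t * Z x * f t) \<partial>unit_leb) = \<bar>Z x\<bar> * ip (\<lambda>t. \<bar>X x t\<bar>) (\<lambda>t. \<bar>f t\<bar>)" for x
  proof -
    have "(\<integral>t. norm (X x t * Z x * f t) \<partial>unit_leb) = (\<integral>t. \<bar>Z x\<bar> * (\<bar>X x t\<bar> * \<bar>f t\<bar>) \<partial>unit_leb)"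
      by (simp add: abs_mult mult_ac)
    then show ?thesis by (simp add: ip_def)
  qed
  have int: "integrable (M \<Otimes>\<^sub>M unit_leb) (\<lambda>(x, t). X x t * Z x * f t)"
  proof (rule P.Fubini_integrable)
    show "integrable M (\<lambda>x. \<integral>t. norm (case (x, t) of (x, t) \<Rightarrow> X x t * Z x * f t) \<partial>unit_leb)"
    proof (rule Bochner_Integration.integrable_bound)
      show "integrable M (\<lambda>x. (Z x)\<^sup>2 / 2 + ip (X x) (X x) * ip f f / 2)"
        using Z2 integrable_norm_X by simp
      show "AE x in M. norm (\<integral>t. norm (case (x, t) of (x, t) \<Rightarrow> X x t * Z x * f t) \<partial>unit_leb)
          \<le> norm ((Z x)\<^sup>2 / 2 + ip (X x) (X x) * ip f f / 2)"
      proof (rule AE_I2)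
        fix x assume x: "x \<in> space M"
        let ?a = "ip (\<lambda>t. \<bar>X x t\<bar>) (\<lambda>t. \<bar>f t\<bar>)"
        have "?a\<^sup>2 \<le> ip (\<lambda>t. \<bar>X x t\<bar>) (\<lambda>t. \<bar>X x t\<bar>) * ip (\<lambda>t. \<bar>f t\<bar>) (\<lambda>t. \<bar>f t\<bar>)"
          using x f by (intro ip_Cauchy_Schwarz L2_abs X_L2)
        also have "\<dots> = ip (X x) (X x) * ip f f" by (simp add: ip_def)
        finally have "\<bar>\<bar>Z x\<bar> * ?a\<bar> \<le> (Z x)\<^sup>2 / 2 + ip (X x) (X x) * ip f f / 2"
          using abs_mult_le_half[of "\<bar>Z x\<bar>" ?a] by simp
        then show "norm (\<integral>t. norm (case (x, t) of (x, t) \<Rightarrow> X x t * Z x * f t) \<partial>unit_leb)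
            \<le> norm ((Z x)\<^sup>2 / 2 + ip (X x) (X x) * ip f f / 2)"
          unfolding prod.case norm_eq by simp
      qed
    qed measurable
    show "AE x in M. integrable unit_leb (\<lambda>t. case (x, t) of (x, t) \<Rightarrow> X x t * Z x * f t)"
    proof (rule AE_I2)
      fix x assume "x \<in> space M"
      then have "integrable unit_leb (\<lambda>t. Z x * (X x t * f t))" using Xf by simp
      then show "integrable unit_leb (\<lambda>t. case (x, t) of (x, t) \<Rightarrow> X x t * Z x * f t)"
        by (simp add: mult_ac)
    qed
  qed measurable
  have "(\<integral>t. (\<integral>x. X x t * Z x \<partial>M) * f t \<partial>unit_leb) = (\<integral>t. (\<integral>x. X x t * Z x * f t \<partial>M) \<partial>unit_leb)"
    by simp
  also have "\<dots> = (\<integral>x. (\<integral>t. X x t * Z x * f t \<partial>unit_leb) \<partial>M)"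
    by (rule P.Fubini_integral[OF int])
  also have "\<dots> = (\<integral>x. (\<integral>t. Z x * (X x t * f t) \<partial>unit_leb) \<partial>M)" by (simp add: mult_ac)
  also have "\<dots> = (\<integral>x. ip (X x) f * Z x \<partial>M)" by (simp add: ip_def mult.commute)
  finally show ?thesis .
qed

lemma cov_op_eq:
  assumes f: "f \<in> L2" and s: "s \<in> {0..1}"
  shows "cov_op M X f s = (\<integral>x. X x s * ip (X x) f \<partial>M)"
proof -
  have Xt: "(\<lambda>x. X x t) \<in> borel_measurable M" "integrable M (\<lambda>x. (X x t)\<^sup>2)" "(\<integral>x. X x t \<partial>M) = 0"
    if "t \<in> {0..1}" for t
    using X_regressors that by (auto simp: regressors_def second_order_stationary_def)
  have "cov_op M X f s = (\<integral>t. (\<integral>x. X x t * X x s \<partial>M) * f t \<partial>unit_leb)"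
    unfolding cov_op_def covar_def using s
    by (intro Bochner_Integration.integral_cong) (auto simp: Xt)
  also have "\<dots> = (\<integral>x. ip (X x) f * X x s \<partial>M)" by (rule Fubini_cross_moment[OF Xt(1,2)[OF s] f])
  finally show ?thesis by (simp add: mult.commute)
qed

lemma measurable_cov_op:
  assumes f: "f \<in> L2"
  shows "cov_op M X f \<in> borel_measurable unit_leb"
proof -
  have "(\<lambda>s. \<integral>x. X x s * ip (X x) f \<partial>M) \<in> borel_measurable unit_leb"
    by (rule measurable_cross_moment[OF measurable_ip_X[OF f]])
  then show ?thesis by (rule measurable_cong[THEN iffD1, rotated]) (simp add: cov_op_eq[OF f])
qed

lemma ip_cov_op:
  assumes f: "f \<in> L2" and g: "g \<in> L2"
  shows "ip (cov_op M X f) g = (\<integral>x. ip (X x) f * ip (X x) g \<partial>M)"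
proof -
  have "ip (cov_op M X f) g = (\<integral>s. (\<integral>x. X x s * ip (X x) f \<partial>M) * g s \<partial>unit_leb)"
    unfolding ip_def[of "cov_op M X f"]
    by (intro Bochner_Integration.integral_cong) (auto simp: cov_op_eq[OF f])
  also have "\<dots> = (\<integral>x. ip (X x) g * ip (X x) f \<partial>M)"
    by (rule Fubini_cross_moment[OF measurable_ip_X[OF f] integrable_ip_X_sq[OF f] g])
  finally show ?thesis by (simp add: mult.commute)
qed

lemma cross_moment_psi:
  assumes j: "1 \<le> j" and f: "f \<in> L2"
  shows "(\<integral>x. ip (X x) (psi j) * ip (X x) f \<partial>M) = lam j * ip (psi j) f"
proof -
  have [measurable]: "f \<in> borel_measurable unit_leb" "psi j \<in> borel_measurable unit_leb"
    "cov_op M X (psi j) \<in> borel_measurable unit_leb"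
    using f psi_L2 L2_measurable measurable_cov_op by blast+
  have "(\<integral>x. ip (X x) (psi j) * ip (X x) f \<partial>M) = ip (cov_op M X (psi j)) f"
    by (rule ip_cov_op[OF psi_L2 f, symmetric])
  also have "\<dots> = (\<integral>t. lam j * psi j t * f t \<partial>unit_leb)"
    unfolding ip_def
  proof (rule integral_cong_AE)
    have "AE t in unit_leb. cov_op M X (psi j) t = lam j * psi j t"
      using X_diagonal j by (simp add: trig_diagonal_def)
    then show "AE t in unit_leb. cov_op M X (psi j) t * f t = lam j * psi j t * f t"
      by eventually_elim simp
  qed measurable
  finally show ?thesis by (simp add: ip_def mult.assoc)
qed

text \<open>The prediction error is this quadratic form, and the lemma splits it into the errors of the
  single coefficients. The form at \<open>f\<close> exceeds the partial sum exactly by the form at the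
  remainder of \<open>f\<close>, since the mixed terms vanish; and the form is bounded by the trace times
  the squared norm, so that it tends to zero along the remainders.\<close>

lemma cov_op_quadratic_form:
  assumes f: "f \<in> L2"
  shows "(\<lambda>l. lam (Suc l) * (ip f (psi (Suc l)))\<^sup>2) sums ip (cov_op M X f) f"
proof -
  let ?a = "\<lambda>l. ip f (psi (Suc l))"
  define B where "B g h = (\<integral>x. ip (X x) g * ip (X x) h \<partial>M)" for g h
  have B_resid: "B (resid f n) h = B f h - (\<Sum>l<n. ?a l * (lam (Suc l) * ip (psi (Suc l)) h))"
    if h: "h \<in> L2" for n h
  proof -
    have "B (resid f n) h =
      (\<integral>x. ip (X x) f * ip (X x) h - (\<Sum>l<n. ?a l * (ip (X x) (psi (Suc l)) * ip (X x) h)) \<partial>M)"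
      unfolding B_def
    proof (intro Bochner_Integration.integral_cong refl)
      fix x assume "x \<in> space M"
      note x = X_L2[OF this]
      have "ip (X x) (resid f n) = ip (X x) f - (\<Sum>l<n. ?a l * ip (X x) (psi (Suc l)))"
        unfolding resid_def
        by (subst ip_diff_right[OF f psi_comb_L2 x], subst ip_sum_right)
          (simp_all add: x L2_scale psi_L2 ip_scale_right)
      then show "ip (X x) (resid f n) * ip (X x) h =
        ip (X x) f * ip (X x) h - (\<Sum>l<n. ?a l * (ip (X x) (psi (Suc l)) * ip (X x) h))"
        by (simp add: left_diff_distrib sum_distrib_right mult.assoc)
    qed
    also have "\<dots> = B f h - (\<Sum>l<n. ?a l * B (psi (Suc l)) h)"
      unfolding B_def using f h psi_L2
      by (simp add: integrable_ip_X_mult)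
    finally show ?thesis using h by (simp add: B_def cross_moment_psi)
  qed
  have B_sym: "B g h = B h g" for g h by (simp add: B_def mult.commute)
  have eq: "B (resid f n) (resid f n) = B f f - (\<Sum>l<n. lam (Suc l) * (?a l)\<^sup>2)" for n
  proof -
    have "B (resid f n) (resid f n) = B f (resid f n)"
      using B_resid[OF resid_L2[OF f]] by (simp add: ip_commute[of "psi _"] ip_resid_psi[OF f])
    also have "\<dots> = B (resid f n) f" by (rule B_sym)
    also have "\<dots> = B f f - (\<Sum>l<n. lam (Suc l) * (?a l)\<^sup>2)"
      unfolding B_resid[OF f]
      by (simp add: ip_commute[of "psi _"] power2_eq_square mult_ac)
    finally show ?thesis .
  qed
  have bound: "norm (B (resid f n) (resid f n)) \<le> total_variance * ip (resid f n) (resid f n)" for n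
  proof -
    have "B (resid f n) (resid f n) \<le> (\<integral>x. ip (X x) (X x) * ip (resid f n) (resid f n) \<partial>M)"
      unfolding B_def
      using ip_Cauchy_Schwarz[OF X_L2 resid_L2[OF f]] integrable_norm_X
        integrable_ip_X_mult[OF resid_L2[OF f] resid_L2[OF f]]
      by (intro integral_mono) (auto simp: power2_eq_square)
    moreover have "0 \<le> B (resid f n) (resid f n)" by (simp add: B_def)
    ultimately show ?thesis by (simp add: total_variance_def)
  qed
  have "(\<lambda>n. B (resid f n) (resid f n)) \<longlonglongrightarrow> 0"
    by (rule Lim_null_comparison[OF always_eventually tendsto_mult_right_zero[OF resid_tendsto_zero[OF f]]])
      (use bound in blast)
  then have "(\<lambda>n. B f f - (B f f - (\<Sum>l<n. lam (Suc l) * (?a l)\<^sup>2))) \<longlonglongrightarrow> B f f - 0"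
    unfolding eq by (rule tendsto_diff[OF tendsto_const])
  then show ?thesis unfolding sums_def by (simp add: ip_cov_op[OF f f] B_def)
qed

lemma sum_lam_le: "(\<Sum>l<n. lam (Suc l)) \<le> total_variance"
proof -
  have "(\<Sum>l<n. lam (Suc l)) = (\<integral>x. (\<Sum>l<n. (ip (X x) (psi (Suc l)))\<^sup>2) \<partial>M)"
    by (simp add: eigval_def integrable_ip_X_sq psi_L2)
  also have "\<dots> \<le> total_variance"
    unfolding total_variance_def
    using bessel[OF X_L2] integrable_norm_X by (intro integral_mono) (auto simp: integrable_ip_X_sq psi_L2)
  finally show ?thesis .
qed

lemma lam_le: "1 \<le> j \<Longrightarrow> lam j \<le> total_variance"
  using sum_lam_le[of j] lam_pos
    member_le_sum[of "j - 1" "{..<j}" "\<lambda>l. lam (Suc l)"] by (force simp: less_imp_le)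

end

section \<open>Sums of independent random variables\<close>

lemma exp_minus_le_quadratic:
  fixes y :: real
  assumes "0 \<le> y"
  shows "exp (- y) \<le> 1 - y + y\<^sup>2 / 2"
proof -
  let ?f = "\<lambda>y::real. 1 - y + y\<^sup>2 / 2 - exp (- y)"
  have "?f 0 \<le> ?f y"
  proof (rule DERIV_nonneg_imp_nondecreasing[OF assms])
    fix x :: real
    have "(?f has_real_derivative (- 1 + x + exp (- x))) (at x)"
      by (auto intro!: derivative_eq_intros)
    moreover have "0 \<le> - 1 + x + exp (- x)" using exp_ge_add_one_self[of "- x"] by simp
    ultimately show "\<exists>y. (?f has_real_derivative y) (at x) \<and> 0 \<le> y" by blast
  qed
  then show ?thesis by simp
qed

context prob_space
begin

text \<open>For a nonnegative variable the Laplace transform at \<open>s\<close> is at most one minus \<open>s\<close> times the first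
  moment plus \<open>s\<^sup>2 / 2\<close> times the second, because the exponential of a negative number lies
  below its quadratic Taylor polynomial. Two moments thus give an exponential bound for the
  lower tail, although the variables are unbounded.\<close>

lemma lower_tail_nonneg:
  fixes A :: "'i \<Rightarrow> 'a \<Rightarrow> real"
  assumes I: "finite I" and ind: "indep_vars (\<lambda>_. borel) A I"
    and nonneg: "\<And>i x. i \<in> I \<Longrightarrow> 0 \<le> A i x"
    and int: "\<And>i. i \<in> I \<Longrightarrow> integrable M (A i)" "\<And>i. i \<in> I \<Longrightarrow> integrable M (\<lambda>x. (A i x)\<^sup>2)"
    and mean: "\<And>i. i \<in> I \<Longrightarrow> expectation (A i) = 1"
    and second: "\<And>i. i \<in> I \<Longrightarrow> expectation (\<lambda>x. (A i x)\<^sup>2) \<le> H" and H: "1 \<le> H"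
  shows "emeasure M {x \<in> space M. (\<Sum>i\<in>I. A i x) < real (card I) / 2} \<le> ennreal (exp (- real (card I) / (8 * H)))"
proof -
  \<comment> \<open>this value minimises the resulting exponent \<open>- s / 2 + s\<^sup>2 * H / 2\<close>\<close>
  define s where "s = 1 / (2 * H)"
  have s: "0 < s" using H by (simp add: s_def)
  have [measurable]: "A i \<in> borel_measurable M" if "i \<in> I" for i
    using int(1)[OF that] by simp
  have factor: "(\<integral>\<^sup>+x. ennreal (exp (- s * A i x)) \<partial>M) \<le> ennreal (exp (- 3 / (8 * H)))" if i: "i \<in> I" for i
  proof -
    have le: "exp (- s * A i x) \<le> 1 - s * A i x + s\<^sup>2 / 2 * (A i x)\<^sup>2" for x
      using exp_minus_le_quadratic[of "s * A i x"] s nonneg[OF i, of x]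
      by (simp add: power_mult_distrib)
    have int': "integrable M (\<lambda>x. 1 - s * A i x + s\<^sup>2 / 2 * (A i x)\<^sup>2)"
      using int[OF i] by simp
    have "(\<integral>\<^sup>+x. ennreal (exp (- s * A i x)) \<partial>M) \<le> (\<integral>\<^sup>+x. ennreal (1 - s * A i x + s\<^sup>2 / 2 * (A i x)\<^sup>2) \<partial>M)"
      using le by (intro nn_integral_mono ennreal_leI)
    also have "\<dots> = ennreal (expectation (\<lambda>x. 1 - s * A i x + s\<^sup>2 / 2 * (A i x)\<^sup>2))"
      using int' le by (intro nn_integral_eq_integral) (auto intro!: AE_I2 order_trans[OF exp_ge_zero])
    also have "expectation (\<lambda>x. 1 - s * A i x + s\<^sup>2 / 2 * (A i x)\<^sup>2) =
        1 - s * 1 + s\<^sup>2 / 2 * expectation (\<lambda>x. (A i x)\<^sup>2)"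
      using int[OF i] mean[OF i] by (simp add: prob_space)
    also have "\<dots> \<le> 1 - s * 1 + s\<^sup>2 / 2 * H"
      using second[OF i] by (intro add_left_mono mult_left_mono) simp_all
    also have "\<dots> = 1 + (- 3 / (8 * H))"
      using H by (simp add: s_def power2_eq_square field_simps)
    also have "\<dots> \<le> exp (- 3 / (8 * H))" by (rule exp_ge_add_one_self)
    finally show ?thesis by (simp add: ennreal_leI)
  qed
  have "emeasure M {x \<in> space M. (\<Sum>i\<in>I. A i x) < real (card I) / 2}
      \<le> emeasure M {x \<in> space M. 1 \<le> ennreal (exp (s * real (card I) / 2)) * (\<Prod>i\<in>I. ennreal (exp (- s * A i x)))}"
  proof (rule emeasure_mono)
    show "{x \<in> space M. (\<Sum>i\<in>I. A i x) < real (card I) / 2} \<subseteq>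
      {x \<in> space M. 1 \<le> ennreal (exp (s * real (card I) / 2)) * (\<Prod>i\<in>I. ennreal (exp (- s * A i x)))}"
    proof safe
      fix x assume "(\<Sum>i\<in>I. A i x) < real (card I) / 2"
      then have "s * (\<Sum>i\<in>I. A i x) \<le> s * (real (card I) / 2)"
        using s by (intro mult_left_mono) auto
      then have "(0 :: real) \<le> s * real (card I) / 2 + (\<Sum>i\<in>I. - s * A i x)"
        by (simp add: sum_distrib_left[symmetric] sum_negf)
      then have "1 \<le> exp (s * real (card I) / 2) * exp (\<Sum>i\<in>I. - s * A i x)"
        by (simp add: exp_add[symmetric])
      then have "ennreal 1 \<le> ennreal (exp (s * real (card I) / 2) * exp (\<Sum>i\<in>I. - s * A i x))"
        by (rule ennreal_leI)
      then show "1 \<le> ennreal (exp (s * real (card I) / 2)) * (\<Prod>i\<in>I. ennreal (exp (- s * A i x)))"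
        using I by (simp add: exp_sum ennreal_mult prod_ennreal prod_nonneg)
    qed
  qed (use I in measurable)
  also have "\<dots> \<le> ennreal (exp (s * real (card I) / 2)) * (\<integral>\<^sup>+x. (\<Prod>i\<in>I. ennreal (exp (- s * A i x))) * indicator (space M) x \<partial>M)"
    using nn_integral_Markov_inequality[of "\<lambda>x. \<Prod>i\<in>I. ennreal (exp (- s * A i x))" "space M" M "ennreal (exp (s * real (card I) / 2))"]
    by (simp add: I)
  also have "(\<integral>\<^sup>+x. (\<Prod>i\<in>I. ennreal (exp (- s * A i x))) * indicator (space M) x \<partial>M) =
      (\<integral>\<^sup>+x. (\<Prod>i\<in>I. ennreal (exp (- s * A i x))) \<partial>M)"
    by (intro nn_integral_cong) simp
  also have "\<dots> = (\<Prod>i\<in>I. \<integral>\<^sup>+x. ennreal (exp (- s * A i x)) \<partial>M)"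
    by (intro indep_vars_nn_integral I indep_vars_compose2[OF ind]) auto
  also have "\<dots> \<le> (\<Prod>i\<in>I. ennreal (exp (- 3 / (8 * H))))"
    using factor by (intro prod_mono_ennreal)
  also have "\<dots> = ennreal (exp (real (card I) * (- 3 / (8 * H))))"
    by (simp add: ennreal_power exp_of_nat_mult[symmetric])
  also have "ennreal (exp (s * real (card I) / 2)) * \<dots> =
      ennreal (exp (s * real (card I) / 2 + real (card I) * (- 3 / (8 * H))))"
    unfolding exp_add by (rule ennreal_mult[symmetric]) auto
  also have "s * real (card I) / 2 + real (card I) * (- 3 / (8 * H)) = - real (card I) / (8 * H)"
    using H by (simp add: s_def field_simps)
  finally show ?thesis by (simp add: mult_left_mono)
qed

lemma second_moment_sum_indep:
  fixes U :: "'i \<Rightarrow> 'a \<Rightarrow> real"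
  assumes I: "finite I" and ind: "indep_vars (\<lambda>_. borel) U I"
    and sq: "\<And>i. i \<in> I \<Longrightarrow> integrable M (\<lambda>x. (U i x)\<^sup>2)"
    and mean: "\<And>i. i \<in> I \<Longrightarrow> expectation (U i) = 0"
    and v: "\<And>i. i \<in> I \<Longrightarrow> expectation (\<lambda>x. (U i x)\<^sup>2) \<le> v"
  shows "(\<integral>\<^sup>+x. ennreal ((\<Sum>i\<in>I. U i x)\<^sup>2) \<partial>M) \<le> ennreal (real (card I) * v)"
proof -
  have meas: "U i \<in> borel_measurable M" if "i \<in> I" for i
    using ind that by (auto simp: indep_vars_def)
  have int: "integrable M (U i)" if "i \<in> I" for i
    using meas[OF that] sq[OF that] by (rule square_integrable_imp_integrable)
  have pair: "integrable M (\<lambda>x. U i x * U j x) \<and> expectation (\<lambda>x. U i x * U j x) = 0"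
    if ij: "i \<in> I" "j \<in> I" "i \<noteq> j" for i j
  proof -
    have ind': "indep_vars (\<lambda>_. borel) U {i, j}" using ind ij by (auto intro: indep_vars_subset)
    have int': "integrable M (U k)" if "k \<in> {i, j}" for k using int that ij by auto
    show ?thesis
      using indep_vars_lebesgue_integral[OF _ ind' int'] indep_vars_integrable[OF _ ind' int'] ij mean by simp
  qed
  have int2: "integrable M (\<lambda>x. U i x * U j x)" if "i \<in> I" "j \<in> I" for i j
    using pair[OF that] sq[OF that(1)] by (cases "i = j") (auto simp: power2_eq_square)
  have eq: "(\<Sum>i\<in>I. U i x)\<^sup>2 = (\<Sum>i\<in>I. \<Sum>j\<in>I. U i x * U j x)" for x
    by (simp add: power2_eq_square sum_product)
  have "(\<integral>\<^sup>+x. ennreal ((\<Sum>i\<in>I. U i x)\<^sup>2) \<partial>M) = ennreal (expectation (\<lambda>x. (\<Sum>i\<in>I. U i x)\<^sup>2))"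
    by (rule nn_integral_eq_integral) (simp add: eq int2, simp)
  also have "expectation (\<lambda>x. (\<Sum>i\<in>I. U i x)\<^sup>2) = (\<Sum>i\<in>I. \<Sum>j\<in>I. expectation (\<lambda>x. U i x * U j x))"
    unfolding eq using int2 by (simp add: Bochner_Integration.integral_sum)
  also have "\<dots> = (\<Sum>i\<in>I. \<Sum>j\<in>I. if i = j then expectation (\<lambda>x. (U i x)\<^sup>2) else 0)"
    using pair by (intro sum.cong) (auto simp: power2_eq_square)
  also have "\<dots> = (\<Sum>i\<in>I. expectation (\<lambda>x. (U i x)\<^sup>2))" using I by simp
  also have "\<dots> \<le> real (card I) * v" using sum_bounded_above[of I _ v] v by simp
  finally show ?thesis by (simp add: ennreal_leI)
qed

end


section \<open>The sample and its moments\<close>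

lemma L2_space_space: "space L2_space = L2"
  unfolding L2_space_def by (rule space_measure_of) auto

lemma measurable_ip_L2_space:
  assumes "f \<in> L2"
  shows "(\<lambda>g. ip g f) \<in> borel_measurable L2_space"
proof (rule measurableI)
  fix B :: "real set" assume "B \<in> sets borel"
  then have "{g \<in> L2. ip g f \<in> B} \<in> sets L2_space"
    unfolding L2_space_def using assms by (intro in_measure_of) auto
  moreover have "(\<lambda>g. ip g f) -` B \<inter> space L2_space = {g \<in> L2. ip g f \<in> B}"
    by (auto simp: L2_space_space)
  ultimately show "(\<lambda>g. ip g f) -` B \<inter> space L2_space \<in> sets L2_space" by simp
qed simp

lemma measurable_L2_space:
  assumes "\<And>x. x \<in> space M \<Longrightarrow> X x \<in> L2" "\<And>f. f \<in> L2 \<Longrightarrow> (\<lambda>x. ip (X x) f) \<in> borel_measurable M"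
  shows "X \<in> measurable M L2_space"
  unfolding L2_space_def
proof (rule measurable_measure_of)
  show "X \<in> space M \<rightarrow> L2" using assms(1) by blast
  fix A assume "A \<in> {{g \<in> L2. ip g f \<in> B} |f B. f \<in> L2 \<and> B \<in> sets borel}"
  then obtain f B where A: "A = {g \<in> L2. ip g f \<in> B}" "f \<in> L2" "B \<in> sets borel" by blast
  have "X -` A \<inter> space M = (\<lambda>x. ip (X x) f) -` B \<inter> space M" using A assms(1) by auto
  also have "\<dots> \<in> sets M" using A assms(2) by (intro measurable_sets) auto
  finally show "X -` A \<inter> space M \<in> sets M" .
qed auto

text \<open>Deterministic error of one thresholded coefficient. Here \<open>b\<close> is the true coefficient, \<open>L\<close> and \<open>lam\<close>
  are the empirical and the true eigenvalue, \<open>W\<close> is the noise in the numerator and \<open>Q\<close> the mean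
  squared noise. Above the threshold the error is \<open>W / L\<close>; if \<open>L\<close> is not less than half of
  \<open>lam\<close>, it is at most twice \<open>W / lam\<close> in modulus, and otherwise \<open>W\<^sup>2 / L\<^sup>2 \<le> Q / L \<le> Q / \<alpha>\<close>.
  Below the threshold the error is \<open>b\<close>, and either \<open>L\<close> is untypically small or \<open>lam\<close> itself is at
  most \<open>2 * \<alpha>\<close>.\<close>

lemma coefficient_error_le:
  fixes lam \<alpha> b L W Q g :: real
  assumes lam: "0 < lam" and \<alpha>: "0 < \<alpha>" and WQ: "W\<^sup>2 \<le> L * Q" and Q: "0 \<le> Q"
    and g: "g = b * L + W"
  shows "lam * (g / L * (if L \<ge> \<alpha> then 1 else 0) - b)\<^sup>2
    \<le> 4 * W\<^sup>2 / lam + (lam / \<alpha> * Q + lam * b\<^sup>2) * (if L < lam / 2 then 1 else 0) + 2 * \<alpha> * b\<^sup>2"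
proof (cases "L \<ge> \<alpha>")
  case True
  then have L: "0 < L" using \<alpha> by simp
  have "lam * (g / L * (if L \<ge> \<alpha> then 1 else 0) - b)\<^sup>2 = lam * W\<^sup>2 / L\<^sup>2"
    using True L by (simp add: g field_simps power2_eq_square)
  also have "\<dots> \<le> 4 * W\<^sup>2 / lam + (lam / \<alpha> * Q + lam * b\<^sup>2) * (if L < lam / 2 then 1 else 0)"
  proof (cases "L < lam / 2")
    case True
    have "lam * W\<^sup>2 / L\<^sup>2 \<le> lam * (L * Q) / L\<^sup>2"
      using WQ lam by (intro divide_right_mono mult_left_mono) auto
    also have "\<dots> = lam / L * Q" using L by (simp add: power2_eq_square)
    also have "\<dots> \<le> lam / \<alpha> * Q"
      using \<open>L \<ge> \<alpha>\<close> lam \<alpha> Q by (intro mult_right_mono divide_left_mono) auto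
    also have "\<dots> \<le> 4 * W\<^sup>2 / lam + (lam / \<alpha> * Q + lam * b\<^sup>2)"
      using lam by simp
    finally show ?thesis using True by simp
  next
    case False
    then have "(lam / 2)\<^sup>2 \<le> L\<^sup>2" using lam by (intro power_mono) auto
    then have "lam * W\<^sup>2 / L\<^sup>2 \<le> lam * W\<^sup>2 / (lam / 2)\<^sup>2"
      using lam L by (intro divide_left_mono) auto
    also have "\<dots> = 4 * W\<^sup>2 / lam" using lam by (simp add: power2_eq_square)
    finally show ?thesis using False by simp
  qed
  also have "\<dots> \<le> \<dots> + 2 * \<alpha> * b\<^sup>2" using \<alpha> by simp
  finally show ?thesis .
next
  case False
  have "lam * b\<^sup>2 \<le> (lam / \<alpha> * Q + lam * b\<^sup>2) * (if L < lam / 2 then 1 else 0) + 2 * \<alpha> * b\<^sup>2"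
  proof (cases "L < lam / 2")
    case True
    then show ?thesis using lam \<alpha> Q by simp
  next
    case L: False
    then have "lam * b\<^sup>2 \<le> 2 * \<alpha> * b\<^sup>2" using False by (intro mult_right_mono) auto
    then show ?thesis using L by simp
  qed
  moreover have "0 \<le> 4 * W\<^sup>2 / lam" using lam by simp
  ultimately show ?thesis using False by simp
qed

lemma power4_add_le: "(a + b :: real) ^ 4 \<le> 8 * (a ^ 4 + b ^ 4)"
proof -
  have "(a + b)\<^sup>2 \<le> 2 * (a\<^sup>2 + b\<^sup>2)" using zero_le_power2[of "a - b"]
    by (simp add: power2_sum power2_diff)
  then have "((a + b)\<^sup>2)\<^sup>2 \<le> (2 * (a\<^sup>2 + b\<^sup>2))\<^sup>2" by (intro power_mono) auto
  also have "\<dots> \<le> 8 * ((a\<^sup>2)\<^sup>2 + (b\<^sup>2)\<^sup>2)" using zero_le_power2[of "a\<^sup>2 - b\<^sup>2"]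
    by (simp add: power2_sum power2_diff power_mult_distrib)
  finally show ?thesis by (simp add: power_mult[symmetric])
qed

text \<open>All estimates use the single constant \<open>H\<close>, a bound for the fourth moments of the error and
  of the standardised coefficients of the regressor.\<close>

locale functional_linear_sample = stationary_regressor M X + N: prob_space N
  for M :: "'a measure" and X :: "'a \<Rightarrow> real \<Rightarrow> real" and N :: "'b measure" +
  fixes e :: "'a \<Rightarrow> real" and es :: "nat \<Rightarrow> 'b \<Rightarrow> real" and Xs :: "nat \<Rightarrow> 'b \<Rightarrow> real \<Rightarrow> real"
    and \<sigma> H :: real
  assumes iid: "iid_copies M e X N es Xs" and uncorr: "uncorrelated M e X"
    and e_meas [measurable]: "e \<in> borel_measurable M"
    and e_moment: "(\<integral>\<^sup>+x. ennreal (e x ^ 4) \<partial>M) \<le> ennreal H"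
    and X_moment: "\<And>j. 1 \<le> j \<Longrightarrow>
      (\<integral>\<^sup>+x. ennreal ((ip (X x) (psi j) / sqrt (eigval M X j)) ^ 4) \<partial>M) \<le> ennreal H"
    and H_ge_1: "1 \<le> H"
begin

lemma e_sq_integrable: "integrable M (\<lambda>x. (e x)\<^sup>2)"
proof -
  have "integrable M (\<lambda>x. e x ^ 4)"
    using e_moment by (intro integrableI_nonneg) (auto simp: le_less_trans)
  then have "integrable M (\<lambda>x. ((e x)\<^sup>2)\<^sup>2)" by (simp add: power_mult[symmetric])
  with square_integrable_imp_integrable[of "\<lambda>x. (e x)\<^sup>2"] show ?thesis by simp
qed

lemma coef_moment:
  assumes j: "1 \<le> j"
  shows "integrable M (\<lambda>x. ip (X x) (psi j) ^ 4)" "(\<integral>x. ip (X x) (psi j) ^ 4 \<partial>M) \<le> H * (lam j)\<^sup>2"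
proof -
  have [measurable]: "(\<lambda>x. ip (X x) (psi j)) \<in> borel_measurable M" by (rule measurable_ip_X[OF psi_L2])
  let ?Z = "\<lambda>x. (ip (X x) (psi j) / sqrt (lam j)) ^ 4"
  have Z: "integrable M ?Z"
    using X_moment[OF j] by (intro integrableI_nonneg) (auto simp: le_less_trans)
  have "ennreal (\<integral>x. ?Z x \<partial>M) \<le> ennreal H"
    using nn_integral_eq_integral[OF Z] X_moment[OF j] by simp
  then have ZH: "(\<integral>x. ?Z x \<partial>M) \<le> H" using H_ge_1 by simp
  have "sqrt (lam j) ^ 4 = (lam j)\<^sup>2"
    using lam_pos[OF j] power_mult[of "sqrt (lam j)" 2 2] by simp
  then have eq: "ip (X x) (psi j) ^ 4 = (lam j)\<^sup>2 * ?Z x" for x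
    using lam_pos[OF j] by (simp add: power_divide)
  show "integrable M (\<lambda>x. ip (X x) (psi j) ^ 4)" unfolding eq using Z by simp
  show "(\<integral>x. ip (X x) (psi j) ^ 4 \<partial>M) \<le> H * (lam j)\<^sup>2"
    unfolding eq using mult_left_mono[OF ZH, of "(lam j)\<^sup>2"] by (simp add: mult.commute[of H])
qed

text \<open>By the Cauchy-Schwarz inequality the square of \<open>\<Sum>c\<^sub>l\<^sup>2\<close> is at most
  \<open>(\<Sum>lam\<^sub>l) * (\<Sum>c\<^sub>l\<^sup>4 / lam\<^sub>l)\<close>, and the fourth moment of each coefficient is at
  most a multiple of its squared variance. The squared norm is only a limit of such sums, whence the
  use of Fatou's lemma.\<close>

lemma norm_moment: "(\<integral>\<^sup>+x. ennreal ((ip (X x) (X x))\<^sup>2) \<partial>M) \<le> ennreal (total_variance\<^sup>2 * H)"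
proof -
  let ?c = "\<lambda>x l. ip (X x) (psi (Suc l))"
  define S where "S n x = (\<Sum>l<n. (?c x l)\<^sup>2)" for n x
  have [measurable]: "(\<lambda>x. ?c x l) \<in> borel_measurable M" for l by (rule measurable_ip_X[OF psi_L2])
  have "S n \<in> borel_measurable M" for n unfolding S_def by measurable
  note [measurable] = this
  have S_le: "(S n x)\<^sup>2 \<le> (\<Sum>l<n. lam (Suc l)) * (\<Sum>l<n. ?c x l ^ 4 / lam (Suc l))" for n x
  proof -
    have "(S n x)\<^sup>2 = (\<Sum>l<n. sqrt (lam (Suc l)) * ((?c x l)\<^sup>2 / sqrt (lam (Suc l))))\<^sup>2"
      unfolding S_def using lam_pos by (intro arg_cong[where f = "\<lambda>a. a\<^sup>2"] sum.cong) (auto simp: less_imp_neq[symmetric])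
    also have "\<dots> \<le> (\<Sum>l<n. (sqrt (lam (Suc l)))\<^sup>2) * (\<Sum>l<n. ((?c x l)\<^sup>2 / sqrt (lam (Suc l)))\<^sup>2)"
      by (rule Cauchy_Schwarz_ineq_sum)
    also have "\<dots> = (\<Sum>l<n. lam (Suc l)) * (\<Sum>l<n. ?c x l ^ 4 / lam (Suc l))"
      using lam_pos by (simp add: power_divide less_imp_le power_mult[symmetric])
    finally show ?thesis .
  qed
  have S_int: "(\<integral>\<^sup>+x. ennreal ((S n x)\<^sup>2) \<partial>M) \<le> ennreal (total_variance\<^sup>2 * H)" for n
  proof -
    let ?G = "\<lambda>x. (\<Sum>l<n. lam (Suc l)) * (\<Sum>l<n. ?c x l ^ 4 / lam (Suc l))"
    have G: "integrable M ?G" using coef_moment(1) by auto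
    have "(\<integral>\<^sup>+x. ennreal ((S n x)\<^sup>2) \<partial>M) \<le> (\<integral>\<^sup>+x. ennreal (?G x) \<partial>M)"
      using S_le by (intro nn_integral_mono ennreal_leI)
    also have "\<dots> = ennreal (\<integral>x. ?G x \<partial>M)"
      using S_le by (intro nn_integral_eq_integral G AE_I2) (rule order_trans[OF zero_le_power2])
    also have "(\<integral>x. ?G x \<partial>M) = (\<Sum>l<n. lam (Suc l)) * (\<Sum>l<n. (\<integral>x. ?c x l ^ 4 \<partial>M) / lam (Suc l))"
      using coef_moment(1) by simp
    also have "\<dots> \<le> (\<Sum>l<n. lam (Suc l)) * (\<Sum>l<n. H * lam (Suc l))"
    proof (intro mult_left_mono sum_mono)
      fix l
      show "(\<integral>x. ?c x l ^ 4 \<partial>M) / lam (Suc l) \<le> H * lam (Suc l)"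
        using coef_moment(2)[of "Suc l"] lam_pos[of "Suc l"]
        by (simp add: divide_le_eq power2_eq_square mult.assoc)
      show "0 \<le> (\<Sum>l<n. lam (Suc l))" by (rule sum_nonneg) (simp add: lam_pos less_imp_le)
    qed
    also have "\<dots> = H * (\<Sum>l<n. lam (Suc l))\<^sup>2"
      by (simp add: sum_distrib_left[symmetric] power2_eq_square)
    also have "\<dots> \<le> H * total_variance\<^sup>2"
    proof (intro mult_left_mono power_mono sum_lam_le)
      show "0 \<le> (\<Sum>l<n. lam (Suc l))" by (rule sum_nonneg) (simp add: lam_pos less_imp_le)
    qed (use H_ge_1 in simp)
    finally show ?thesis by (simp add: mult.commute ennreal_leI)
  qed
  have "(\<integral>\<^sup>+x. ennreal ((ip (X x) (X x))\<^sup>2) \<partial>M) = (\<integral>\<^sup>+x. liminf (\<lambda>n. ennreal ((S n x)\<^sup>2)) \<partial>M)"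
  proof (rule nn_integral_cong)
    fix x assume "x \<in> space M"
    then have "(\<lambda>n. S n x) \<longlonglongrightarrow> ip (X x) (X x)"
      using parseval[OF X_L2] by (simp add: S_def sums_def)
    then have "(\<lambda>n. ennreal ((S n x)\<^sup>2)) \<longlonglongrightarrow> ennreal ((ip (X x) (X x))\<^sup>2)"
      by (intro tendsto_ennrealI tendsto_power)
    then show "ennreal ((ip (X x) (X x))\<^sup>2) = liminf (\<lambda>n. ennreal ((S n x)\<^sup>2))"
      by (intro lim_imp_Liminf[symmetric]) auto
  qed
  also have "\<dots> \<le> liminf (\<lambda>n. \<integral>\<^sup>+x. ennreal ((S n x)\<^sup>2) \<partial>M)"
    by (rule nn_integral_liminf) measurable
  also have "\<dots> \<le> limsup (\<lambda>n. \<integral>\<^sup>+x. ennreal ((S n x)\<^sup>2) \<partial>M)"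
    by (rule Liminf_le_Limsup) simp
  also have "\<dots> \<le> ennreal (total_variance\<^sup>2 * H)"
    using S_int by (intro Limsup_bounded always_eventually) auto
  finally show ?thesis .
qed

text \<open>Depends on the slope only through a bound for its norm, which makes the bound for the risk
  uniform over the ellipsoid.\<close>

definition noise_bound :: "real \<Rightarrow> real" where
  "noise_bound \<rho> = 8 * (\<rho>\<^sup>2 * (total_variance\<^sup>2 * H) + \<sigma> ^ 4 * H)"

lemma noise_bound_nonneg: "0 \<le> noise_bound \<rho>"
  using H_ge_1 by (simp add: noise_bound_def)

lemma noise_moment:
  assumes b: "b \<in> L2" and \<rho>: "ip b b \<le> \<rho>"
  shows "(\<integral>\<^sup>+x. ennreal ((ip (X x) b + \<sigma> * e x) ^ 4) \<partial>M) \<le> ennreal (noise_bound \<rho>)"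
proof -
  have [measurable]: "(\<lambda>x. ip (X x) (X x)) \<in> borel_measurable M" using integrable_norm_X by simp
  have "(\<integral>\<^sup>+x. ennreal ((ip (X x) b + \<sigma> * e x) ^ 4) \<partial>M)
      \<le> (\<integral>\<^sup>+x. ennreal (8 * \<rho>\<^sup>2) * ennreal ((ip (X x) (X x))\<^sup>2) + ennreal (8 * \<sigma> ^ 4) * ennreal (e x ^ 4) \<partial>M)"
  proof (rule nn_integral_mono)
    fix x assume x: "x \<in> space M"
    have "(ip (X x) b)\<^sup>2 \<le> ip (X x) (X x) * \<rho>"
      using ip_Cauchy_Schwarz[OF X_L2[OF x] b] mult_left_mono[OF \<rho> ip_self_nonneg[of "X x"]] by linarith
    then have "((ip (X x) b)\<^sup>2)\<^sup>2 \<le> (ip (X x) (X x) * \<rho>)\<^sup>2" by (intro power_mono) auto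
    then have "ip (X x) b ^ 4 \<le> \<rho>\<^sup>2 * (ip (X x) (X x))\<^sup>2"
      by (simp add: power_mult[symmetric] power_mult_distrib mult.commute)
    then have "(ip (X x) b + \<sigma> * e x) ^ 4 \<le> 8 * \<rho>\<^sup>2 * (ip (X x) (X x))\<^sup>2 + 8 * \<sigma> ^ 4 * e x ^ 4"
      using power4_add_le[of "ip (X x) b" "\<sigma> * e x"] by (simp add: power_mult_distrib)
    then show "ennreal ((ip (X x) b + \<sigma> * e x) ^ 4)
      \<le> ennreal (8 * \<rho>\<^sup>2) * ennreal ((ip (X x) (X x))\<^sup>2) + ennreal (8 * \<sigma> ^ 4) * ennreal (e x ^ 4)"
      by (simp add: ennreal_mult[symmetric] ennreal_plus[symmetric] ennreal_leI del: ennreal_plus)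
  qed
  also have "\<dots> = ennreal (8 * \<rho>\<^sup>2) * (\<integral>\<^sup>+x. ennreal ((ip (X x) (X x))\<^sup>2) \<partial>M)
      + ennreal (8 * \<sigma> ^ 4) * (\<integral>\<^sup>+x. ennreal (e x ^ 4) \<partial>M)"
    by (simp add: nn_integral_add nn_integral_cmult)
  also have "\<dots> \<le> ennreal (8 * \<rho>\<^sup>2) * ennreal (total_variance\<^sup>2 * H) + ennreal (8 * \<sigma> ^ 4) * ennreal H"
    by (intro add_mono mult_left_mono norm_moment e_moment) auto
  also have "\<dots> = ennreal (noise_bound \<rho>)"
    using H_ge_1 by (simp add: noise_bound_def ennreal_mult[symmetric] ennreal_plus[symmetric] algebra_simps del: ennreal_plus)
  finally show ?thesis .
qed

lemma pair_measurable: "(\<lambda>x. (e x, X x)) \<in> measurable M (borel \<Otimes>\<^sub>M L2_space)"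
  by (intro measurable_Pair e_meas measurable_L2_space X_L2 measurable_ip_X)

lemma sample_measurable: "1 \<le> i \<Longrightarrow> (\<lambda>w. (es i w, Xs i w)) \<in> measurable N (borel \<Otimes>\<^sub>M L2_space)"
  using iid by (auto simp: iid_copies_def N.indep_vars_def)

lemma sample_nn_integral:
  assumes "1 \<le> i" "F \<in> borel_measurable (borel \<Otimes>\<^sub>M L2_space)"
  shows "(\<integral>\<^sup>+w. F (es i w, Xs i w) \<partial>N) = (\<integral>\<^sup>+x. F (e x, X x) \<partial>M)"
proof -
  have "distr N (borel \<Otimes>\<^sub>M L2_space) (\<lambda>w. (es i w, Xs i w)) = distr M (borel \<Otimes>\<^sub>M L2_space) (\<lambda>x. (e x, X x))"
    using iid assms(1) by (simp add: iid_copies_def)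
  then show ?thesis
    using nn_integral_distr[OF sample_measurable[OF assms(1)], of F]
      nn_integral_distr[OF pair_measurable, of F] assms(2) by simp
qed

lemma sample_integral:
  fixes F :: "real \<times> (real \<Rightarrow> real) \<Rightarrow> real"
  assumes "1 \<le> i" "F \<in> borel_measurable (borel \<Otimes>\<^sub>M L2_space)"
  shows "(\<integral>w. F (es i w, Xs i w) \<partial>N) = (\<integral>x. F (e x, X x) \<partial>M)"
    and "integrable N (\<lambda>w. F (es i w, Xs i w)) \<longleftrightarrow> integrable M (\<lambda>x. F (e x, X x))"
proof -
  have eq: "distr N (borel \<Otimes>\<^sub>M L2_space) (\<lambda>w. (es i w, Xs i w)) = distr M (borel \<Otimes>\<^sub>M L2_space) (\<lambda>x. (e x, X x))"
    using iid assms(1) by (simp add: iid_copies_def)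
  show "(\<integral>w. F (es i w, Xs i w) \<partial>N) = (\<integral>x. F (e x, X x) \<partial>M)"
    using integral_distr[OF sample_measurable[OF assms(1)] assms(2)]
      integral_distr[OF pair_measurable assms(2)] eq by simp
  show "integrable N (\<lambda>w. F (es i w, Xs i w)) \<longleftrightarrow> integrable M (\<lambda>x. F (e x, X x))"
    using integrable_distr_eq[OF sample_measurable[OF assms(1)] assms(2)]
      integrable_distr_eq[OF pair_measurable assms(2)] eq by simp
qed

lemma sample_indep:
  assumes "\<And>i. F i \<in> borel_measurable (borel \<Otimes>\<^sub>M L2_space)"
  shows "N.indep_vars (\<lambda>_. borel) (\<lambda>i w. F i (es i w, Xs i w)) {1..n}"
proof -
  have "N.indep_vars (\<lambda>_. borel \<Otimes>\<^sub>M L2_space) (\<lambda>i w. (es i w, Xs i w)) {1..n}"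
    using iid by (auto simp: iid_copies_def intro: N.indep_vars_subset)
  then show ?thesis by (rule N.indep_vars_compose2) (rule assms)
qed

lemma Xs_L2: "1 \<le> i \<Longrightarrow> w \<in> space N \<Longrightarrow> Xs i w \<in> L2"
  using measurable_space[OF sample_measurable] by (fastforce simp: space_pair_measure L2_space_space)

lemma sample_ip_measurable:
  "1 \<le> i \<Longrightarrow> f \<in> L2 \<Longrightarrow> (\<lambda>w. ip (Xs i w) f) \<in> borel_measurable N"
  using measurable_compose[OF sample_measurable measurable_compose[OF measurable_snd measurable_ip_L2_space], of i f]
  by simp

lemma sample_error_measurable: "1 \<le> i \<Longrightarrow> es i \<in> borel_measurable N"
  using measurable_compose[OF sample_measurable, of i fst borel] measurable_fst by (simp add: comp_def)

end

section \<open>Deviations of the empirical coefficients\<close>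

lemma sobolev_weight_ge_1: "0 \<le> p \<Longrightarrow> 1 \<le> j \<Longrightarrow> 1 \<le> sobolev_weight p j"
  by (auto simp: sobolev_weight_def intro!: ge_one_powr_ge_zero)

lemma sobolev_ellipsoid_sums:
  assumes \<beta>: "\<beta> \<in> sobolev_ellipsoid p \<rho>" and \<rho>: "0 \<le> \<rho>"
  shows "\<beta> \<in> L2" "summable (\<lambda>j. sobolev_weight p (Suc j) * (ip \<beta> (psi (Suc j)))\<^sup>2)"
    "(\<Sum>j. sobolev_weight p (Suc j) * (ip \<beta> (psi (Suc j)))\<^sup>2) \<le> \<rho>"
proof -
  let ?f = "\<lambda>j. sobolev_weight p (Suc j) * (ip \<beta> (psi (Suc j)))\<^sup>2"
  show "\<beta> \<in> L2" using \<beta> by (simp add: sobolev_ellipsoid_def)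
  have nonneg: "0 \<le> ?f j" for j by (simp add: sobolev_weight_def)
  have le: "(\<Sum>j. ennreal (?f j)) \<le> ennreal \<rho>" using \<beta> by (simp add: sobolev_ellipsoid_def)
  then have "(\<Sum>j. ennreal (?f j)) \<noteq> \<top>" by (auto simp: top_unique)
  then show summ: "summable ?f" by (rule summable_suminf_not_top[OF nonneg])
  have "ennreal (\<Sum>j. ?f j) \<le> ennreal \<rho>" using le suminf_ennreal2[OF nonneg summ] by simp
  then show "(\<Sum>j. ?f j) \<le> \<rho>" using \<rho> by simp
qed

lemma sobolev_ellipsoid_norm_le:
  assumes "\<beta> \<in> sobolev_ellipsoid p \<rho>" "0 \<le> \<rho>" "0 \<le> p"
  shows "ip \<beta> \<beta> \<le> \<rho>"
proof -
  note S = sobolev_ellipsoid_sums[OF assms(1,2)]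
  have "ip \<beta> \<beta> = (\<Sum>j. (ip \<beta> (psi (Suc j)))\<^sup>2)" using parseval[OF S(1)] by (rule sums_unique)
  also have "\<dots> \<le> (\<Sum>j. sobolev_weight p (Suc j) * (ip \<beta> (psi (Suc j)))\<^sup>2)"
  proof (rule suminf_le)
    fix j
    show "(ip \<beta> (psi (Suc j)))\<^sup>2 \<le> sobolev_weight p (Suc j) * (ip \<beta> (psi (Suc j)))\<^sup>2"
      using mult_right_mono[OF sobolev_weight_ge_1[OF assms(3), of "Suc j"], of "(ip \<beta> (psi (Suc j)))\<^sup>2"] by simp
  qed (use parseval[OF S(1)] S(2) in \<open>auto simp: sums_iff\<close>)
  finally show ?thesis using S(3) by simp
qed

text \<open>The fourth power is what the risk bound needs: the exponential tail of the empirical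
  eigenvalue has to absorb a factor of the order \<open>n\<^sup>3\<close> and to leave the rate \<open>1 / n\<close>.\<close>

lemma exp_minus_le_inverse_power4:
  fixes x :: real
  assumes "0 < x"
  shows "exp (- x) \<le> 256 / x ^ 4"
proof -
  have "(x / 4) ^ 4 \<le> exp (x / 4) ^ 4"
  proof (rule power_mono)
    show "x / 4 \<le> exp (x / 4)" using exp_ge_add_one_self[of "x / 4"] by linarith
  qed (use assms in simp)
  also have "\<dots> = exp x" by (simp add: exp_of_nat_mult[symmetric])
  finally have "1 / exp x \<le> 1 / (x / 4) ^ 4" using assms by (intro divide_left_mono) auto
  moreover have "1 / (x / 4) ^ 4 = 256 / x ^ 4" by (simp add: power_divide)
  ultimately show ?thesis by (simp add: exp_minus inverse_eq_divide)
qed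

context functional_linear_sample
begin

lemma lambda_hat_measurable: "(\<lambda>w. lambda_hat n (\<lambda>i. Xs i w) j) \<in> borel_measurable N"
proof -
  have "(\<lambda>w. (ip (Xs i w) (psi j))\<^sup>2) \<in> borel_measurable N" if "i \<in> {1..n}" for i
    using sample_ip_measurable[OF _ psi_L2, of i] that by simp
  then show ?thesis unfolding lambda_hat_def by (intro borel_measurable_times borel_measurable_const borel_measurable_sum)
qed

text \<open>The empirical eigenvalue divided by the true one is a mean of squares of standardised
  coefficients, which have expectation one and second moment at most \<open>H\<close>.\<close>

lemma lambda_hat_tail:
  assumes j: "1 \<le> j" and n: "1 \<le> n"
  shows "emeasure N {w \<in> space N. lambda_hat n (\<lambda>i. Xs i w) j < lam j / 2} \<le> ennreal (exp (- real n / (8 * H)))"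
proof -
  let ?F = "\<lambda>p :: real \<times> (real \<Rightarrow> real). (ip (snd p) (psi j))\<^sup>2 / lam j"
  let ?A = "\<lambda>i w. ?F (es i w, Xs i w)"
  have [measurable]: "(\<lambda>g. ip g (psi j)) \<in> borel_measurable L2_space"
    by (rule measurable_ip_L2_space[OF psi_L2])
  have F: "?F \<in> borel_measurable (borel \<Otimes>\<^sub>M L2_space)" by measurable
  then have F2: "(\<lambda>p. (?F p)\<^sup>2) \<in> borel_measurable (borel \<Otimes>\<^sub>M L2_space)" by measurable
  have F2_eq: "(?F (u, g))\<^sup>2 = ip g (psi j) ^ 4 / (lam j)\<^sup>2" for u g
    by (simp add: power_divide power_mult[symmetric])
  have l: "0 < lam j" using j by (rule lam_pos)
  have "emeasure N {w \<in> space N. (\<Sum>i\<in>{1..n}. ?A i w) < real (card {1..n}) / 2}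
      \<le> ennreal (exp (- real (card {1..n}) / (8 * H)))"
  proof (rule N.lower_tail_nonneg[OF _ sample_indep[OF F]])
    fix i assume "i \<in> {1..n}"
    then have i: "1 \<le> i" by simp
    show "integrable N (?A i)"
      using sample_integral(2)[OF i F] integrable_ip_X_sq[OF psi_L2] by simp
    show "integrable N (\<lambda>w. (?A i w)\<^sup>2)"
      using sample_integral(2)[OF i F2] coef_moment(1)[OF j] unfolding F2_eq by simp
    show "(\<integral>w. ?A i w \<partial>N) = 1"
      using sample_integral(1)[OF i F] l by (simp add: eigval_def)
    have "(\<integral>w. (?A i w)\<^sup>2 \<partial>N) = (\<integral>x. ip (X x) (psi j) ^ 4 / (lam j)\<^sup>2 \<partial>M)"
      using sample_integral(1)[OF i F2] unfolding F2_eq by simp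
    also have "\<dots> \<le> H" using coef_moment(2)[OF j] l by (simp add: divide_le_eq)
    finally show "(\<integral>w. (?A i w)\<^sup>2 \<partial>N) \<le> H" .
    show "0 \<le> ?A i w" for w using l by simp
  qed (use H_ge_1 in auto)
  also have "{w \<in> space N. (\<Sum>i\<in>{1..n}. ?A i w) < real (card {1..n}) / 2} =
      {w \<in> space N. lambda_hat n (\<lambda>i. Xs i w) j < lam j / 2}"
    using l n by (auto simp: lambda_hat_def sum_divide_distrib[symmetric] field_simps)
  finally show ?thesis by simp
qed

text \<open>In the application \<open>b\<close> is the slope without its component along the basis function at hand.
  The orthogonality makes the summands centered, since the coefficients of the regressor are
  uncorrelated with each other and with the error.\<close>

lemma score_second_moment:
  assumes j: "1 \<le> j" and b: "b \<in> L2" and ortho: "ip b (psi j) = 0" and \<rho>: "ip b b \<le> \<rho>"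
  shows "(\<integral>\<^sup>+w. ennreal ((\<Sum>i=1..n. ip (Xs i w) (psi j) * (ip (Xs i w) b + \<sigma> * es i w))\<^sup>2) \<partial>N)
    \<le> ennreal (real n * (lam j * (H + noise_bound \<rho>) / 2))"
proof -
  let ?F = "\<lambda>p :: real \<times> (real \<Rightarrow> real). ip (snd p) (psi j) * (ip (snd p) b + \<sigma> * fst p)"
  have [measurable]: "(\<lambda>g. ip g (psi j)) \<in> borel_measurable L2_space" "(\<lambda>g. ip g b) \<in> borel_measurable L2_space"
    by (rule measurable_ip_L2_space, (rule psi_L2 b))+
  have [measurable]: "(\<lambda>x. ip (X x) (psi j)) \<in> borel_measurable M" "(\<lambda>x. ip (X x) b) \<in> borel_measurable M"
    by (rule measurable_ip_X, (rule psi_L2 b))+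
  have F: "?F \<in> borel_measurable (borel \<Otimes>\<^sub>M L2_space)" by measurable
  then have F2: "(\<lambda>p. (?F p)\<^sup>2) \<in> borel_measurable (borel \<Otimes>\<^sub>M L2_space)" by measurable
  have l: "0 < lam j" using j by (rule lam_pos)
  let ?x = "\<lambda>x. ip (X x) (psi j)" and ?\<xi> = "\<lambda>x. ip (X x) b + \<sigma> * e x"
  have \<xi>4: "integrable M (\<lambda>x. ?\<xi> x ^ 4)"
    using noise_moment[OF b \<rho>] by (intro integrableI_nonneg) (auto simp: le_less_trans)
  have "ennreal (\<integral>x. ?\<xi> x ^ 4 \<partial>M) \<le> ennreal (noise_bound \<rho>)"
    using noise_moment[OF b \<rho>] nn_integral_eq_integral[OF \<xi>4] by simp
  then have \<xi>4_le: "(\<integral>x. ?\<xi> x ^ 4 \<partial>M) \<le> noise_bound \<rho>" using noise_bound_nonneg by simp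
  define D where "D x = ?x x ^ 4 / (2 * lam j) + lam j * ?\<xi> x ^ 4 / 2" for x
  have D: "integrable M D" unfolding D_def using coef_moment(1)[OF j] \<xi>4 by simp
  have "(\<integral>x. D x \<partial>M) = (\<integral>x. ?x x ^ 4 \<partial>M) / (2 * lam j) + lam j * (\<integral>x. ?\<xi> x ^ 4 \<partial>M) / 2"
    unfolding D_def using coef_moment(1)[OF j] \<xi>4 by simp
  also have "\<dots> \<le> H * (lam j)\<^sup>2 / (2 * lam j) + lam j * noise_bound \<rho> / 2"
    using coef_moment(2)[OF j] \<xi>4_le l by (intro add_mono divide_right_mono mult_left_mono) auto
  also have "\<dots> = lam j * (H + noise_bound \<rho>) / 2" using l by (simp add: field_simps power2_eq_square)
  finally have D_le: "(\<integral>x. D x \<partial>M) \<le> lam j * (H + noise_bound \<rho>) / 2" .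
  have sq_le: "(?x x * ?\<xi> x)\<^sup>2 \<le> D x" for x
  proof -
    have "0 \<le> ((?x x)\<^sup>2 - lam j * (?\<xi> x)\<^sup>2)\<^sup>2" by simp
    then have "2 * lam j * (?x x * ?\<xi> x)\<^sup>2 \<le> ?x x ^ 4 + (lam j)\<^sup>2 * ?\<xi> x ^ 4"
      by (simp add: power2_diff power_mult_distrib power_mult[symmetric] mult_ac)
    then have "(?x x * ?\<xi> x)\<^sup>2 \<le> (?x x ^ 4 + (lam j)\<^sup>2 * ?\<xi> x ^ 4) / (2 * lam j)"
      using l by (simp add: pos_le_divide_eq mult_ac)
    also have "\<dots> = D x" unfolding D_def using l by (simp add: add_divide_distrib power2_eq_square)
    finally show ?thesis .
  qed
  have sq_int: "integrable M (\<lambda>x. (?x x * ?\<xi> x)\<^sup>2)"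
  proof (rule Bochner_Integration.integrable_bound[OF D])
    show "AE x in M. norm ((?x x * ?\<xi> x)\<^sup>2) \<le> norm (D x)"
      using sq_le order_trans[OF zero_le_power2 sq_le] by (intro AE_I2) simp
  qed measurable
  have int_xb: "integrable M (\<lambda>x. ?x x * ip (X x) b)" by (rule integrable_ip_X_mult[OF psi_L2 b])
  have int_xe: "integrable M (\<lambda>x. e x * ?x x)"
    by (intro integrable_mult_sq e_sq_integrable integrable_ip_X_sq psi_L2) measurable
  have "(\<integral>x. ?x x * ?\<xi> x \<partial>M) = (\<integral>x. ?x x * ip (X x) b + \<sigma> * (e x * ?x x) \<partial>M)"
    by (simp add: algebra_simps)
  also have "\<dots> = (\<integral>x. ?x x * ip (X x) b \<partial>M) + \<sigma> * (\<integral>x. e x * ?x x \<partial>M)"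
    using int_xb int_xe by simp
  also have "\<dots> = 0"
    using cross_moment_psi[OF j b] ortho uncorr psi_L2 by (simp add: ip_commute[of "psi j"] uncorrelated_def)
  finally have mean: "(\<integral>x. ?x x * ?\<xi> x \<partial>M) = 0" .
  have "(\<integral>\<^sup>+w. ennreal ((\<Sum>i\<in>{1..n}. ?F (es i w, Xs i w))\<^sup>2) \<partial>N)
    \<le> ennreal (real (card {1..n}) * (lam j * (H + noise_bound \<rho>) / 2))"
  proof (rule N.second_moment_sum_indep[OF _ sample_indep[OF F]])
    fix i assume "i \<in> {1..n}"
    then have i: "1 \<le> i" by simp
    show "integrable N (\<lambda>w. (?F (es i w, Xs i w))\<^sup>2)"
      using sample_integral(2)[OF i F2] sq_int by simp
    show "(\<integral>w. ?F (es i w, Xs i w) \<partial>N) = 0" using sample_integral(1)[OF i F] mean by simp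
    have "(\<integral>w. (?F (es i w, Xs i w))\<^sup>2 \<partial>N) = (\<integral>x. (?x x * ?\<xi> x)\<^sup>2 \<partial>M)"
      using sample_integral(1)[OF i F2] by simp
    also have "\<dots> \<le> (\<integral>x. D x \<partial>M)" using sq_int D sq_le by (intro integral_mono)
    finally show "(\<integral>w. (?F (es i w, Xs i w))\<^sup>2 \<partial>N) \<le> lam j * (H + noise_bound \<rho>) / 2"
      using D_le by simp
  qed simp
  then show ?thesis by simp
qed

lemma noise_sum_moment:
  assumes b: "b \<in> L2" and \<rho>: "ip b b \<le> \<rho>"
  shows "(\<integral>\<^sup>+w. ennreal (\<Sum>i=1..n. (ip (Xs i w) b + \<sigma> * es i w) ^ 4) \<partial>N) \<le> ennreal (real n * noise_bound \<rho>)"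
proof -
  have [measurable]: "(\<lambda>g. ip g b) \<in> borel_measurable L2_space"
    by (rule measurable_ip_L2_space[OF b])
  have F: "(\<lambda>p. ennreal ((ip (snd p) b + \<sigma> * fst p) ^ 4)) \<in> borel_measurable (borel \<Otimes>\<^sub>M L2_space)"
    by measurable
  have meas: "(\<lambda>w. ennreal ((ip (Xs i w) b + \<sigma> * es i w) ^ 4)) \<in> borel_measurable N" if "1 \<le> i" for i
    using measurable_compose[OF sample_measurable[OF that] F] by simp
  have "(\<integral>\<^sup>+w. ennreal (\<Sum>i=1..n. (ip (Xs i w) b + \<sigma> * es i w) ^ 4) \<partial>N)
      = (\<integral>\<^sup>+w. (\<Sum>i=1..n. ennreal ((ip (Xs i w) b + \<sigma> * es i w) ^ 4)) \<partial>N)"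
    by (simp add: sum_ennreal)
  also have "\<dots> = (\<Sum>i=1..n. \<integral>\<^sup>+w. ennreal ((ip (Xs i w) b + \<sigma> * es i w) ^ 4) \<partial>N)"
    using meas by (intro nn_integral_sum) auto
  also have "\<dots> = (\<Sum>i=1..n. \<integral>\<^sup>+x. ennreal ((ip (X x) b + \<sigma> * e x) ^ 4) \<partial>M)"
    using sample_nn_integral[OF _ F] by (intro sum.cong) auto
  also have "\<dots> \<le> (\<Sum>i=1..n. ennreal (noise_bound \<rho>))"
    by (intro sum_mono noise_moment b \<rho>)
  also have "\<dots> = ennreal (real n * noise_bound \<rho>)"
    using noise_bound_nonneg by (simp add: ennreal_of_nat_eq_real_of_nat ennreal_mult)
  finally show ?thesis .
qed

end

section \<open>The risk at a fixed sample size\<close>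

context functional_linear_sample
begin

definition coef_hat :: "nat \<Rightarrow> real \<Rightarrow> (real \<Rightarrow> real) \<Rightarrow> nat \<Rightarrow> 'b \<Rightarrow> real" where
  "coef_hat n \<alpha> \<beta> j w =
    g_hat n (\<lambda>i. response \<beta> \<sigma> Xs es i w) (\<lambda>i. Xs i w) j / lambda_hat n (\<lambda>i. Xs i w) j *
      (if lambda_hat n (\<lambda>i. Xs i w) j \<ge> \<alpha> then 1 else 0)"

text \<open>The typical squared error is the variance of the numerator over the squared eigenvalue and gives,
  after multiplication with the eigenvalue, a term of order \<open>1 / n\<close> that does not depend on the
  eigenvalue. This is why small eigenvalues do not inflate the variance part of the prediction risk.\<close>

lemma coef_risk:
  assumes j: "1 \<le> j" and n: "1 \<le> n" and \<alpha>: "0 < \<alpha>" and \<beta>: "\<beta> \<in> L2" and \<rho>: "ip \<beta> \<beta> \<le> \<rho>"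
  shows "(\<integral>\<^sup>+w. ennreal (lam j * (coef_hat n \<alpha> \<beta> j w - ip \<beta> (psi j))\<^sup>2) \<partial>N)
    \<le> ennreal (2 * (H + noise_bound \<rho>) / real n + lam j * noise_bound \<rho> / (2 * \<alpha> * (real n)\<^sup>2)
        + (lam j * (real n)\<^sup>2 / (2 * \<alpha>) + lam j * (ip \<beta> (psi j))\<^sup>2) * exp (- real n / (8 * H))
        + 2 * \<alpha> * (ip \<beta> (psi j))\<^sup>2)"
proof -
  define \<beta>j where "\<beta>j = ip \<beta> (psi j)"
  define b where "b t = \<beta> t - \<beta>j * psi j t" for t
  have b: "b \<in> L2" unfolding b_def[abs_def] by (intro L2_diff L2_scale \<beta> psi_L2)
  have ip_b: "ip g b = ip g \<beta> - \<beta>j * ip g (psi j)" if "g \<in> L2" for g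
    unfolding b_def[abs_def] using that \<beta> psi_L2 by (simp add: ip_diff_right L2_scale ip_scale_right)
  have ortho: "ip b (psi j) = 0"
    using ip_b[OF psi_L2[of j]] j by (simp add: ip_commute[of b] ip_commute[of "psi j" \<beta>] ip_psi \<beta>j_def)
  have "ip b b = ip \<beta> \<beta> - \<beta>j\<^sup>2"
    using ip_b[OF b] ip_b[OF \<beta>] ortho by (simp add: ip_commute[of b \<beta>] \<beta>j_def power2_eq_square)
  then have b\<rho>: "ip b b \<le> \<rho>" using \<rho> zero_le_power2[of \<beta>j] by linarith
  have l: "0 < lam j" using j by (rule lam_pos)
  have n0: "0 < real n" using n by simp
  define x where "x i w = ip (Xs i w) (psi j)" for i w
  define \<xi> where "\<xi> i w = ip (Xs i w) b + \<sigma> * es i w" for i w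
  define L where "L w = lambda_hat n (\<lambda>i. Xs i w) j" for w
  define S1 S4 where "S1 w = (\<Sum>i=1..n. x i w * \<xi> i w)" and "S4 w = (\<Sum>i=1..n. \<xi> i w ^ 4)" for w
  define E where "E = {w \<in> space N. L w < lam j / 2}"
  have xm: "x i \<in> borel_measurable N" and \<xi>m: "\<xi> i \<in> borel_measurable N" if "i \<in> {1..n}" for i
    using that sample_ip_measurable[OF _ psi_L2, of i] sample_ip_measurable[OF _ b, of i] sample_error_measurable[of i]
    by (auto simp: x_def[abs_def] \<xi>_def[abs_def])
  have S1m [measurable]: "S1 \<in> borel_measurable N" unfolding S1_def[abs_def]
    using xm \<xi>m by (intro borel_measurable_sum borel_measurable_times)
  have S4m [measurable]: "S4 \<in> borel_measurable N" unfolding S4_def[abs_def]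
    using \<xi>m by (intro borel_measurable_sum borel_measurable_power)
  have [measurable]: "L \<in> borel_measurable N" unfolding L_def[abs_def] by (rule lambda_hat_measurable)
  have Em [measurable]: "E \<in> sets N" unfolding E_def by measurable
  define c1 c2 c3 c4 where "c1 = 4 / (lam j * (real n)\<^sup>2)" and "c2 = lam j / (2 * \<alpha> * (real n) ^ 3)"
    and "c3 = lam j * (real n)\<^sup>2 / (2 * \<alpha>) + lam j * \<beta>j\<^sup>2" and "c4 = 2 * \<alpha> * \<beta>j\<^sup>2"
  have c: "0 \<le> c1" "0 \<le> c2" "0 \<le> c3" "0 \<le> c4"
    using l \<alpha> by (auto simp: c1_def c2_def c3_def c4_def)
  have S4_nonneg: "0 \<le> S4 w" for w unfolding S4_def by (simp add: sum_nonneg)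
  have pointwise: "lam j * (coef_hat n \<alpha> \<beta> j w - \<beta>j)\<^sup>2 \<le> c1 * (S1 w)\<^sup>2 + c2 * S4 w + c3 * indicator E w + c4"
    if w: "w \<in> space N" for w
  proof -
    define W Q where "W = S1 w / real n" and "Q = (\<Sum>i=1..n. (\<xi> i w)\<^sup>2) / real n"
    have Lw: "L w = (\<Sum>i=1..n. (x i w)\<^sup>2) / real n" by (simp add: L_def lambda_hat_def x_def)
    have Q0: "0 \<le> Q" unfolding Q_def by (simp add: sum_nonneg)
    have "(S1 w)\<^sup>2 \<le> (\<Sum>i=1..n. (x i w)\<^sup>2) * (\<Sum>i=1..n. (\<xi> i w)\<^sup>2)"
      unfolding S1_def by (rule Cauchy_Schwarz_ineq_sum)
    \<comment> \<open>this bound lets the threshold divide only once, not twice\<close>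
    then have WQ: "W\<^sup>2 \<le> L w * Q"
      unfolding W_def Q_def Lw using n0 by (simp add: power_divide divide_right_mono power2_eq_square)
    have resp: "response \<beta> \<sigma> Xs es i w * ip (Xs i w) (psi j) = \<beta>j * (x i w)\<^sup>2 + x i w * \<xi> i w" if "i \<in> {1..n}" for i
    proof -
      have "ip (Xs i w) b = ip \<beta> (Xs i w) - \<beta>j * x i w"
        using ip_b[OF Xs_L2[OF _ w, of i]] that by (simp add: x_def ip_commute[of "Xs i w" \<beta>])
      then have "response \<beta> \<sigma> Xs es i w = \<beta>j * x i w + \<xi> i w" by (simp add: response_def \<xi>_def)
      then show ?thesis by (simp add: x_def algebra_simps power2_eq_square)
    qed
    have g: "g_hat n (\<lambda>i. response \<beta> \<sigma> Xs es i w) (\<lambda>i. Xs i w) j = \<beta>j * L w + W"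
      unfolding g_hat_def Lw W_def S1_def
      by (simp add: resp sum.distrib sum_distrib_left[symmetric] add_divide_distrib)
    have "(\<Sum>i=1..n. (\<xi> i w)\<^sup>2 * 1)\<^sup>2 \<le> (\<Sum>i=1..n. ((\<xi> i w)\<^sup>2)\<^sup>2) * (\<Sum>i=1..n. 1\<^sup>2)"
      by (rule Cauchy_Schwarz_ineq_sum)
    then have "(\<Sum>i=1..n. (\<xi> i w)\<^sup>2)\<^sup>2 \<le> S4 w * real n"
      by (simp add: S4_def power_mult[symmetric])
    then have "Q\<^sup>2 \<le> S4 w * real n / (real n)\<^sup>2"
      unfolding Q_def power_divide by (intro divide_right_mono) auto
    also have "\<dots> = S4 w / real n" using n0 by (simp add: power2_eq_square)
    finally have Q2: "Q\<^sup>2 \<le> S4 w / real n" .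
    \<comment> \<open>The arithmetic-geometric mean inequality with weight \<open>n\<^sup>2\<close> separates \<open>Q\<close> from the indicator
      of \<open>E\<close>: the fourth moments then carry a factor \<open>1 / n\<^sup>2\<close>, while the factor \<open>n\<^sup>2\<close> goes to the
      indicator, whose expectation is exponentially small.\<close>
    have "Q * (real n)\<^sup>2 \<le> Q\<^sup>2 / 2 + ((real n)\<^sup>2)\<^sup>2 / 2"
      using sum_squares_bound[of Q "(real n)\<^sup>2"] by simp
    also have "\<dots> \<le> S4 w / real n / 2 + ((real n)\<^sup>2)\<^sup>2 / 2"
      by (rule add_right_mono[OF divide_right_mono[OF Q2]]) simp
    finally have "Q * (real n)\<^sup>2 \<le> S4 w / real n / 2 + ((real n)\<^sup>2)\<^sup>2 / 2" .
    then have "Q \<le> (S4 w / real n / 2 + ((real n)\<^sup>2)\<^sup>2 / 2) / (real n)\<^sup>2"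
      using n0 by (simp add: pos_le_divide_eq)
    also have "\<dots> = S4 w / (2 * real n ^ 3) + (real n)\<^sup>2 / 2"
      using n0 by (simp add: add_divide_distrib power2_eq_square power3_eq_cube)
    finally have Q_le: "Q \<le> S4 w / (2 * real n ^ 3) + (real n)\<^sup>2 / 2" .
    have "lam j * (coef_hat n \<alpha> \<beta> j w - \<beta>j)\<^sup>2
      \<le> 4 * W\<^sup>2 / lam j + (lam j / \<alpha> * Q + lam j * \<beta>j\<^sup>2) * (if L w < lam j / 2 then 1 else 0) + 2 * \<alpha> * \<beta>j\<^sup>2"
      unfolding coef_hat_def L_def[symmetric] by (rule coefficient_error_le[OF l \<alpha> WQ Q0 g])
    also have "4 * W\<^sup>2 / lam j = c1 * (S1 w)\<^sup>2"
      by (simp add: W_def c1_def power_divide)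
    also have "(lam j / \<alpha> * Q + lam j * \<beta>j\<^sup>2) * (if L w < lam j / 2 then 1 else 0) \<le> c2 * S4 w + c3 * indicator E w"
    proof (cases "w \<in> E")
      case True
      have "lam j / \<alpha> * Q \<le> lam j / \<alpha> * (S4 w / (2 * real n ^ 3) + (real n)\<^sup>2 / 2)"
        using Q_le l \<alpha> by (intro mult_left_mono) auto
      also have "\<dots> = c2 * S4 w + lam j * (real n)\<^sup>2 / (2 * \<alpha>)"
        by (simp add: c2_def distrib_left)
      finally show ?thesis using True by (simp add: E_def c3_def)
    next
      case False
      then show ?thesis using w c S4_nonneg[of w] by (simp add: E_def)
    qed
    finally show ?thesis by (simp add: c4_def)
  qed
  have "(\<integral>\<^sup>+w. ennreal (lam j * (coef_hat n \<alpha> \<beta> j w - \<beta>j)\<^sup>2) \<partial>N)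
      \<le> (\<integral>\<^sup>+w. ennreal c1 * ennreal ((S1 w)\<^sup>2) + ennreal c2 * ennreal (S4 w) + ennreal c3 * indicator E w + ennreal c4 \<partial>N)"
  proof (rule nn_integral_mono)
    fix w assume w: "w \<in> space N"
    have "ennreal (lam j * (coef_hat n \<alpha> \<beta> j w - \<beta>j)\<^sup>2)
        \<le> ennreal (c1 * (S1 w)\<^sup>2 + c2 * S4 w + c3 * indicator E w + c4)"
      by (rule ennreal_leI[OF pointwise[OF w]])
    also have "\<dots> = ennreal c1 * ennreal ((S1 w)\<^sup>2) + ennreal c2 * ennreal (S4 w) + ennreal c3 * indicator E w + ennreal c4"
      using c S4_nonneg[of w] by (simp add: ennreal_mult ennreal_indicator[symmetric] split: split_indicator)
    finally show "ennreal (lam j * (coef_hat n \<alpha> \<beta> j w - \<beta>j)\<^sup>2)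
      \<le> ennreal c1 * ennreal ((S1 w)\<^sup>2) + ennreal c2 * ennreal (S4 w) + ennreal c3 * indicator E w + ennreal c4" .
  qed
  also have "\<dots> = ennreal c1 * (\<integral>\<^sup>+w. ennreal ((S1 w)\<^sup>2) \<partial>N) + ennreal c2 * (\<integral>\<^sup>+w. ennreal (S4 w) \<partial>N)
      + ennreal c3 * emeasure N E + ennreal c4"
    by (simp add: nn_integral_add nn_integral_cmult N.emeasure_space_1)
  also have "\<dots> \<le> ennreal c1 * ennreal (real n * (lam j * (H + noise_bound \<rho>) / 2))
      + ennreal c2 * ennreal (real n * noise_bound \<rho>) + ennreal c3 * ennreal (exp (- real n / (8 * H))) + ennreal c4"
    using score_second_moment[OF j b ortho b\<rho>, of n] noise_sum_moment[OF b b\<rho>, of n] lambda_hat_tail[OF j n]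
    unfolding S1_def S4_def E_def L_def x_def \<xi>_def
    by (intro add_mono mult_left_mono order_refl) auto
  also have "\<dots> = ennreal (c1 * (real n * (lam j * (H + noise_bound \<rho>) / 2)) + c2 * (real n * noise_bound \<rho>)
      + c3 * exp (- real n / (8 * H)) + c4)"
  proof -
    have "ennreal a * ennreal x + ennreal b * ennreal y + ennreal c * ennreal z + ennreal d
        = ennreal (a * x + b * y + c * z + d)"
      if "0 \<le> a" "0 \<le> b" "0 \<le> c" "0 \<le> d" "0 \<le> x" "0 \<le> y" "0 \<le> z" for a b c d x y z
      using that by (simp add: ennreal_mult)
    then show ?thesis using c l H_ge_1 noise_bound_nonneg by simp
  qed
  also have "c1 * (real n * (lam j * (H + noise_bound \<rho>) / 2)) = 2 * (H + noise_bound \<rho>) / real n"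
    using l n0 by (simp add: c1_def power2_eq_square field_simps)
  also have "c2 * (real n * noise_bound \<rho>) = lam j * noise_bound \<rho> / (2 * \<alpha> * (real n)\<^sup>2)"
    using n0 by (simp add: c2_def power2_eq_square power3_eq_cube)
  finally show ?thesis unfolding c3_def c4_def \<beta>j_def .
qed

lemma prediction_risk_eq:
  assumes \<beta>: "\<beta> \<in> L2"
  shows "prediction_risk M X N es Xs \<sigma> n m \<alpha> \<beta> =
    (\<integral>\<^sup>+w. ennreal ((\<Sum>l<m. lam (Suc l) * (coef_hat n \<alpha> \<beta> (Suc l) w - ip \<beta> (psi (Suc l)))\<^sup>2)
      + (\<Sum>l. lam (Suc (l + m)) * (ip \<beta> (psi (Suc (l + m))))\<^sup>2)) \<partial>N)"
    and "summable (\<lambda>l. lam (Suc (l + m)) * (ip \<beta> (psi (Suc (l + m))))\<^sup>2)"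
proof -
  let ?\<Delta> = "\<lambda>w t. beta_hat n m \<alpha> (\<lambda>i. response \<beta> \<sigma> Xs es i w) (\<lambda>i. Xs i w) t - \<beta> t"
  have hat: "beta_hat n m \<alpha> (\<lambda>i. response \<beta> \<sigma> Xs es i w) (\<lambda>i. Xs i w)
      = (\<lambda>t. \<Sum>l<m. coef_hat n \<alpha> \<beta> (Suc l) w * psi (Suc l) t)" for w
    unfolding beta_hat_def[abs_def] coef_hat_def One_nat_def sum.atLeast1_atMost_eq[unfolded One_nat_def] ..
  have \<Delta>: "?\<Delta> w \<in> L2" for w unfolding hat by (intro L2_diff psi_comb_L2 \<beta>)
  have coef: "ip (?\<Delta> w) (psi (Suc l)) =
      (if l < m then coef_hat n \<alpha> \<beta> (Suc l) w else 0) - ip \<beta> (psi (Suc l))" for w l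
    unfolding hat by (subst ip_diff_left[OF psi_comb_L2 \<beta> psi_L2]) (simp add: ip_psi_comb)
  show summ: "summable (\<lambda>l. lam (Suc (l + m)) * (ip \<beta> (psi (Suc (l + m))))\<^sup>2)"
    using summable_ignore_initial_segment[OF sums_summable[OF cov_op_quadratic_form[OF \<beta>]], of m] by simp
  have "ip (cov_op M X (?\<Delta> w)) (?\<Delta> w) =
      (\<Sum>l<m. lam (Suc l) * (coef_hat n \<alpha> \<beta> (Suc l) w - ip \<beta> (psi (Suc l)))\<^sup>2)
      + (\<Sum>l. lam (Suc (l + m)) * (ip \<beta> (psi (Suc (l + m))))\<^sup>2)" for w
  proof -
    note q = cov_op_quadratic_form[OF \<Delta>[of w]]
    have "ip (cov_op M X (?\<Delta> w)) (?\<Delta> w) = (\<Sum>l. lam (Suc l) * (ip (?\<Delta> w) (psi (Suc l)))\<^sup>2)"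
      by (rule sums_unique[OF q])
    also have "\<dots> = (\<Sum>l. lam (Suc (l + m)) * (ip (?\<Delta> w) (psi (Suc (l + m))))\<^sup>2)
        + (\<Sum>l<m. lam (Suc l) * (ip (?\<Delta> w) (psi (Suc l)))\<^sup>2)"
      by (rule suminf_split_initial_segment[OF sums_summable[OF q]])
    finally show ?thesis unfolding coef by simp
  qed
  then show "prediction_risk M X N es Xs \<sigma> n m \<alpha> \<beta> =
    (\<integral>\<^sup>+w. ennreal ((\<Sum>l<m. lam (Suc l) * (coef_hat n \<alpha> \<beta> (Suc l) w - ip \<beta> (psi (Suc l)))\<^sup>2)
      + (\<Sum>l. lam (Suc (l + m)) * (ip \<beta> (psi (Suc (l + m))))\<^sup>2)) \<partial>N)"
    unfolding prediction_risk_def Let_def by simp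
qed

lemma coef_hat_measurable:
  assumes "1 \<le> j" "\<beta> \<in> L2"
  shows "coef_hat n \<alpha> \<beta> j \<in> borel_measurable N"
proof -
  have [measurable]: "(\<lambda>w. lambda_hat n (\<lambda>i. Xs i w) j) \<in> borel_measurable N" by (rule lambda_hat_measurable)
  have "(\<lambda>w. response \<beta> \<sigma> Xs es i w * ip (Xs i w) (psi j)) \<in> borel_measurable N" if "i \<in> {1..n}" for i
    using that sample_ip_measurable[OF _ psi_L2, of i] sample_ip_measurable[OF _ assms(2), of i] sample_error_measurable[of i]
    by (auto simp: response_def[abs_def] ip_commute[of \<beta>])
  then have [measurable]: "(\<lambda>w. g_hat n (\<lambda>i. response \<beta> \<sigma> Xs es i w) (\<lambda>i. Xs i w) j) \<in> borel_measurable N"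
    unfolding g_hat_def by (rule borel_measurable_times[OF borel_measurable_const borel_measurable_sum])
  show ?thesis unfolding coef_hat_def[abs_def] by measurable
qed

lemma tail_bias_le:
  assumes \<beta>: "\<beta> \<in> sobolev_ellipsoid p \<rho>" and \<rho>: "0 \<le> \<rho>" and s: "0 \<le> s"
    and lam_s: "\<And>j. m < j \<Longrightarrow> lam j \<le> s * sobolev_weight p j"
  shows "(\<Sum>l. lam (Suc (l + m)) * (ip \<beta> (psi (Suc (l + m))))\<^sup>2) \<le> \<rho> * s"
proof -
  note S = sobolev_ellipsoid_sums[OF \<beta> \<rho>]
  let ?f = "\<lambda>l. sobolev_weight p (Suc l) * (ip \<beta> (psi (Suc l)))\<^sup>2"
  have f0: "0 \<le> ?f l" for l by (simp add: sobolev_weight_def)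
  have sm: "summable (\<lambda>l. ?f (l + m))" by (rule summable_ignore_initial_segment[OF S(2)])
  have "(\<Sum>l. lam (Suc (l + m)) * (ip \<beta> (psi (Suc (l + m))))\<^sup>2) \<le> (\<Sum>l. s * ?f (l + m))"
  proof (rule suminf_le)
    fix l
    show "lam (Suc (l + m)) * (ip \<beta> (psi (Suc (l + m))))\<^sup>2 \<le> s * ?f (l + m)"
      using mult_right_mono[OF lam_s[of "Suc (l + m)"], of "(ip \<beta> (psi (Suc (l + m))))\<^sup>2"] by (simp add: mult.assoc)
  qed (use prediction_risk_eq(2)[OF S(1)] sm in auto)
  also have "\<dots> = s * (\<Sum>l. ?f (l + m))" using sm by (rule suminf_mult)
  also have "\<dots> \<le> s * \<rho>"
  proof (rule mult_left_mono[OF _ s])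
    have "(\<Sum>l. ?f (l + m)) \<le> suminf ?f"
      using suminf_split_initial_segment[OF S(2), of m] sum_nonneg[of "{..<m}" ?f] f0 by simp
    then show "(\<Sum>l. ?f (l + m)) \<le> \<rho>" using S(3) by simp
  qed
  finally show ?thesis by (simp add: mult.commute)
qed

text \<open>Summing the coefficient risks: each of the \<open>m\<close> variance terms is of order \<open>1 / n\<close>, and all
  others are summable, since the eigenvalues and the squared coefficients of the slope are. The
  omitted coefficients contribute a bias that the ellipsoid condition controls through the largest
  ratio of eigenvalue and weight beyond \<open>m\<close>.\<close>

lemma risk_bound:
  assumes p: "0 \<le> p" and \<rho>: "0 \<le> \<rho>" and c: "0 < c"  and C: "0 \<le> C"
  shows "\<exists>R>0. \<forall>n m \<alpha> s \<beta>. 1 \<le> n \<longrightarrow> 1 \<le> m \<longrightarrow> c / real n \<le> \<alpha> \<longrightarrow> \<alpha> \<le> C / real n \<longrightarrow> 0 \<le> s \<longrightarrow>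
    (\<forall>j>m. lam j \<le> s * sobolev_weight p j) \<longrightarrow> \<beta> \<in> sobolev_ellipsoid p \<rho> \<longrightarrow>
    prediction_risk M X N es Xs \<sigma> n m \<alpha> \<beta> \<le> ennreal (R * (real m / real n) + \<rho> * s)"
proof -
  define K V D where "K = noise_bound \<rho>" and "V = total_variance" and "D = 256 * (8 * H) ^ 4"
  have KVD: "0 \<le> K" "0 \<le> V" "0 \<le> D"
    using noise_bound_nonneg total_variance_nonneg H_ge_1 by (auto simp: K_def V_def D_def)
  define R where "R = 2 * (H + K) + V * (K + D) / (2 * c) + V * \<rho> * D + 2 * C * \<rho>"
  have R: "0 < R" unfolding R_def using KVD H_ge_1 c C \<rho> by (intro add_pos_nonneg) auto
  show ?thesis
  proof (intro exI[of _ R] conjI allI impI R)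
    fix n m :: nat and \<alpha> s :: real and \<beta> :: "real \<Rightarrow> real"
    assume n: "1 \<le> n" and m: "1 \<le> m" and \<alpha>: "c / real n \<le> \<alpha>" "\<alpha> \<le> C / real n" and s: "0 \<le> s"
      and lam_s: "\<forall>j>m. lam j \<le> s * sobolev_weight p j" and \<beta>: "\<beta> \<in> sobolev_ellipsoid p \<rho>"
    have n0: "0 < real n" using n by simp
    have \<alpha>0: "0 < \<alpha>" using \<alpha>(1) c n0 by (meson divide_pos_pos less_le_trans)
    have \<beta>L: "\<beta> \<in> L2" using \<beta> by (simp add: sobolev_ellipsoid_def)
    have \<beta>\<rho>: "ip \<beta> \<beta> \<le> \<rho>" by (rule sobolev_ellipsoid_norm_le[OF \<beta> \<rho> p])
    let ?b = "\<lambda>l. (ip \<beta> (psi (Suc l)))\<^sup>2"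
    let ?t = "\<lambda>l w. lam (Suc l) * (coef_hat n \<alpha> \<beta> (Suc l) w - ip \<beta> (psi (Suc l)))\<^sup>2"
    let ?T = "\<Sum>l. lam (Suc (l + m)) * ?b (l + m)"
    have t0: "0 \<le> ?t l w" for l w using lam_pos[of "Suc l"] by simp
    have T0: "0 \<le> ?T"
      using prediction_risk_eq(2)[OF \<beta>L, of m] lam_pos by (intro suminf_nonneg) (auto simp: less_imp_le)
    have T: "?T \<le> \<rho> * s" using tail_bias_le[OF \<beta> \<rho> s] lam_s by simp
    have tail: "exp (- real n / (8 * H)) \<le> D / real n ^ 4"
      using exp_minus_le_inverse_power4[of "real n / (8 * H)"] H_ge_1 n0
      by (simp add: D_def power_divide)
    have tail1: "exp (- real n / (8 * H)) \<le> D / real n"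
    proof -
      have "real n * 1 \<le> real n * real n ^ 3" using n by (intro mult_left_mono) auto
      then have "real n \<le> real n ^ 4" by (simp add: power_numeral_reduce)
      then have "D / real n ^ 4 \<le> D / real n" using KVD n0 by (intro divide_left_mono) auto
      then show ?thesis using tail by simp
    qed
    have inv: "1 / \<alpha> \<le> real n / c"
      using \<alpha>(1) \<alpha>0 c n0 by (simp add: divide_simps mult_ac)
    have coef_le: "(\<integral>\<^sup>+w. ennreal (?t l w) \<partial>N)
      \<le> ennreal ((2 * (H + K) + lam (Suc l) * (K + D) / (2 * c) + V * D * ?b l + 2 * C * ?b l) / real n)" for l
    proof -
      have l0: "0 < lam (Suc l)" "lam (Suc l) \<le> V" using lam_pos lam_le by (auto simp: V_def)
      have "lam (Suc l) * K / (2 * \<alpha> * (real n)\<^sup>2) = lam (Suc l) * K / (2 * (real n)\<^sup>2) * (1 / \<alpha>)" by simp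
      also have "\<dots> \<le> lam (Suc l) * K / (2 * (real n)\<^sup>2) * (real n / c)"
        using inv l0 KVD by (intro mult_left_mono) auto
      also have "\<dots> = lam (Suc l) * K / (2 * c) / real n" using n0 by (simp add: power2_eq_square)
      finally have 2: "lam (Suc l) * K / (2 * \<alpha> * (real n)\<^sup>2) \<le> lam (Suc l) * K / (2 * c) / real n" .
      have "lam (Suc l) * (real n)\<^sup>2 / (2 * \<alpha>) * exp (- real n / (8 * H))
          = lam (Suc l) * (real n)\<^sup>2 / 2 * ((1 / \<alpha>) * exp (- real n / (8 * H)))" by simp
      also have "\<dots> \<le> lam (Suc l) * (real n)\<^sup>2 / 2 * ((real n / c) * (D / real n ^ 4))"
        using inv l0 \<alpha>0 c tail by (intro mult_left_mono mult_mono) auto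
      also have "\<dots> = lam (Suc l) * D / (2 * c) / real n"
        using n0 by (simp add: power2_eq_square power_numeral_reduce)
      finally have 3: "lam (Suc l) * (real n)\<^sup>2 / (2 * \<alpha>) * exp (- real n / (8 * H)) \<le> lam (Suc l) * D / (2 * c) / real n" .
      have "lam (Suc l) * ?b l * exp (- real n / (8 * H)) \<le> V * ?b l * (D / real n)"
        using l0 KVD tail1 by (intro mult_mono) auto
      then have 4: "lam (Suc l) * ?b l * exp (- real n / (8 * H)) \<le> V * D * ?b l / real n"
        by (simp add: mult_ac)
      have "2 * \<alpha> * ?b l \<le> 2 * (C / real n) * ?b l" using \<alpha>(2) by (intro mult_right_mono mult_left_mono) auto
      then have 5: "2 * \<alpha> * ?b l \<le> 2 * C * ?b l / real n" by simp
      have "2 * (H + K) / real n + lam (Suc l) * K / (2 * \<alpha> * (real n)\<^sup>2)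
          + (lam (Suc l) * (real n)\<^sup>2 / (2 * \<alpha>) + lam (Suc l) * ?b l) * exp (- real n / (8 * H)) + 2 * \<alpha> * ?b l
        \<le> (2 * (H + K) + lam (Suc l) * (K + D) / (2 * c) + V * D * ?b l + 2 * C * ?b l) / real n"
        using 2 3 4 5 by (simp only: distrib_right distrib_left add_divide_distrib)
      then show ?thesis
        using coef_risk[of "Suc l", OF _ n \<alpha>0 \<beta>L \<beta>\<rho>] unfolding K_def[symmetric]
        by (auto intro: order_trans ennreal_leI)
    qed
    have "prediction_risk M X N es Xs \<sigma> n m \<alpha> \<beta> = (\<integral>\<^sup>+w. (\<Sum>l<m. ennreal (?t l w)) + ennreal ?T \<partial>N)"
      unfolding prediction_risk_eq(1)[OF \<beta>L] using t0 T0 by (simp add: sum_nonneg sum_ennreal)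
    also have "\<dots> = (\<Sum>l<m. \<integral>\<^sup>+w. ennreal (?t l w) \<partial>N) + ennreal ?T"
    proof -
      have [measurable]: "coef_hat n \<alpha> \<beta> (Suc l) \<in> borel_measurable N" for l
        by (rule coef_hat_measurable[OF _ \<beta>L]) simp
      show ?thesis by (simp add: nn_integral_add nn_integral_sum N.emeasure_space_1)
    qed
    also have "\<dots> \<le> (\<Sum>l<m. ennreal ((2 * (H + K) + lam (Suc l) * (K + D) / (2 * c) + V * D * ?b l + 2 * C * ?b l) / real n))
        + ennreal (\<rho> * s)"
      using coef_le T by (intro add_mono sum_mono ennreal_leI)
    also have "\<dots> = ennreal ((\<Sum>l<m. (2 * (H + K) + lam (Suc l) * (K + D) / (2 * c) + V * D * ?b l + 2 * C * ?b l) / real n) + \<rho> * s)"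
    proof -
      have "0 \<le> (2 * (H + K) + lam (Suc l) * (K + D) / (2 * c) + V * D * ?b l + 2 * C * ?b l) / real n" for l
        using lam_pos[of "Suc l"] H_ge_1 KVD c C by (intro divide_nonneg_nonneg add_nonneg_nonneg mult_nonneg_nonneg) auto
      then show ?thesis using \<rho> s by (simp add: sum_nonneg sum_ennreal)
    qed
    also have "\<dots> \<le> ennreal (R * (real m / real n) + \<rho> * s)"
    proof (intro ennreal_leI add_right_mono)
      have b_le: "(\<Sum>l<m. ?b l) \<le> \<rho>" using bessel[OF \<beta>L, of m] \<beta>\<rho> by simp
      have lam_sum: "(\<Sum>l<m. lam (Suc l)) \<le> V" unfolding V_def by (rule sum_lam_le)
      have "(\<Sum>l<m. 2 * (H + K) + lam (Suc l) * (K + D) / (2 * c) + V * D * ?b l + 2 * C * ?b l)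
        = real m * (2 * (H + K)) + (\<Sum>l<m. lam (Suc l)) * ((K + D) / (2 * c)) + V * D * (\<Sum>l<m. ?b l) + 2 * C * (\<Sum>l<m. ?b l)"
        by (simp add: sum.distrib sum_distrib_left sum_distrib_right sum_divide_distrib)
      also have "\<dots> \<le> real m * (2 * (H + K)) + V * ((K + D) / (2 * c)) + V * D * \<rho> + 2 * C * \<rho>"
        using b_le lam_sum KVD c C by (intro add_mono mult_left_mono mult_right_mono order_refl) auto
      also have "\<dots> \<le> real m * (2 * (H + K)) + real m * (V * ((K + D) / (2 * c))) + real m * (V * D * \<rho>) + real m * (2 * C * \<rho>)"
      proof -
        have *: "x \<le> real m * x" if "0 \<le> x" for x using mult_right_mono[of 1 "real m" x] m that by simp
        show ?thesis using KVD c C \<rho> by (intro add_mono order_refl *) auto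
      qed
      also have "\<dots> = R * real m" by (simp add: R_def algebra_simps)
      finally show "(\<Sum>l<m. (2 * (H + K) + lam (Suc l) * (K + D) / (2 * c) + V * D * ?b l + 2 * C * ?b l) / real n)
          \<le> R * (real m / real n)"
        using n0 by (simp add: sum_divide_distrib[symmetric] divide_right_mono)
    qed
    finally show "prediction_risk M X N es Xs \<sigma> n m \<alpha> \<beta> \<le> ennreal (R * (real m / real n) + \<rho> * s)" .
  qed
qed

end

section \<open>Rates of convergence\<close>

lemma lesssim_realI:
  assumes "0 < C" "\<forall>\<^sub>F n in sequentially. a n \<le> C * b n"
  shows "lesssim (\<lambda>n. ennreal (a n)) (\<lambda>n. ennreal (b n))"
  unfolding lesssim_def
proof (intro exI[of _ C] conjI assms(1))
  show "\<forall>\<^sub>F n in sequentially. ennreal (a n) \<le> ennreal C * ennreal (b n)"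
    using assms(2)
  proof eventually_elim
    case (elim n)
    then have "ennreal (a n) \<le> ennreal (C * b n)" by (rule ennreal_leI)
    then show ?case using assms(1) by (simp add: ennreal_mult')
  qed
qed

lemma lesssim_realE:
  assumes "lesssim (\<lambda>n. ennreal (a n)) (\<lambda>n. ennreal (b n))"
    and nonneg: "\<forall>\<^sub>F n in sequentially. 0 \<le> b n"
  obtains C where "0 < C" "\<forall>\<^sub>F n in sequentially. a n \<le> C * b n"
proof -
  obtain C where C: "0 < C" "\<forall>\<^sub>F n in sequentially. ennreal (a n) \<le> ennreal C * ennreal (b n)"
    using assms(1) unfolding lesssim_def by blast
  from C(2) nonneg have "\<forall>\<^sub>F n in sequentially. a n \<le> C * b n"
  proof eventually_elim
    case (elim n)
    then have "ennreal (a n) \<le> ennreal (C * b n)" using C(1) by (simp add: ennreal_mult')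
    then show ?case using C(1) elim(2) by (simp add: ennreal_le_iff)
  qed
  with C(1) show ?thesis by (rule that)
qed

lemma same_orderE:
  assumes "same_order a b" "\<forall>\<^sub>F n in sequentially. 0 \<le> a n" "\<forall>\<^sub>F n in sequentially. 0 \<le> b n"
  obtains C c where "0 < C" "\<forall>\<^sub>F n in sequentially. a n \<le> C * b n"
    "0 < c" "\<forall>\<^sub>F n in sequentially. b n \<le> c * a n"
proof -
  obtain C where C: "0 < C" "\<forall>\<^sub>F n in sequentially. a n \<le> C * b n"
    using assms(1,3) unfolding same_order_def by (blast elim: lesssim_realE)
  obtain c where c: "0 < c" "\<forall>\<^sub>F n in sequentially. b n \<le> c * a n"
    using assms(1,2) unfolding same_order_def by (blast elim: lesssim_realE)
  show ?thesis by (rule that[OF C c])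
qed

lemma moment4_le:
  assumes "prob_space M" and f: "f \<in> borel_measurable M" and k: "1 \<le> k"
    and moment: "(\<integral>\<^sup>+x. ennreal (\<bar>f x :: real\<bar> ^ (4 * k)) \<partial>M) \<le> ennreal \<eta>" and \<eta>: "0 \<le> \<eta>"
  shows "(\<integral>\<^sup>+x. ennreal (f x ^ 4) \<partial>M) \<le> ennreal (1 + \<eta>)"
proof -
  interpret prob_space M by fact
  have le: "f x ^ 4 \<le> 1 + \<bar>f x\<bar> ^ (4 * k)" for x
  proof (cases "\<bar>f x\<bar> \<le> 1")
    case True
    then have "\<bar>f x\<bar> ^ 4 \<le> 1" by (intro power_le_one) auto
    moreover have "f x ^ 4 = \<bar>f x\<bar> ^ 4" by simp
    ultimately show ?thesis using zero_le_power[OF abs_ge_zero, of "f x" "4 * k"] by linarith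
  next
    case False
    then have "\<bar>f x\<bar> ^ 4 \<le> \<bar>f x\<bar> ^ (4 * k)" using k by (intro power_increasing) auto
    then show ?thesis by simp
  qed
  have "(\<integral>\<^sup>+x. ennreal (f x ^ 4) \<partial>M) \<le> (\<integral>\<^sup>+x. 1 + ennreal (\<bar>f x\<bar> ^ (4 * k)) \<partial>M)"
  proof (rule nn_integral_mono)
    fix x
    have "ennreal (f x ^ 4) \<le> ennreal (1 + \<bar>f x\<bar> ^ (4 * k))" by (rule ennreal_leI[OF le])
    then show "ennreal (f x ^ 4) \<le> 1 + ennreal (\<bar>f x\<bar> ^ (4 * k))" by simp
  qed
  also have "\<dots> = 1 + (\<integral>\<^sup>+x. ennreal (\<bar>f x\<bar> ^ (4 * k)) \<partial>M)"
    using f by (simp add: nn_integral_add emeasure_space_1)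
  also have "\<dots> \<le> 1 + ennreal \<eta>" by (intro add_left_mono moment)
  finally show ?thesis using \<eta> by simp
qed

lemma sobolev_weight_mono:
  assumes "0 \<le> p" "1 \<le> i" "i \<le> j"
  shows "sobolev_weight p i \<le> sobolev_weight p j"
proof (cases "i = 1")
  case True
  then show ?thesis using sobolev_weight_ge_1[of p j] assms by (simp add: sobolev_weight_def)
next
  case False
  have "real (i div 2) \<le> real (j div 2)" using assms by (simp add: div_le_mono)
  then have "real (i div 2) powr (2 * p) \<le> real (j div 2) powr (2 * p)"
    using assms by (intro powr_mono2) auto
  then show ?thesis using False assms by (simp add: sobolev_weight_def)
qed

text \<open>The constant 3 comes from \<open>j div 2 \<ge> j / 3\<close>, with equality at \<open>j = 3\<close>.\<close>

lemma sobolev_weight_ge_powr: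
  assumes "0 \<le> p" "2 \<le> j"
  shows "(real j / 3) powr (2 * p) \<le> sobolev_weight p j"
proof -
  have "j \<le> 3 * (j div 2)" using assms by presburger
  then have "real j \<le> real (3 * (j div 2))" by (simp only: of_nat_le_iff)
  then have "real j / 3 \<le> real (j div 2)" by simp
  then have "(real j / 3) powr (2 * p) \<le> real (j div 2) powr (2 * p)"
    using assms by (intro powr_mono2) auto
  then show ?thesis using assms by (simp add: sobolev_weight_def)
qed

lemma sobolev_weight_le_powr:
  assumes "0 \<le> p" "1 \<le> j"
  shows "sobolev_weight p j \<le> real j powr (2 * p)"
  using assms by (auto simp: sobolev_weight_def intro!: powr_mono2)

context functional_linear_sample
begin

lemma risk_lesssim:
  assumes p: "0 \<le> p" and \<rho>: "0 \<le> \<rho>" and m: "\<forall>n\<ge>1. 1 \<le> m n"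
    and \<alpha>: "same_order \<alpha> (\<lambda>n. 1 / real n)"  "\<forall>n\<ge>1. 0 < \<alpha> n"
    and s: "\<And>n. 0 \<le> s n" and bias: "\<forall>\<^sub>F n in sequentially. \<forall>j>m n. lam j \<le> s n * sobolev_weight p j"
    and AB: "0 < A" "0 \<le> B" and r: "\<And>n. 0 \<le> r n"
    and variance_rate: "\<forall>\<^sub>F n in sequentially. real (m n) / real n \<le> A * r n"
    and bias_rate: "\<forall>\<^sub>F n in sequentially. s n \<le> B * r n"
  shows "lesssim (\<lambda>n. SUP \<beta>\<in>sobolev_ellipsoid p \<rho>. prediction_risk M X N es Xs \<sigma> n (m n) (\<alpha> n) \<beta>)
    (\<lambda>n. ennreal (r n))"
proof -
  have "\<forall>\<^sub>F n in sequentially. 0 \<le> \<alpha> n"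
    using eventually_ge_at_top[of 1] by eventually_elim (use \<alpha>(2) in \<open>simp add: less_imp_le\<close>)
  then obtain C c where C: "0 < C" "\<forall>\<^sub>F n in sequentially. \<alpha> n \<le> C * (1 / real n)"
    and c: "0 < c" "\<forall>\<^sub>F n in sequentially. 1 / real n \<le> c * \<alpha> n"
    using \<alpha>(1) by (elim same_orderE) auto
  obtain R where R: "0 < R" and risk: "\<And>n m \<alpha> s \<beta>. 1 \<le> n \<Longrightarrow> 1 \<le> m \<Longrightarrow> 1 / c / real n \<le> \<alpha> \<Longrightarrow>
      \<alpha> \<le> C / real n \<Longrightarrow> 0 \<le> s \<Longrightarrow> \<forall>j>m. lam j \<le> s * sobolev_weight p j \<Longrightarrow>
      \<beta> \<in> sobolev_ellipsoid p \<rho> \<Longrightarrow>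
      prediction_risk M X N es Xs \<sigma> n m \<alpha> \<beta> \<le> ennreal (R * (real m / real n) + \<rho> * s)"
    using risk_bound[OF p \<rho>, of "1 / c" C] c(1) C(1) by (auto simp del: of_nat_le_iff)
  show ?thesis
    unfolding lesssim_def
  proof (intro exI[of _ "R * A + \<rho> * B"] conjI)
    show "0 < R * A + \<rho> * B" using R AB \<rho> by (intro add_pos_nonneg) auto
    show "\<forall>\<^sub>F n in sequentially.
        (SUP \<beta>\<in>sobolev_ellipsoid p \<rho>. prediction_risk M X N es Xs \<sigma> n (m n) (\<alpha> n) \<beta>)
        \<le> ennreal (R * A + \<rho> * B) * ennreal (r n)"
      using C(2) c(2) bias variance_rate bias_rate eventually_ge_at_top[of 1]
    proof eventually_elim
      case (elim n)
      have "1 / c / real n = 1 / real n / c" by simp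
      also have "\<dots> \<le> \<alpha> n" using elim(2) c(1) by (subst pos_divide_le_eq) (simp_all add: mult.commute)
      finally have \<alpha>n: "1 / c / real n \<le> \<alpha> n" "\<alpha> n \<le> C / real n" using elim(1) by simp_all
      have "R * (real (m n) / real n) + \<rho> * s n \<le> R * (A * r n) + \<rho> * (B * r n)"
        using elim(4,5) R \<rho> by (intro add_mono mult_left_mono) auto
      also have "\<dots> = (R * A + \<rho> * B) * r n" by (simp add: algebra_simps)
      finally have "ennreal (R * (real (m n) / real n) + \<rho> * s n) \<le> ennreal ((R * A + \<rho> * B) * r n)"
        by (rule ennreal_leI)
      also have "\<dots> = ennreal (R * A + \<rho> * B) * ennreal (r n)"
        using R AB \<rho> by (intro ennreal_mult') auto
      finally show ?case
        using risk[OF elim(6) _ \<alpha>n s elim(3)] m elim(6) by (intro SUP_least) (auto intro: order_trans)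
    qed
  qed
qed

text \<open>The variance term \<open>m / n\<close> and the bias \<open>m\<close> to the power \<open>- (2 * p + 2 * a)\<close> are of the same
  order exactly for \<open>m\<close> of the order of \<open>n\<close> to the power \<open>1 / (2 * p + 2 * a + 1)\<close>.\<close>

lemma polynomial_rate:
  assumes d: "0 < d" and eigs: "lam \<in> eigval_class \<upsilon> d" and p: "0 \<le> p" and \<rho>: "0 \<le> \<rho>"
    and a: "0 < a" and \<upsilon>: "\<forall>j\<ge>2. \<upsilon> j = real j powr (- (2 * a))"
    and m: "\<forall>n\<ge>1. 1 \<le> m n" and \<alpha>: "same_order \<alpha> (\<lambda>n. 1 / real n)" "\<forall>n\<ge>1. 0 < \<alpha> n"
    and order_m: "same_order (\<lambda>n. real (m n)) (\<lambda>n. real n powr (1 / (2 * p + 2 * a + 1)))"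
  shows "lesssim (\<lambda>n. SUP \<beta>\<in>sobolev_ellipsoid p \<rho>. prediction_risk M X N es Xs \<sigma> n (m n) (\<alpha> n) \<beta>)
    (\<lambda>n. ennreal (real n powr (- ((2 * p + 2 * a) / (2 * p + 2 * a + 1)))))"
proof -
  define q where "q = 2 * p + 2 * a + 1"
  have q: "0 < q" using p a by (simp add: q_def)
  obtain A A' where A: "0 < A" "\<forall>\<^sub>F n in sequentially. real (m n) \<le> A * (real n powr (1 / q))"
    and A': "0 < A'" "\<forall>\<^sub>F n in sequentially. real n powr (1 / q) \<le> A' * real (m n)"
    using order_m unfolding q_def[symmetric] by (elim same_orderE) auto
  define s where "s n = d * 3 powr (2 * p) * real (m n) powr (- (2 * p + 2 * a))" for n
  have "lesssim (\<lambda>n. SUP \<beta>\<in>sobolev_ellipsoid p \<rho>. prediction_risk M X N es Xs \<sigma> n (m n) (\<alpha> n) \<beta>)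
    (\<lambda>n. ennreal (real n powr (- ((2 * p + 2 * a) / q))))"
  proof (rule risk_lesssim[OF p \<rho> m \<alpha>, where s = s and A = A and B = "d * 3 powr (2 * p) * A' powr (2 * p + 2 * a)"])
    show "0 \<le> s n" for n using d by (simp add: s_def)
    show "\<forall>\<^sub>F n in sequentially. \<forall>j>m n. lam j \<le> s n * sobolev_weight p j"
      using eventually_ge_at_top[of 1]
    proof eventually_elim
      case (elim n)
      then have mn: "1 \<le> m n" using m by simp
      show ?case
      proof (intro allI impI)
        fix j assume j: "m n < j"
        then have j2: "2 \<le> j" using mn by simp
        have "lam j / \<upsilon> j \<le> d" using eigs j2 by (simp add: eigval_class_def)
        then have "lam j \<le> d * real j powr (- (2 * a))"
          using \<upsilon> j2 by (simp add: pos_divide_le_eq)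
        also have "real j powr (- (2 * a)) = 3 powr (2 * p) * (real j powr (- (2 * p + 2 * a)) * (real j / 3) powr (2 * p))"
          using j2 by (simp add: powr_divide powr_add[symmetric] del: powr_minus)
        also have "\<dots> \<le> 3 powr (2 * p) * (real (m n) powr (- (2 * p + 2 * a)) * sobolev_weight p j)"
          using j mn p a j2 by (intro mult_left_mono mult_mono powr_mono2' sobolev_weight_ge_powr) auto
        finally show "lam j \<le> s n * sobolev_weight p j" using d by (simp add: s_def mult_ac)
      qed
    qed
    show "\<forall>\<^sub>F n in sequentially. real (m n) / real n \<le> A * real n powr (- ((2 * p + 2 * a) / q))"
      using A(2) eventually_ge_at_top[of 1]
    proof eventually_elim
      case (elim n)
      have "real (m n) / real n \<le> A * (real n powr (1 / q)) / real n"
        using elim by (intro divide_right_mono) auto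
      also have "\<dots> = A * (real n powr (1 / q - 1))" using elim by (simp add: powr_diff)
      also have "1 / q - 1 = - ((2 * p + 2 * a) / q)" using q by (simp add: q_def field_simps)
      finally show ?case .
    qed
    show "\<forall>\<^sub>F n in sequentially. s n \<le> d * 3 powr (2 * p) * A' powr (2 * p + 2 * a) * real n powr (- ((2 * p + 2 * a) / q))"
      using A'(2) eventually_ge_at_top[of 1]
    proof eventually_elim
      case (elim n)
      have "real n powr (1 / q) / A' \<le> real (m n)" using elim A' by (simp add: divide_le_eq mult.commute)
      then have "real (m n) powr (- (2 * p + 2 * a)) \<le> (real n powr (1 / q) / A') powr (- (2 * p + 2 * a))"
        using elim p a A' by (intro powr_mono2') auto
      also have "\<dots> = A' powr (2 * p + 2 * a) * real n powr (- ((2 * p + 2 * a) / q))"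
      proof -
        have "(x powr (1 / q) / y) powr (- u) = y powr u * x powr (- (u / q))"
          if "0 < y" for x y u :: real
          using that by (simp add: powr_divide powr_powr powr_minus_divide)
        from this[OF A'(1)] show ?thesis .
      qed
      finally show ?case using d by (simp add: s_def mult.assoc mult_left_mono)
    qed
  qed (use A d in auto)
  then show ?thesis by (simp add: q_def)
qed

text \<open>The order of \<open>m\<close> alone does not determine the order of the eigenvalues beyond \<open>m\<close>. But these
  are bounded by a multiple of the eigenvalue at \<open>kstar\<close>, because \<open>kstar \<le> m\<close>, and the defining inequality of
  \<open>kstar\<close> bounds the ratio of that eigenvalue and the weight by a multiple of \<open>kstar / n\<close>.\<close>

lemma exponential_rate:
  assumes d: "0 < d" and eigs: "lam \<in> eigval_class \<upsilon> d" and p: "0 \<le> p" and \<rho>: "0 \<le> \<rho>"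
    and a: "0 < a" and \<upsilon>1: "\<upsilon> 1 = 1" and \<upsilon>: "\<forall>j\<ge>2. \<upsilon> j = exp (- (real j powr (2 * a)))" and D: "0 < D"
    and kstar: "\<forall>n\<ge>1. 1 \<le> kstar n \<and> sobolev_weight p (kstar n) / (real n * \<upsilon> (kstar n)) * real (kstar n) \<ge> 1 / D"
    and m: "\<forall>n\<ge>1. 1 \<le> m n" and \<alpha>: "same_order \<alpha> (\<lambda>n. 1 / real n)" "\<forall>n\<ge>1. 0 < \<alpha> n"
    and kstar_m: "\<forall>\<^sub>F n in sequentially. kstar n \<le> m n"
    and order_m: "same_order (\<lambda>n. real (m n)) (\<lambda>n. ln (real n) powr (1 / (2 * a)))"
  shows "lesssim (\<lambda>n. SUP \<beta>\<in>sobolev_ellipsoid p \<rho>. prediction_risk M X N es Xs \<sigma> n (m n) (\<alpha> n) \<beta>)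
    (\<lambda>n. ennreal (1 / real n * ln (real n) powr (1 / (2 * a))))"
proof -
  let ?L = "\<lambda>n. ln (real n) powr (1 / (2 * a))"
  have \<upsilon>_pos: "0 < \<upsilon> j" if "1 \<le> j" for j
    using \<upsilon> \<upsilon>1 that by (cases "j = 1") auto
  have \<upsilon>_antimono: "\<upsilon> j \<le> \<upsilon> i" if "1 \<le> i" "i \<le> j" for i j
  proof (cases "j = 1")
    case False
    then have j: "2 \<le> j" using that by simp
    show ?thesis
    proof (cases "i = 1")
      case False
      then have "real i powr (2 * a) \<le> real j powr (2 * a)" using that a by (intro powr_mono2) auto
      then show ?thesis using \<upsilon> j False that by simp
    qed (use \<upsilon>1 \<upsilon> j in simp)
  qed (use that in simp)
  obtain A where A: "0 < A" "\<forall>\<^sub>F n in sequentially. real (m n) \<le> A * ?L n"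
    using order_m by (elim same_orderE) auto
  define s where "s n = d * \<bar>\<upsilon> (kstar n)\<bar> / sobolev_weight p (kstar n)" for n
  show ?thesis
  proof (rule risk_lesssim[OF p \<rho> m \<alpha>, where s = s and A = A and B = "d * D * A"])
    show "0 \<le> s n" for n using d by (simp add: s_def sobolev_weight_def)
    show "\<forall>\<^sub>F n in sequentially. \<forall>j>m n. lam j \<le> s n * sobolev_weight p j"
      using kstar_m eventually_ge_at_top[of 1]
    proof eventually_elim
      case (elim n)
      have k1: "1 \<le> kstar n" using kstar elim by simp
      have w: "1 \<le> sobolev_weight p (kstar n)" by (rule sobolev_weight_ge_1[OF p k1])
      show ?case
      proof (intro allI impI)
        fix j assume "m n < j"
        then have j: "kstar n \<le> j" "1 \<le> j" using elim by auto
        have "lam j / \<upsilon> j \<le> d" using eigs j by (simp add: eigval_class_def)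
        then have "lam j \<le> d * \<upsilon> j" using \<upsilon>_pos[OF j(2)] by (simp add: pos_divide_le_eq)
        also have "\<dots> \<le> d * \<upsilon> (kstar n)" using \<upsilon>_antimono[OF k1 j(1)] d by (intro mult_left_mono) auto
        also have "\<dots> = s n * sobolev_weight p (kstar n)" using \<upsilon>_pos[OF k1] w by (simp add: s_def)
        also have "\<dots> \<le> s n * sobolev_weight p j"
          using sobolev_weight_mono[OF p k1 j(1)] d w by (intro mult_left_mono) (auto simp: s_def)
        finally show "lam j \<le> s n * sobolev_weight p j" .
      qed
    qed
    show "\<forall>\<^sub>F n in sequentially. real (m n) / real n \<le> A * (1 / real n * ?L n)"
      using A(2) by eventually_elim (simp add: divide_right_mono)
    show "\<forall>\<^sub>F n in sequentially. s n \<le> d * D * A * (1 / real n * ?L n)"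
      using A(2) kstar_m eventually_ge_at_top[of 1]
    proof eventually_elim
      case (elim n)
      have k1: "1 \<le> kstar n" and k: "1 / D \<le> sobolev_weight p (kstar n) / (real n * \<upsilon> (kstar n)) * real (kstar n)"
        using kstar elim by auto
      have w: "1 \<le> sobolev_weight p (kstar n)" by (rule sobolev_weight_ge_1[OF p k1])
      have u: "0 < \<upsilon> (kstar n)" by (rule \<upsilon>_pos[OF k1])
      have "\<upsilon> (kstar n) / sobolev_weight p (kstar n) \<le> D * real (kstar n) / real n"
        using k w u D elim(3) by (simp add: field_simps)
      also have "\<dots> \<le> D * (A * ?L n) / real n"
        using elim D by (intro divide_right_mono mult_left_mono) auto
      finally have "d * (\<upsilon> (kstar n) / sobolev_weight p (kstar n)) \<le> d * (D * (A * ?L n) / real n)"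
        using d by (intro mult_left_mono) auto
      then show ?case using u by (simp add: s_def mult.assoc)
    qed
  qed (use A d D in auto)
qed

end

text \<open>Taking logarithms in the balance condition, \<open>kstar\<close> to the power \<open>2 * a\<close> equals \<open>ln n\<close> up to a
  constant and a multiple of \<open>ln kstar\<close>, both of smaller order.\<close>

lemma kstar_order_exponential:
  assumes p: "0 \<le> p" and a: "0 < a" and \<upsilon>1: "\<upsilon> 1 = 1"
    and \<upsilon>: "\<forall>j\<ge>2. \<upsilon> j = exp (- (real j powr (2 * a)))" and D: "1 \<le> D"
    and kstar: "\<forall>n\<ge>1. 1 \<le> kstar n \<and>
      1 / D \<le> sobolev_weight p (kstar n) / (real n * \<upsilon> (kstar n)) * real (kstar n) \<and>
      sobolev_weight p (kstar n) / (real n * \<upsilon> (kstar n)) * real (kstar n) \<le> D"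
  shows "same_order (\<lambda>n. real (kstar n)) (\<lambda>n. ln (real n) powr (1 / (2 * a)))"
  unfolding same_order_def
proof
  let ?L = "\<lambda>n. ln (real n) powr (1 / (2 * a))"
  have root: "(real k powr (2 * a)) powr (1 / (2 * a)) = real k" if "1 \<le> k" for k
    using that a by (simp add: powr_powr)
  \<comment> \<open>\<open>exp 1\<close> makes the logarithm at least one, and \<open>D\<^sup>2\<close> makes it at least twice \<open>ln D\<close>\<close>
  have large: "\<forall>\<^sub>F n in sequentially. exp 1 + D\<^sup>2 \<le> real n"
    using filterlim_real_sequentially by (simp add: filterlim_at_top)
  have basics: "1 \<le> n" "1 \<le> ln (real n)" "ln D \<le> ln (real n) / 2" if n: "exp 1 + D\<^sup>2 \<le> real n" for n
  proof -
    have "D\<^sup>2 \<le> real n" "exp 1 \<le> real n" using n D exp_gt_zero[of "1::real"] zero_le_power2[of D] by linarith+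
    moreover have "0 < real n" using \<open>exp 1 \<le> real n\<close> exp_gt_zero[of "1::real"] by linarith
    ultimately show "1 \<le> n" "1 \<le> ln (real n)" by (simp_all add: ln_ge_iff)
    have "ln (D\<^sup>2) \<le> ln (real n)" using \<open>D\<^sup>2 \<le> real n\<close> D \<open>0 < real n\<close> by simp
    then show "ln D \<le> ln (real n) / 2" using D by (simp add: ln_realpow)
  qed
  show "lesssim (\<lambda>n. ennreal (real (kstar n))) (\<lambda>n. ennreal (?L n))"
  proof (rule lesssim_realI[of "2 powr (1 / (2 * a))"])
    show "\<forall>\<^sub>F n in sequentially. real (kstar n) \<le> 2 powr (1 / (2 * a)) * ?L n"
      using large
    proof eventually_elim
      case (elim n)
      note n = basics[OF elim]
      define k where "k = kstar n"
      have k: "1 \<le> k" "sobolev_weight p k / (real n * \<upsilon> k) * real k \<le> D" using kstar n by (auto simp: k_def)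
      have "real k powr (2 * a) \<le> 2 * ln (real n)"
      proof (cases "k = 1")
        case False
        then have \<upsilon>k: "\<upsilon> k = exp (- (real k powr (2 * a)))" using \<upsilon> k by simp
        have "1 * 1 \<le> sobolev_weight p k * real k"
          using sobolev_weight_ge_1[OF p k(1)] k(1) by (intro mult_mono) auto
        then have "1 / (real n * \<upsilon> k) \<le> sobolev_weight p k * real k / (real n * \<upsilon> k)"
          by (intro divide_right_mono) (auto simp: \<upsilon>k)
        then have "1 / (real n * \<upsilon> k) \<le> D" using k(2) by simp
        then have "exp (real k powr (2 * a)) \<le> D * real n"
          using n by (simp add: \<upsilon>k exp_minus field_simps)
        then have "ln (exp (real k powr (2 * a))) \<le> ln (D * real n)"
          by (intro ln_mono) auto
        then have "real k powr (2 * a) \<le> ln D + ln (real n)" using D n by (simp add: ln_mult)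
        then show ?thesis using n by linarith
      qed (use n in simp)
      then have "(real k powr (2 * a)) powr (1 / (2 * a)) \<le> (2 * ln (real n)) powr (1 / (2 * a))"
        using a by (intro powr_mono2) auto
      then show ?case using root[OF k(1)] n by (simp add: powr_mult k_def)
    qed
  qed simp
  define B where "B = (2 * p + 1) / (2 * a) + 1"
  have B: "0 < B" using p a by (simp add: B_def add_pos_pos)
  show "lesssim (\<lambda>n. ennreal (?L n)) (\<lambda>n. ennreal (real (kstar n)))"
  proof (rule lesssim_realI[of "(2 * B) powr (1 / (2 * a))"])
    show "\<forall>\<^sub>F n in sequentially. ?L n \<le> (2 * B) powr (1 / (2 * a)) * real (kstar n)"
      using large
    proof eventually_elim
      case (elim n)
      note n = basics[OF elim]
      define k where "k = kstar n"
      have k: "1 \<le> k" "1 / D \<le> sobolev_weight p k / (real n * \<upsilon> k) * real k" using kstar n by (auto simp: k_def)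
      have \<upsilon>k: "exp (- (real k powr (2 * a))) \<le> \<upsilon> k" using \<upsilon> \<upsilon>1 k by (cases "k = 1") auto
      have \<upsilon>k0: "0 < \<upsilon> k" by (rule less_le_trans[OF exp_gt_zero \<upsilon>k])
      have "exp (- (real k powr (2 * a))) * real n \<le> \<upsilon> k * real n" using \<upsilon>k by (intro mult_right_mono) auto
      also have "\<dots> \<le> D * (sobolev_weight p k * real k)"
        using k(2) D n \<upsilon>k0 by (simp add: field_simps)
      also have "\<dots> \<le> D * (real k powr (2 * p) * real k)"
        using sobolev_weight_le_powr[OF p k(1)] D by (intro mult_left_mono mult_right_mono) auto
      also have "\<dots> = D * real k powr (2 * p + 1)" using k(1) by (simp add: powr_add)
      finally have "ln (exp (- (real k powr (2 * a))) * real n) \<le> ln (D * real k powr (2 * p + 1))"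
        using n by (intro ln_mono) auto
      then have "ln (real n) \<le> real k powr (2 * a) + ln D + (2 * p + 1) * ln (real k)"
        using n D k(1) by (simp add: ln_mult ln_powr)
      moreover have "(2 * p + 1) * ln (real k) \<le> (2 * p + 1) / (2 * a) * real k powr (2 * a)"
      proof -
        have "2 * a * ln (real k) \<le> real k powr (2 * a)"
          using ln_le_minus_one[of "real k powr (2 * a)"] k(1) by (simp add: ln_powr)
        then have "(2 * p + 1) / (2 * a) * (2 * a * ln (real k)) \<le> (2 * p + 1) / (2 * a) * real k powr (2 * a)"
          using p a by (intro mult_left_mono) auto
        then show ?thesis using a by simp
      qed
      moreover have "B * real k powr (2 * a) = (2 * p + 1) / (2 * a) * real k powr (2 * a) + real k powr (2 * a)"
        by (simp only: B_def distrib_right mult_1)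
      ultimately have "ln (real n) \<le> 2 * (B * real k powr (2 * a))"
        using n(3) by linarith
      then have "ln (real n) powr (1 / (2 * a)) \<le> (2 * B * real k powr (2 * a)) powr (1 / (2 * a))"
        using n a by (intro powr_mono2) auto
      also have "\<dots> = (2 * B) powr (1 / (2 * a)) * real k"
        using B root[OF k(1)] by (simp add: powr_mult)
      finally show ?case by (simp add: k_def)
    qed
  qed (use B in simp)
qed

theorem proposition4p2:
  fixes M :: "'a measure" and e :: "'a \<Rightarrow> real" and X :: "'a \<Rightarrow> real \<Rightarrow> real"
    and N :: "'b measure" and es :: "nat \<Rightarrow> 'b \<Rightarrow> real" and Xs :: "nat \<Rightarrow> 'b \<Rightarrow> real \<Rightarrow> real"
    and \<sigma> \<eta> d p \<rho> \<D> :: real and k :: nat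
    and \<upsilon> \<gamma> \<omega> :: "nat \<Rightarrow> real" and kstar :: "nat \<Rightarrow> nat"
  assumes "prob_space M" and "prob_space N"
    and "\<sigma> > 0" and "d \<ge> 1" and "k \<ge> 4" and "\<eta> \<ge> 1" and "p \<ge> 0" and "\<rho> > 0" and "\<D> \<ge> 1"
    and "X \<in> regressors_moment M (4 * k) \<eta>"
    and "trig_diagonal M X"
    and "eigval M X \<in> eigval_class \<upsilon> d"
    and "e \<in> errors_moment M (4 * k) \<eta>"
    and "uncorrelated M e X"
    and "iid_copies M e X N es Xs"
    and "\<gamma> = sobolev_weight p" and "\<omega> = \<upsilon>"
    and "\<forall>n\<ge>1. kstar n \<ge> 1 \<and>
           1 / \<D> \<le> \<gamma> (kstar n) / (real n * \<omega> (kstar n)) * (\<Sum>j=1..kstar n. \<omega> j / \<upsilon> j) \<and>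
           \<gamma> (kstar n) / (real n * \<omega> (kstar n)) * (\<Sum>j=1..kstar n. \<omega> j / \<upsilon> j) \<le> \<D>"
  shows
    "(\<forall>a. a > 1 / 2 \<and> \<upsilon> 1 = 1 \<and> (\<forall>j\<ge>2. \<upsilon> j = real j powr (- (2 * a))) \<longrightarrow>
       (\<forall>m \<alpha>. (\<forall>n\<ge>1. m n \<ge> 1 \<and> \<alpha> n > 0) \<and>
          same_order (\<lambda>n. real (m n)) (\<lambda>n. real n powr (1 / (2 * p + 2 * a + 1))) \<and>
          same_order \<alpha> (\<lambda>n. 1 / real n) \<longrightarrow>
          lesssim
            (\<lambda>n. SUP \<beta>\<in>sobolev_ellipsoid p \<rho>. prediction_risk M X N es Xs \<sigma> n (m n) (\<alpha> n) \<beta>)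
            (\<lambda>n. ennreal (real n powr (- ((2 * p + 2 * a) / (2 * p + 2 * a + 1)))))))
     \<and>
     (\<forall>a. a > 0 \<and> \<upsilon> 1 = 1 \<and> (\<forall>j\<ge>2. \<upsilon> j = exp (- (real j powr (2 * a)))) \<longrightarrow>
       same_order (\<lambda>n. real (kstar n)) (\<lambda>n. ln (real n) powr (1 / (2 * a))) \<and>
       (\<forall>m \<alpha>. (\<forall>n\<ge>1. m n \<ge> 1 \<and> \<alpha> n > 0) \<and>
          same_order (\<lambda>n. real (m n)) (\<lambda>n. ln (real n) powr (1 / (2 * a))) \<and>
          (\<forall>\<^sub>F n in sequentially. kstar n \<le> m n) \<and>
          same_order \<alpha> (\<lambda>n. 1 / real n) \<longrightarrow>
          lesssim
            (\<lambda>n. SUP \<beta>\<in>sobolev_ellipsoid p \<rho>. prediction_risk M X N es Xs \<sigma> n (m n) (\<alpha> n) \<beta>)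
            (\<lambda>n. ennreal (1 / real n * ln (real n) powr (1 / (2 * a))))))"
proof -
  have X: "X \<in> regressors M" using assms(10) by (simp add: regressors_moment_def)
  interpret R: stationary_regressor M X
    using assms(1,11) X by (simp add: stationary_regressor_def stationary_regressor_axioms_def)
  \<comment> \<open>\<open>z ^ 4 \<le> 1 + \<bar>z\<bar> ^ (4 * k)\<close> turns the assumed moments into fourth moments\<close>
  interpret functional_linear_sample M X N e es Xs \<sigma> "1 + \<eta>"
  proof (intro functional_linear_sample.intro functional_linear_sample_axioms.intro)
    show "stationary_regressor M X" ..
    show e: "e \<in> borel_measurable M" using assms(13) by (simp add: errors_moment_def)
    show "(\<integral>\<^sup>+x. ennreal (e x ^ 4) \<partial>M) \<le> ennreal (1 + \<eta>)"
      using assms(5,6,13) by (intro moment4_le[OF assms(1) e, of k]) (auto simp: errors_moment_def)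
    show "(\<integral>\<^sup>+x. ennreal ((ip (X x) (psi j) / sqrt (eigval M X j)) ^ 4) \<partial>M) \<le> ennreal (1 + \<eta>)" if "1 \<le> j" for j
    proof (rule moment4_le[OF assms(1), of _ k])
      show "(\<lambda>x. ip (X x) (psi j) / sqrt (eigval M X j)) \<in> borel_measurable M"
        using R.measurable_ip_X[OF psi_L2[of j]] by simp
      have "(\<integral>\<^sup>+x. ennreal (\<bar>ip (X x) (psi j) / sqrt (eigval M X j)\<bar> ^ (4 * k)) \<partial>M)
        \<le> (SUP j\<in>{1..}. \<integral>\<^sup>+x. ennreal (\<bar>ip (X x) (psi j) / sqrt (eigval M X j)\<bar> ^ (4 * k)) \<partial>M)"
        using that by (intro SUP_upper) auto
      also have "\<dots> \<le> ennreal \<eta>" using assms(10) by (simp add: regressors_moment_def)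
      finally show "(\<integral>\<^sup>+x. ennreal (\<bar>ip (X x) (psi j) / sqrt (eigval M X j)\<bar> ^ (4 * k)) \<partial>M) \<le> ennreal \<eta>" .
    qed (use assms(5,6) in auto)
  qed (use assms in auto)
  have d: "0 < d" and \<rho>: "0 \<le> \<rho>" and D: "0 < \<D>" using assms(4,8,9) by auto
  show ?thesis
  proof (intro conjI allI impI)
    fix a m \<alpha>
    assume a: "1 / 2 < a \<and> \<upsilon> 1 = 1 \<and> (\<forall>j\<ge>2. \<upsilon> j = real j powr (- (2 * a)))"
      and m: "(\<forall>n\<ge>1. 1 \<le> m n \<and> 0 < \<alpha> n) \<and>
        same_order (\<lambda>n. real (m n)) (\<lambda>n. real n powr (1 / (2 * p + 2 * a + 1))) \<and> same_order \<alpha> (\<lambda>n. 1 / real n)"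
    show "lesssim (\<lambda>n. SUP \<beta>\<in>sobolev_ellipsoid p \<rho>. prediction_risk M X N es Xs \<sigma> n (m n) (\<alpha> n) \<beta>)
      (\<lambda>n. ennreal (real n powr (- ((2 * p + 2 * a) / (2 * p + 2 * a + 1)))))"
      by (rule polynomial_rate[OF d assms(12) assms(7) \<rho>, of a]) (use a m in auto)
  next
    fix a
    assume a: "0 < a \<and> \<upsilon> 1 = 1 \<and> (\<forall>j\<ge>2. \<upsilon> j = exp (- (real j powr (2 * a))))"
    have \<upsilon>_pos: "0 < \<upsilon> j" if "1 \<le> j" for j
      using a that by (cases "j = 1") auto
    have sum_one: "(\<Sum>j=1..i. \<omega> j / \<upsilon> j) = real i" for i
    proof -
      have "(\<Sum>j=1..i. \<omega> j / \<upsilon> j) = (\<Sum>j=1..i. 1)"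
        using \<upsilon>_pos assms(17) by (intro sum.cong) (auto simp: less_imp_neq[symmetric])
      then show ?thesis by simp
    qed
    have kstar: "\<forall>n\<ge>1. 1 \<le> kstar n \<and>
        1 / \<D> \<le> sobolev_weight p (kstar n) / (real n * \<upsilon> (kstar n)) * real (kstar n) \<and>
        sobolev_weight p (kstar n) / (real n * \<upsilon> (kstar n)) * real (kstar n) \<le> \<D>"
      using assms(18) unfolding sum_one unfolding assms(16,17) .
    show "same_order (\<lambda>n. real (kstar n)) (\<lambda>n. ln (real n) powr (1 / (2 * a)))"
      by (rule kstar_order_exponential[OF assms(7) _ _ _ assms(9) kstar]) (use a in auto)
    fix m \<alpha>
    assume m: "(\<forall>n\<ge>1. 1 \<le> m n \<and> 0 < \<alpha> n) \<and>
        same_order (\<lambda>n. real (m n)) (\<lambda>n. ln (real n) powr (1 / (2 * a))) \<and>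
        (\<forall>\<^sub>F n in sequentially. kstar n \<le> m n) \<and> same_order \<alpha> (\<lambda>n. 1 / real n)"
    show "lesssim (\<lambda>n. SUP \<beta>\<in>sobolev_ellipsoid p \<rho>. prediction_risk M X N es Xs \<sigma> n (m n) (\<alpha> n) \<beta>)
      (\<lambda>n. ennreal (1 / real n * ln (real n) powr (1 / (2 * a))))"
      by (rule exponential_rate[OF d assms(12) assms(7) \<rho> _ _ _ D, where kstar = kstar])
        (use a m kstar in auto)
  qed
qed

end
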